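(* Let $d,e$ be integers with $$752\le d\le e\le \tfrac{1}{648}\,d^2 ,$$ let $R,S\in\mathbb{C}[x,y]$ be polynomials of degrees $\deg R=d$, $\deg S=e$ satisfying the generic geometric conditions (G1)–(G6) listed in the context, and let $X\subset\mathbb{P}^4(\mathbb{C})$ be the surface with affine equations $z^d=R(x,y)$, $t^e=S(x,y)$. Let $m\ge 1$ and $a$ be integers with $a\le d-4m$. For polynomials $$A_{j,k,p,q}(x,y)=\sum_{h+i\le a}A^{h,i}_{j,k,p,q}\,x^hy^i\in\mathbb{C}[x,y]\qquad (j,k,p,q\in\mathbb{N},\ j+k+p+q=m)$$ of degree $\le a$, put $$\mathsf{J}(x,y,x',y')=\sum_{j+k+p+q=m}A_{j,k,p,q}\,(x')^j(y')^k\,\big(x'R_x+y'R_y\big)^p\big(x'S_x+y'S_y\big)^q\,R^{\,m-p}\,S^{\,m-q}.$$ (i) For all such $A_{j,k,p,q}$, if the polynomial $\mathsf{J}$ is divisible by $y^d$ in $\mathbb{C}[x,y,x',y']$, i.e. $\mathsf{J}(x,y,x',y')\equiv y^d\,\widetilde{\mathsf{J}}(x,y,x',y')$, then the restriction to $X$ of the meromorphic jet differential $$\frac{\mathsf{J}(x,y,x',y')}{y^d\,z^{m(d-1)}\,t^{m(e-1)}}$$ is a (global) holomorphic section of $\mathrm{Sym}^m T_X^*$ over $X$. (ii) The divisibility of $\mathsf{J}$ by $y^d$ is a system of linear equations, depending on $R$ and $S$, in the $\frac{(a+1)(a+2)}{2}\cdot\frac{(m+1)(m+2)(m+3)}{1\cdot2\cdot3}$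 coefficients $A^{h,i}_{j,k,p,q}\in\mathbb{C}$. When $m=\lfloor d/12\rfloor$ and $a=d-4m$, its space of solutions has dimension at least $$\frac{1}{93312}\,d^3-\frac{61}{7776}\,d^2-\frac{17}{108}\,d-\frac{28}{27},$$ and one has $$\dim H^0\big(X,\mathrm{Sym}^mT_X^*\big)\ \ge\ \frac{1}{93312}\,d^3-\frac{61}{7776}\,d^2-\frac{17}{108}\,d-\frac{28}{27}.$$
   Context: Homogeneous coordinates on $\mathbb{P}^4$ are $[u_0:u_1:u_2:u_3:u_4]$, with affine coordinates $x=u_1/u_0$, $y=u_2/u_0$, $z=u_3/u_0$, $t=u_4/u_0$ on $\mathbb{C}^4=\{u_0\ne0\}$. The surface $X\subset\mathbb{P}^4$ is defined by the homogenized equations $u_3^d=u_0^dR(u_1/u_0,u_2/u_0)$, $u_4^e=u_0^eS(u_1/u_0,u_2/u_0)$. Subscripts $x,y$ denote partial derivatives. The letters $x',y'$ stand for the differentials $dx,dy$, so that a polynomial homogeneous of degree $m$ in $(x',y')$, with coefficients rational functions on $\mathbb{C}^4$, defines a meromorphic symmetric differential of degree $m$ on $\mathbb{C}^4$, which can be restricted (pulled back) to the surface as a meromorphic section of $\mathrm{Sym}^mT_X^*$. Generic geometric conditions on $(R,S)$ (they are satisfied by generic pairs, up to an affine change of the coordinates $(x,y)$); curves in $\mathbb{C}^2_{xy}$ are also considered through their closures in $\mathbb{P}^2\supset\mathbb{C}^2_{xy}$: (G1) The coefficients of $x^d$ and $y^d$ in $R$ and of $x^e$ and $y^e$ in $S$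 are nonzero. (G2) The two projective curves $\{R=0\}$, $\{S=0\}$ are smooth and intersect transversally in exactly $de$ distinct points of $\mathbb{P}^2$, all situated in $\mathbb{C}^2_{xy}$. (G3) Any two distinct curves among $\{R=0\},\{R_x=0\},\{R_y=0\},\{S=0\},\{S_x=0\},\{S_y=0\}$ (of degrees $d,d-1,d-1,e,e-1,e-1$) intersect transversally in $\mathbb{P}^2$ in a number of distinct points equal to the product of their degrees, all situated in $\mathbb{C}^2_{xy}$, and no three of these six curves have a common point in $\mathbb{P}^2$. (G4) The line $\{y=0\}$ intersects $\{R=0\}$ and $\{S=0\}$ in respectively $d$ and $e$ points of multiplicity $1$ in $\mathbb{C}^2_{xy}$, at which both partial derivatives $R_x,R_y$, respectively $S_x,S_y$, are nonzero. (G5) No point of $\{R=0\}\cap\{S=0\}$ lies on the axis $\{y=0\}$. (G6) $X\cap\{u_0=0\}$ is a smooth curve, and the three sets $X\cap\{u_0=0,\,u_1\neq0\}\cap\{u_2=0\}$, $X\cap\{u_0=0,\,u_1\neq0\}\cap\{u_3=0\}$, $X\cap\{u_0=0,\,u_1\neq0\}\cap\{u_4=0\}$ are finite. *)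

theory Defs
  imports
    "HOL-Analysis.Analysis"
    "HOL-Computational_Algebra.Computational_Algebra"
    "HOL-Library.Function_Algebras"
    "HOL-Library.Extended_Nat"
begin

section \<open>Polynomials in two variables\<close>

text \<open>
  The ring \<open>\<complex>[x,y]\<close> is the iterated ring \<^typ>\<open>complex poly poly\<close>; the inner
  variable is \<open>x\<close> and the outer one is \<open>y\<close>.
\<close>

type_synonym poly_xy = "complex poly poly"

definition coeff_xy :: "poly_xy \<Rightarrow> nat \<Rightarrow> nat \<Rightarrow> complex" where
  "coeff_xy F h i = coeff (coeff F i) h"

definition eval_xy :: "poly_xy \<Rightarrow> complex \<Rightarrow> complex \<Rightarrow> complex" where
  "eval_xy F x y = poly (poly F [:y:]) x"

definition total_degree :: "poly_xy \<Rightarrow> nat" where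
  "total_degree F = (if F = 0 then 0 else Max {h + i | h i. coeff_xy F h i \<noteq> 0})"

definition diff_x :: "poly_xy \<Rightarrow> poly_xy" where
  "diff_x F = map_poly pderiv F"

definition diff_y :: "poly_xy \<Rightarrow> poly_xy" where
  "diff_y F = pderiv F"

text \<open>
  Homogenization \<open>u\<^sub>0\<^bsup>n\<^esup> F(u\<^sub>1/u\<^sub>0, u\<^sub>2/u\<^sub>0)\<close> with \<open>n\<close> the total degree of \<open>F\<close>. It is used
  with \<open>u\<close> in \<open>\<complex>\<^sup>3\<close> and in \<open>\<complex>\<^sup>5\<close>. The summands with \<open>h + i > n\<close> have coefficient zero.
  In the index types \<open>3\<close> and \<open>5\<close> the numerals \<open>0, 1, 2, \<dots>\<close> are the residues, so
  homogeneous coordinates are numbered from \<open>0\<close>.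
\<close>

definition homogenize :: "poly_xy \<Rightarrow> complex ^ 'n::{finite, comm_ring_1} \<Rightarrow> complex" where
  "homogenize F u =
     (\<Sum>i\<le>degree F. \<Sum>h\<le>degree (coeff F i).
        coeff_xy F h i * (u $ 0) ^ (total_degree F - h - i) * (u $ 1) ^ h * (u $ 2) ^ i)"


section \<open>Projective space\<close>

quotient_type 'n proj = "complex ^ ('n::finite)" / partial:
  "\<lambda>u v. u \<noteq> 0 \<and> v \<noteq> 0 \<and> (\<exists>c. c \<noteq> 0 \<and> v = c *s u)"
proof (rule part_equivpI)
  show "\<exists>u :: complex ^ 'n. u \<noteq> 0 \<and> u \<noteq> 0 \<and> (\<exists>c. c \<noteq> 0 \<and> u = c *s u)"
    by (rule exI[of _ 1]) (auto simp: vec_eq_iff intro!: exI[of _ 1])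
next
  show "symp (\<lambda>u v :: complex ^ 'n. u \<noteq> 0 \<and> v \<noteq> 0 \<and> (\<exists>c. c \<noteq> 0 \<and> v = c *s u))"
  proof (rule sympI, elim conjE exE, intro conjI)
    fix u v :: "complex ^ 'n" and c
    assume "c \<noteq> 0" "v = c *s u"
    then have "inverse c \<noteq> 0 \<and> u = inverse c *s v"
      by (simp add: vector_smult_assoc)
    then show "\<exists>c. c \<noteq> 0 \<and> u = c *s v" by blast
  qed
next
  show "transp (\<lambda>u v :: complex ^ 'n. u \<noteq> 0 \<and> v \<noteq> 0 \<and> (\<exists>c. c \<noteq> 0 \<and> v = c *s u))"
    by (rule transpI) (metis no_zero_divisors vector_smult_assoc)
qed

instantiation proj :: (finite) topological_space
begin

definition open_proj :: "'a proj set \<Rightarrow> bool" where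
  "open_proj U \<longleftrightarrow> open {u. u \<noteq> 0 \<and> abs_proj u \<in> U}"

instance
proof
  show "open (UNIV :: 'a proj set)"
    by (simp add: open_proj_def open_Collect_neq)
next
  fix S T :: "'a proj set"
  assume "open S" "open T"
  then have "open ({u. u \<noteq> 0 \<and> abs_proj u \<in> S} \<inter> {u. u \<noteq> 0 \<and> abs_proj u \<in> T})"
    by (simp add: open_proj_def open_Int)
  also have "{u. u \<noteq> 0 \<and> abs_proj u \<in> S} \<inter> {u. u \<noteq> 0 \<and> abs_proj u \<in> T} =
      {u. u \<noteq> 0 \<and> abs_proj u \<in> S \<inter> T}"
    by blast
  finally show "open (S \<inter> T)"
    by (simp add: open_proj_def)
next
  fix K :: "'a proj set set"
  assume "\<forall>S\<in>K. open S"
  then have "open (\<Union>S\<in>K. {u. u \<noteq> 0 \<and> abs_proj u \<in> S})"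
    by (auto simp: open_proj_def)
  also have "(\<Union>S\<in>K. {u. u \<noteq> 0 \<and> abs_proj u \<in> S}) = {u. u \<noteq> 0 \<and> abs_proj u \<in> \<Union>K}"
    by blast
  finally show "open (\<Union>K)"
    by (simp add: open_proj_def)
qed

end

definition affine_part :: "'n::finite \<Rightarrow> 'n proj set" where
  "affine_part i = {p. rep_proj p $ i \<noteq> 0}"

text \<open>
  Affine coordinates \<open>u\<^sub>k / u\<^sub>i\<close>. The redundant coordinate \<open>k = i\<close> is kept, so that
  \<^term>\<open>affine_part i\<close> is identified with the affine hyperplane \<open>w\<^sub>i = 1\<close>.
\<close>

definition affine_coords :: "'n::finite \<Rightarrow> 'n proj \<Rightarrow> complex ^ 'n" where
  "affine_coords i p = (\<chi> k. rep_proj p $ k / rep_proj p $ i)"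

text \<open>In the following definitions the functions \<open>fs\<close> are homogeneous polynomials.\<close>

definition proj_locus :: "(complex ^ 'n::finite \<Rightarrow> complex) list \<Rightarrow> 'n proj set" where
  "proj_locus fs = {abs_proj u | u. u \<noteq> 0 \<and> (\<forall>f\<in>set fs. f u = 0)}"

definition gradient :: "(complex ^ 'n::finite \<Rightarrow> complex) \<Rightarrow> complex ^ 'n \<Rightarrow> complex ^ 'n" where
  "gradient f u = (\<chi> i. deriv (\<lambda>w. f (\<chi> k. if k = i then w else u $ k)) (u $ i))"

text \<open>
  Jacobian criterion. For one function this is smoothness of the hypersurface; for several
  ones it says that the hypersurfaces are smooth and meet transversally along their
  intersection, which is then smooth of the expected dimension.
\<close>

definition smooth_intersection :: "(complex ^ 'n::finite \<Rightarrow> complex) list \<Rightarrow> bool" where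
  "smooth_intersection fs \<longleftrightarrow>
     (\<forall>u. u \<noteq> 0 \<and> (\<forall>f\<in>set fs. f u = 0) \<longrightarrow>
        (\<forall>c. (\<Sum>k<length fs. c k *s gradient (fs ! k) u) = 0 \<longrightarrow> (\<forall>k<length fs. c k = 0)))"


section \<open>The surface and the generic conditions\<close>

definition eqn_z :: "poly_xy \<Rightarrow> complex ^ 5 \<Rightarrow> complex" where
  "eqn_z R u = (u $ 3) ^ total_degree R - homogenize R u"

definition eqn_t :: "poly_xy \<Rightarrow> complex ^ 5 \<Rightarrow> complex" where
  "eqn_t S u = (u $ 4) ^ total_degree S - homogenize S u"

definition surface :: "poly_xy \<Rightarrow> poly_xy \<Rightarrow> 5 proj set" where
  "surface R S = proj_locus [eqn_z R, eqn_t S]"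

definition curve :: "poly_xy \<Rightarrow> 3 proj set" where
  "curve F = proj_locus [homogenize F]"

definition meet_transversally :: "poly_xy \<Rightarrow> poly_xy \<Rightarrow> bool" where
  "meet_transversally F G \<longleftrightarrow>
     smooth_intersection [homogenize F, homogenize G :: complex ^ 3 \<Rightarrow> complex] \<and>
     finite (curve F \<inter> curve G) \<and>
     card (curve F \<inter> curve G) = total_degree F * total_degree G \<and>
     curve F \<inter> curve G \<subseteq> affine_part 0"

definition G1 :: "poly_xy \<Rightarrow> poly_xy \<Rightarrow> bool" where
  "G1 R S \<longleftrightarrow>
     coeff_xy R (total_degree R) 0 \<noteq> 0 \<and> coeff_xy R 0 (total_degree R) \<noteq> 0 \<and>
     coeff_xy S (total_degree S) 0 \<noteq> 0 \<and> coeff_xy S 0 (total_degree S) \<noteq> 0"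

definition G2 :: "poly_xy \<Rightarrow> poly_xy \<Rightarrow> bool" where
  "G2 R S \<longleftrightarrow>
     smooth_intersection [homogenize R :: complex ^ 3 \<Rightarrow> complex] \<and>
     smooth_intersection [homogenize S :: complex ^ 3 \<Rightarrow> complex] \<and>
     meet_transversally R S"

text \<open>Under \<^const>\<open>G1\<close> the derivatives have total degrees \<open>d - 1\<close> and \<open>e - 1\<close>.\<close>

definition G3 :: "poly_xy \<Rightarrow> poly_xy \<Rightarrow> bool" where
  "G3 R S \<longleftrightarrow>
     (let Fs = [R, diff_x R, diff_y R, S, diff_x S, diff_y S] in
       (\<forall>i j. i < j \<and> j < 6 \<longrightarrow> meet_transversally (Fs ! i) (Fs ! j)) \<and>
       (\<forall>i j k. i < j \<and> j < k \<and> k < 6 \<longrightarrow>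
          curve (Fs ! i) \<inter> curve (Fs ! j) \<inter> curve (Fs ! k) = {}))"

text \<open>
  The intersection multiplicity of \<open>{y = 0}\<close> and \<open>{F = 0}\<close> at \<open>(x, 0)\<close> is the order of
  vanishing at \<open>x\<close> of the univariate polynomial \<open>F(\<cdot>, 0)\<close>.
\<close>

definition meets_axis_generically :: "poly_xy \<Rightarrow> bool" where
  "meets_axis_generically F \<longleftrightarrow>
     card {x. eval_xy F x 0 = 0} = total_degree F \<and>
     (\<forall>x. eval_xy F x 0 = 0 \<longrightarrow>
        order x (poly F 0) = 1 \<and> eval_xy (diff_x F) x 0 \<noteq> 0 \<and> eval_xy (diff_y F) x 0 \<noteq> 0)"

definition G4 :: "poly_xy \<Rightarrow> poly_xy \<Rightarrow> bool" where
  "G4 R S \<longleftrightarrow> meets_axis_generically R \<and> meets_axis_generically S"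

definition G5 :: "poly_xy \<Rightarrow> poly_xy \<Rightarrow> bool" where
  "G5 R S \<longleftrightarrow> \<not> (\<exists>x. eval_xy R x 0 = 0 \<and> eval_xy S x 0 = 0)"

definition G6 :: "poly_xy \<Rightarrow> poly_xy \<Rightarrow> bool" where
  "G6 R S \<longleftrightarrow>
     smooth_intersection [\<lambda>u. u $ 0, eqn_z R, eqn_t S] \<and>
     (\<forall>k\<in>{2, 3, 4}.
        finite (surface R S \<inter> proj_locus [\<lambda>u. u $ 0] \<inter> affine_part 1 \<inter> proj_locus [\<lambda>u. u $ k]))"

definition generic_conditions :: "poly_xy \<Rightarrow> poly_xy \<Rightarrow> bool" where
  "generic_conditions R S \<longleftrightarrow> G1 R S \<and> G2 R S \<and> G3 R S \<and> G4 R S \<and> G5 R S \<and> G6 R S"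


section \<open>Holomorphic symmetric differentials on submanifolds of projective space\<close>

definition holomorphic_fun_on :: "(complex ^ 'k) set \<Rightarrow> (complex ^ 'k::finite \<Rightarrow> complex) \<Rightarrow> bool" where
  "holomorphic_fun_on V f \<longleftrightarrow>
     (\<forall>s\<in>V. \<exists>D. (f has_derivative D) (at s) \<and> (\<forall>c v. D (c *s v) = c * D v))"

type_synonym ('k, 'n) chart = "(complex ^ 'k) set \<times> (complex ^ 'k \<Rightarrow> 'n proj)"

text \<open>
  The holomorphic charts of a subset \<open>X\<close> of projective space, given by their inverses:
  holomorphic immersions \<open>\<phi>\<close> of an open set \<open>V\<close> that are homeomorphisms onto an open subset of \<open>X\<close>.
  When \<open>X\<close> is a complex submanifold of dimension \<open>k\<close> they form its maximal holomorphic atlas.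
\<close>

definition charts :: "'n::finite proj set \<Rightarrow> ('k::finite, 'n) chart set" where
  "charts X = {(V, \<phi>).
     open V \<and> openin (top_of_set X) (\<phi> ` V) \<and> (\<exists>\<kappa>. homeomorphism V (\<phi> ` V) \<phi> \<kappa>) \<and>
     (\<forall>s\<in>V. \<forall>i. \<phi> s \<in> affine_part i \<longrightarrow>
        (\<exists>D. ((affine_coords i \<circ> \<phi>) has_derivative D) (at s) \<and>
             (\<forall>c v. D (c *s v) = c *s D v) \<and> inj D))}"

definition transition ::
  "('k::finite, 'n::finite) chart \<Rightarrow> ('k, 'n) chart \<Rightarrow> complex ^ 'k \<Rightarrow> complex ^ 'k" where
  "transition \<alpha> \<beta> = inv_into (fst \<beta>) (snd \<beta>) \<circ> snd \<alpha>"

text \<open>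
  \<open>H\<^sup>0(X, Sym\<^sup>m T\<^sub>X\<^sup>*)\<close> for a surface \<open>X\<close>. The value \<open>\<omega> (\<alpha>, s, v)\<close> is that of the section, read in
  the chart \<open>\<alpha>\<close> at the point \<open>s\<close>, as a homogeneous polynomial of degree \<open>m\<close> in the
  tangent vector \<open>v\<close>. So in each chart \<open>\<omega> = \<Sum>\<^sub>j f\<^sub>j (ds\<^sub>1)\<^sup>j (ds\<^sub>2)\<^bsup>m-j\<^esup>\<close> with holomorphic \<open>f\<^sub>j\<close>,
  and charts are related by pullback. Off the charts \<open>\<omega>\<close> is normalized to zero.
\<close>

type_synonym 'n sym_diff = "(2, 'n) chart \<times> (complex ^ 2) \<times> (complex ^ 2) \<Rightarrow> complex"

definition holomorphic_sections :: "'n::finite proj set \<Rightarrow> nat \<Rightarrow> 'n sym_diff set" where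
  "holomorphic_sections X m = {\<omega>.
     (\<forall>V \<phi> s v. (V, \<phi>) \<notin> charts X \<or> s \<notin> V \<longrightarrow> \<omega> ((V, \<phi>), s, v) = 0) \<and>
     (\<forall>(V, \<phi>)\<in>charts X. \<exists>f.
        (\<forall>j\<le>m. holomorphic_fun_on V (f j)) \<and>
        (\<forall>s\<in>V. \<forall>v. \<omega> ((V, \<phi>), s, v) = (\<Sum>j\<le>m. f j s * (v $ 1) ^ j * (v $ 2) ^ (m - j)))) \<and>
     (\<forall>\<alpha>\<in>charts X. \<forall>\<beta>\<in>charts X. \<forall>s\<in>fst \<alpha>. snd \<alpha> s \<in> snd \<beta> ` fst \<beta> \<longrightarrow>
        (\<forall>v. \<omega> (\<alpha>, s, v) =
             \<omega> (\<beta>, transition \<alpha> \<beta> s, frechet_derivative (transition \<alpha> \<beta>) (at s) v)))}"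

text \<open>
  Here \<open>F q q'\<close> is a jet differential on the affine space \<open>{u\<^sub>0 \<noteq> 0}\<close>, regular on the set \<open>\<Omega>\<close>
  of points \<open>q\<close>, with \<open>q' = dq\<close>. Its restriction to \<open>X\<close> is a meromorphic section when \<open>\<Omega>\<close> is dense
  in \<open>X\<close>, and this section is holomorphic when it extends to a holomorphic section over \<open>X\<close>.
\<close>

definition restriction_holomorphic ::
  "'n::{finite, zero} proj set \<Rightarrow> nat \<Rightarrow> (complex ^ 'n::{finite, zero}) set \<Rightarrow>
     (complex ^ 'n::{finite, zero} \<Rightarrow> complex ^ 'n::{finite, zero} \<Rightarrow> complex) \<Rightarrow> bool" where
  "restriction_holomorphic X m \<Omega> F \<longleftrightarrow>
     (let regular = affine_part 0 \<inter> {p. affine_coords 0 p \<in> \<Omega>} in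
       X \<subseteq> closure (X \<inter> regular) \<and>
       (\<exists>\<omega>\<in>holomorphic_sections X m. \<forall>(V, \<phi>)\<in>charts X. \<forall>s\<in>V. \<phi> s \<in> regular \<longrightarrow>
          (\<forall>v. \<omega> ((V, \<phi>), s, v) =
               F (affine_coords 0 (\<phi> s)) (frechet_derivative (affine_coords 0 \<circ> \<phi>) (at s) v))))"


section \<open>The jet polynomial\<close>

text \<open>
  The ring \<open>\<complex>[x,y,x',y']\<close>, with the variables from the innermost to the outermost one in this order.
\<close>

type_synonym jet_poly = "complex poly poly poly poly"

definition const_jet :: "poly_xy \<Rightarrow> jet_poly" where
  "const_jet F = [:[:F:]:]"

definition var_x' :: jet_poly where "var_x' = [:[:0, 1:]:]"

definition var_y' :: jet_poly where "var_y' = [:0, 1:]"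

definition var_y :: jet_poly where "var_y = const_jet [:0, 1:]"

definition eval_jet :: "jet_poly \<Rightarrow> complex \<Rightarrow> complex \<Rightarrow> complex \<Rightarrow> complex \<Rightarrow> complex" where
  "eval_jet P x y x' y' = eval_xy (poly (poly P [:[:[:y':]:]:]) [:[:x':]:]) x y"

definition total_diff :: "poly_xy \<Rightarrow> jet_poly" where
  "total_diff F = var_x' * const_jet (diff_x F) + var_y' * const_jet (diff_y F)"

definition jet_exponents :: "nat \<Rightarrow> (nat \<times> nat \<times> nat \<times> nat) set" where
  "jet_exponents m = {(j, k, p, q). j + k + p + q = m}"

definition monomials :: "int \<Rightarrow> (nat \<times> nat) set" where
  "monomials a = {(h, i). int (h + i) \<le> a}"

text \<open>
  A family of polynomials \<open>A\<^sub>j\<^sub>,\<^sub>k\<^sub>,\<^sub>p\<^sub>,\<^sub>q\<close> of degree at most \<open>a\<close> is given by its coefficients, the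
  coefficient \<open>A\<^bsup>h,i\<^esup>\<close> of \<open>A\<^sub>j\<^sub>,\<^sub>k\<^sub>,\<^sub>p\<^sub>,\<^sub>q\<close> being \<open>A ((j, k, p, q), (h, i))\<close>.
\<close>

type_synonym coeff_family = "(nat \<times> nat \<times> nat \<times> nat) \<times> (nat \<times> nat) \<Rightarrow> complex"

definition coeff_indices :: "nat \<Rightarrow> int \<Rightarrow> ((nat \<times> nat \<times> nat \<times> nat) \<times> (nat \<times> nat)) set" where
  "coeff_indices m a = jet_exponents m \<times> monomials a"

definition coeff_families :: "nat \<Rightarrow> int \<Rightarrow> coeff_family set" where
  "coeff_families m a = {A. \<forall>\<iota>. \<iota> \<notin> coeff_indices m a \<longrightarrow> A \<iota> = 0}"

definition A_poly :: "int \<Rightarrow> coeff_family \<Rightarrow> nat \<times> nat \<times> nat \<times> nat \<Rightarrow> poly_xy" where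
  "A_poly a A \<epsilon> = (\<Sum>(h, i)\<in>monomials a. monom (monom (A (\<epsilon>, (h, i))) h) i)"

definition jet_J :: "poly_xy \<Rightarrow> poly_xy \<Rightarrow> nat \<Rightarrow> int \<Rightarrow> coeff_family \<Rightarrow> jet_poly" where
  "jet_J R S m a A =
     (\<Sum>(j, k, p, q)\<in>jet_exponents m.
        const_jet (A_poly a A (j, k, p, q)) * var_x' ^ j * var_y' ^ k *
        total_diff R ^ p * total_diff S ^ q * const_jet R ^ (m - p) * const_jet S ^ (m - q))"

definition solutions :: "poly_xy \<Rightarrow> poly_xy \<Rightarrow> nat \<Rightarrow> int \<Rightarrow> coeff_family set" where
  "solutions R S m a = {A \<in> coeff_families m a. var_y ^ total_degree R dvd jet_J R S m a A}"

text \<open>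
  \<open>J(x, y, x', y') / (y\<^bsup>d\<^esup> z\<^bsup>m(d-1)\<^esup> t\<^bsup>m(e-1)\<^esup>)\<close> at the affine point \<open>q = (1, x, y, z, t)\<close>.
\<close>

definition jet_differential ::
  "poly_xy \<Rightarrow> poly_xy \<Rightarrow> nat \<Rightarrow> int \<Rightarrow> coeff_family \<Rightarrow> complex ^ 5 \<Rightarrow> complex ^ 5 \<Rightarrow> complex" where
  "jet_differential R S m a A q q' =
     eval_jet (jet_J R S m a A) (q $ 1) (q $ 2) (q' $ 1) (q' $ 2) /
     ((q $ 2) ^ total_degree R * (q $ 3) ^ (m * (total_degree R - 1)) *
      (q $ 4) ^ (m * (total_degree S - 1)))"


section \<open>Dimension of complex function spaces\<close>

interpretation cfun: vector_space "\<lambda>(c :: complex) (f :: 'a \<Rightarrow> complex) x. c * f x"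
  by unfold_locales (auto simp: fun_eq_iff algebra_simps)

text \<open>
  Unlike \<^term>\<open>cfun.dim\<close>, which is zero on spaces without a finite basis, this is
  infinite on them.
\<close>

definition cfun_edim :: "('a \<Rightarrow> complex) set \<Rightarrow> enat" where
  "cfun_edim W = Sup {enat (card B) | B. finite B \<and> B \<subseteq> W \<and> cfun.independent B}"

end

theory Submission
  imports Defs
    "HOL-Complex_Analysis.Complex_Singularities"
    "HOL-Computational_Algebra.Field_as_Ring"
begin

text \<open>
  (i) The equations \<open>z^d = R\<close> and \<open>t^e = S\<close> give \<open>d z^(d-1) dz = dR\<close> and \<open>e t^(e-1) dt = dS\<close> on \<open>X\<close>.
  Substituted into \<open>J\<close> they produce the factor \<open>z^(m(d-1)) t^(m(e-1))\<close>, and the quotient is the polynomial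
  \<open>\<Sum> A (dx)^j (dy)^k (d dz)^p (e dt)^q z^(m-p) t^(m-q)\<close>. In homogeneous coordinates \<open>dx\<close> is
  \<open>(u0 du1 - u1 du0) / u0^2\<close>, and similarly for \<open>y, z, t\<close>. After division by \<open>y^d\<close> the remaining power of
  \<open>u0\<close> in each term has exponent \<open>d + p + q - 4m - h - i\<close>, which is nonnegative because \<open>a \<le> d - 4m\<close>.
  So the differential is \<open>hom_jet\<close> divided by \<open>u2^d\<close>, holomorphic wherever \<open>u2 \<noteq> 0\<close> and in particular at
  the points at infinity with \<open>u2 \<noteq> 0\<close>. The divisibility \<open>J = y^d P\<close> gives the second
  expression \<open>P / (z^(m(d-1)) t^(m(e-1)))\<close>, holomorphic where \<open>u0, u3, u4\<close> do not vanish. Both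
  expressions fail only at finitely many points of \<open>X\<close> (\<open>finite_bad_points\<close>): at infinity by
  (G6), at finite distance because such a point lies over a zero of \<open>R(x,0)\<close> or \<open>S(x,0)\<close>. In dimension two
  isolated singularities are removable (\<open>hartogs_finite\<close>), so the section extends.

  (ii) Divisibility by \<open>y^d\<close> is the vanishing of the coefficients of \<open>1, y, \<dots>, y^(d-1)\<close>. Counting the
  possible monomials bounds the number of equations; for \<open>m = \<lfloor>d/12\<rfloor>\<close> and \<open>e \<le> d^2/648\<close> the unknowns exceed
  the equations by an amount of order at least \<open>d^5\<close>, hence by more than the cubic bound (\<open>counting_inequality\<close>).

  For the lower bound on \<open>dim H\<^sup>0\<close> the linear map from solutions to sections has to be injective. An
  explicit chart of \<open>X\<close>, given by branches of the roots of \<open>R\<close> and \<open>S\<close>, shows that a family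
  \<open>A\<close> inducing the zero section satisfies \<open>J = 0\<close>. Then all \<open>A\<^sub>j\<^sub>k\<^sub>p\<^sub>q\<close> vanish (\<open>jet_J_injective\<close>). Indeed
  \<open>J / (R S)^m = \<Sum> A (dx)^j (dy)^k (dR/R)^p (dS/S)^q\<close>, and at each of the \<open>d e\<close> transversal intersection points
  of \<open>R = 0\<close> and \<open>S = 0\<close> the logarithmic differentials can be given arbitrary limits while \<open>dx\<close> and \<open>dy\<close>
  tend to zero. The terms of lowest order \<open>j + k\<close> then show that the corresponding
  \<open>A\<^sub>j\<^sub>k\<^sub>p\<^sub>q\<close> vanish at all these points. A polynomial of degree \<open>a < d \<le> e\<close> vanishing at \<open>d e\<close> such points is
  zero, by Bezout's inequality (\<open>vanishing_on_complete_intersection\<close>), and induction on \<open>j + k\<close> concludes.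
\<close>

text \<open>The symbol \<open>$\<close> is reserved for the components of vectors.\<close>

no_notation fps_nth (infixl \<open>$\<close> 75)

section \<open>Holomorphic functions of several variables\<close>

lemma norm_smult_complex: "norm (c *s v) = norm c * norm (v :: complex ^ 'k::finite)"
  by (simp add: norm_vec_def L2_set_right_distrib norm_mult)

lemma bounded_linear_smult_left: "bounded_linear (\<lambda>c. c *s (v :: complex ^ 'k::finite))"
  by (rule bounded_linear_intro[where K = "norm v"])
     (simp_all add: norm_smult_complex vec_eq_iff algebra_simps)

lemmas continuous_on_smult [continuous_intros] =
  bounded_linear.continuous_on[OF bounded_linear_smult_left]

lemma holo_pointD:
  assumes "holomorphic_fun_on V f" "s \<in> V"
  shows "(f has_derivative frechet_derivative f (at s)) (at s)"
    "frechet_derivative f (at s) (c *s v) = c * frechet_derivative f (at s) v"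
proof -
  obtain D where D: "(f has_derivative D) (at s)" "\<forall>c v. D (c *s v) = c * D v"
    using assms unfolding holomorphic_fun_on_def by blast
  moreover have "D = frechet_derivative f (at s)"
    using D(1) by (rule frechet_derivative_at)
  ultimately show "(f has_derivative frechet_derivative f (at s)) (at s)"
    "frechet_derivative f (at s) (c *s v) = c * frechet_derivative f (at s) v" by auto
qed

lemma holo_subset: "holomorphic_fun_on V f \<Longrightarrow> U \<subseteq> V \<Longrightarrow> holomorphic_fun_on U f"
  by (auto simp: holomorphic_fun_on_def)

lemma holo_transform:
  assumes "holomorphic_fun_on U f" "open U" "\<And>s. s \<in> U \<Longrightarrow> f s = g s"
  shows "holomorphic_fun_on U g"
  unfolding holomorphic_fun_on_def
proof
  fix s assume s: "s \<in> U"
  then obtain D where "(f has_derivative D) (at s)" "\<forall>c v. D (c *s v) = c * D v"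
    using assms(1) unfolding holomorphic_fun_on_def by blast
  then show "\<exists>D. (g has_derivative D) (at s) \<and> (\<forall>c v. D (c *s v) = c * D v)"
    using has_derivative_transform_within_open[OF _ assms(2) s] assms(3) by blast
qed

lemma holo_local:
  assumes "\<And>s. s \<in> V \<Longrightarrow> \<exists>U. s \<in> U \<and> holomorphic_fun_on U f"
  shows "holomorphic_fun_on V f"
  using assms unfolding holomorphic_fun_on_def by blast

lemma holo_Un: "holomorphic_fun_on (U \<union> V) f \<longleftrightarrow> holomorphic_fun_on U f \<and> holomorphic_fun_on V f"
  unfolding holomorphic_fun_on_def by blast

lemma holo_const: "holomorphic_fun_on V (\<lambda>s. c)"
  unfolding holomorphic_fun_on_def by (auto intro!: exI[of _ "\<lambda>v. 0"] derivative_eq_intros)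

lemma holo_nth: "holomorphic_fun_on V (\<lambda>s. s $ i)"
  unfolding holomorphic_fun_on_def
  by (auto intro!: exI[of _ "\<lambda>v. v $ i"] bounded_linear_imp_has_derivative bounded_linear_vec_nth)

lemma holo_add:
  assumes "holomorphic_fun_on V f" "holomorphic_fun_on V g"
  shows "holomorphic_fun_on V (\<lambda>s. f s + g s)"
  unfolding holomorphic_fun_on_def
proof
  fix s assume s: "s \<in> V"
  note f = holo_pointD[OF assms(1) s] and g = holo_pointD[OF assms(2) s]
  show "\<exists>D. ((\<lambda>s. f s + g s) has_derivative D) (at s) \<and> (\<forall>c v. D (c *s v) = c * D v)"
    by (rule exI, rule conjI, rule has_derivative_add[OF f(1) g(1)])
       (simp add: f(2) g(2) algebra_simps)
qed

lemma holo_mult: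
  assumes "holomorphic_fun_on V f" "holomorphic_fun_on V g"
  shows "holomorphic_fun_on V (\<lambda>s. f s * g s)"
  unfolding holomorphic_fun_on_def
proof
  fix s assume s: "s \<in> V"
  note f = holo_pointD[OF assms(1) s] and g = holo_pointD[OF assms(2) s]
  show "\<exists>D. ((\<lambda>s. f s * g s) has_derivative D) (at s) \<and> (\<forall>c v. D (c *s v) = c * D v)"
    by (rule exI, rule conjI, rule has_derivative_mult[OF f(1) g(1)])
       (simp add: f(2) g(2) algebra_simps)
qed

lemma holo_inverse:
  assumes "holomorphic_fun_on V f" "\<And>s. s \<in> V \<Longrightarrow> f s \<noteq> 0"
  shows "holomorphic_fun_on V (\<lambda>s. inverse (f s))"
  unfolding holomorphic_fun_on_def
proof
  fix s assume s: "s \<in> V"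
  note f = holo_pointD[OF assms(1) s]
  show "\<exists>D. ((\<lambda>s. inverse (f s)) has_derivative D) (at s) \<and> (\<forall>c v. D (c *s v) = c * D v)"
    by (rule exI, rule conjI, rule Deriv.has_derivative_inverse[OF assms(2)[OF s] f(1)])
       (simp add: f(2) algebra_simps)
qed

lemma holo_divide:
  assumes "holomorphic_fun_on V f" "holomorphic_fun_on V g" "\<And>s. s \<in> V \<Longrightarrow> g s \<noteq> 0"
  shows "holomorphic_fun_on V (\<lambda>s. f s / g s)"
  unfolding divide_inverse by (intro holo_mult holo_inverse assms)

lemma holo_diff:
  assumes "holomorphic_fun_on V f" "holomorphic_fun_on V g"
  shows "holomorphic_fun_on V (\<lambda>s. f s - g s)"
  using holo_add[OF assms(1) holo_mult[OF holo_const[of _ "-1"] assms(2)]] by simp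

lemma holo_power: "holomorphic_fun_on V f \<Longrightarrow> holomorphic_fun_on V (\<lambda>s. f s ^ n)"
  by (induction n) (auto intro: holo_const holo_mult)

lemma holo_sum:
  "(\<And>i. i \<in> I \<Longrightarrow> holomorphic_fun_on V (f i)) \<Longrightarrow> holomorphic_fun_on V (\<lambda>s. \<Sum>i\<in>I. f i s)"
  by (induction I rule: infinite_finite_induct) (auto intro: holo_const holo_add)

lemma holo_imp_continuous_on: "holomorphic_fun_on V f \<Longrightarrow> continuous_on V f"
  by (meson continuous_at_imp_continuous_on has_derivative_continuous holo_pointD(1))

lemma holo_has_field_derivative_line:
  assumes "holomorphic_fun_on V f" "s + \<zeta> *s w \<in> V"
  shows "((\<lambda>\<zeta>. f (s + \<zeta> *s w)) has_field_derivative
    frechet_derivative f (at (s + \<zeta> *s w)) w) (at \<zeta>)"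
proof -
  have "((\<lambda>\<zeta>. s + \<zeta> *s w) has_derivative (\<lambda>h. h *s w)) (at \<zeta>)"
    by (rule derivative_eq_intros bounded_linear_imp_has_derivative[OF bounded_linear_smult_left] refl)+ simp
  from diff_chain_at[OF this holo_pointD(1)[OF assms]]
  have "((\<lambda>\<zeta>. f (s + \<zeta> *s w)) has_derivative
      (\<lambda>h. frechet_derivative f (at (s + \<zeta> *s w)) w * h)) (at \<zeta>)"
    by (simp add: o_def holo_pointD(2)[OF assms] mult.commute)
  then show ?thesis by (simp add: has_field_derivative_def)
qed

lemma holo_line_holomorphic:
  assumes "holomorphic_fun_on V f" "\<And>\<zeta>. \<zeta> \<in> A \<Longrightarrow> s + \<zeta> *s w \<in> V"
  shows "(\<lambda>\<zeta>. f (s + \<zeta> *s w)) holomorphic_on A"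
  unfolding holomorphic_on_def field_differentiable_def
  using holo_has_field_derivative_line[OF assms(1)] assms(2)
  by (meson has_field_derivative_at_within)

definition circle_point :: "real \<Rightarrow> real \<Rightarrow> complex" where
  "circle_point r \<theta> = of_real r * exp (2 * of_real pi * \<i> * of_real \<theta>)"

lemma norm_circle_point [simp]: "norm (circle_point r \<theta>) = \<bar>r\<bar>"
  by (simp add: circle_point_def norm_mult norm_exp_eq_Re)

lemma circle_point_eq_0_iff [simp]: "circle_point r \<theta> = 0 \<longleftrightarrow> r = 0"
  by (simp add: circle_point_def)

lemma continuous_on_circle_point [continuous_intros]: "continuous_on A (circle_point r)"
  unfolding circle_point_def by (intro continuous_intros)

text \<open>
  The mean of \<open>f\<close> over the circle of radius \<open>r\<close> around \<open>s\<close> in the complex direction \<open>w\<close>, with weight \<open>c\<close>.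
  Weight \<open>1\<close> gives Cauchy's formula for \<open>f s\<close>, the reciprocal of the circle point gives the one for the
  derivative in direction \<open>w\<close>. Unlike contour integrals along varying paths, these integrals over the
  fixed interval depend on \<open>s\<close> only through the integrand and can be differentiated under the integral.
\<close>

definition circle_mean :: "(complex ^ 'k::finite \<Rightarrow> complex) \<Rightarrow> (real \<Rightarrow> complex) \<Rightarrow> real
    \<Rightarrow> complex ^ 'k \<Rightarrow> complex ^ 'k \<Rightarrow> complex" where
  "circle_mean f c r w s = integral (cbox 0 1) (\<lambda>\<theta>. f (s + circle_point r \<theta> *s w) * c \<theta>)"

lemma circlepath_integral:
  assumes "(f has_contour_integral I) (circlepath z r)"
  shows "((\<lambda>\<theta>. f (z + circle_point r \<theta>) * (2 * of_real pi * \<i> * circle_point r \<theta>)) has_integral I) (cbox 0 1)"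
proof -
  have "((\<lambda>x. f (circlepath z r x) * vector_derivative (circlepath z r) (at x within {0..1}))
     has_integral I) {0..1}"
    using assms by (simp add: has_contour_integral_def)
  then have "((\<lambda>\<theta>. f (z + circle_point r \<theta>) * (2 * of_real pi * \<i> * circle_point r \<theta>)) has_integral I) {0..1}"
  proof (rule has_integral_eq[rotated])
    fix x :: real assume "x \<in> {0..1}"
    then have "vector_derivative (circlepath z r) (at x within {0..1}) =
        2 * of_real pi * \<i> * of_real r * exp (2 * of_real pi * \<i> * of_real x)"
      using vector_derivative_circlepath01[of x z r] by (simp only: atLeastAtMost_iff) (simp add: mult.assoc)
    then show "f (circlepath z r x) * vector_derivative (circlepath z r) (at x within {0..1}) =
        f (z + circle_point r x) * (2 * of_real pi * \<i> * circle_point r x)"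
      by (simp only:) (simp add: circlepath circle_point_def algebra_simps)
  qed
  then show ?thesis by simp
qed

lemma circle_mean_value:
  assumes f: "holomorphic_fun_on V f" and r: "r > 0"
    and V: "\<And>\<zeta>. norm \<zeta> \<le> r \<Longrightarrow> s + \<zeta> *s w \<in> V"
  shows "circle_mean f (\<lambda>_. 1) r w s = f s"
proof -
  let ?g = "\<lambda>\<zeta>. f (s + \<zeta> *s w)"
  have "?g holomorphic_on cball 0 r"
    using V by (intro holo_line_holomorphic[OF f]) auto
  then have "((\<lambda>u. ?g u / (u - 0)) has_contour_integral 2 * of_real pi * \<i> * ?g 0) (circlepath 0 r)"
    using r by (intro Cauchy_integral_circlepath_simple) auto
  from circlepath_integral[OF this]
  have "((\<lambda>\<theta>. ?g (circle_point r \<theta>) / circle_point r \<theta> * (2 * of_real pi * \<i> * circle_point r \<theta>))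
      has_integral 2 * of_real pi * \<i> * ?g 0) (cbox 0 1)" by simp
  from has_integral_mult_right[OF this, of "1 / (2 * of_real pi * \<i>)"]
  have "((\<lambda>\<theta>. ?g (circle_point r \<theta>)) has_integral ?g 0) (cbox 0 1)"
    using r by (rule_tac has_integral_eq[rotated]) (auto simp: circle_point_def field_simps)
  then show ?thesis
    by (simp add: circle_mean_def integral_unique)
qed

lemma circle_mean_derivative:
  assumes f: "holomorphic_fun_on V f" and r: "r > 0"
    and V: "\<And>\<zeta>. norm \<zeta> \<le> r \<Longrightarrow> s + \<zeta> *s w \<in> V"
  shows "circle_mean f (\<lambda>\<theta>. 1 / circle_point r \<theta>) r w s = frechet_derivative f (at s) w"
proof -
  let ?g = "\<lambda>\<zeta>. f (s + \<zeta> *s w)"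
  have hol: "?g holomorphic_on cball 0 r"
    using V by (intro holo_line_holomorphic[OF f]) auto
  have cont: "continuous_on (cball 0 r) ?g"
    using hol by (rule holomorphic_on_imp_continuous_on)
  have hol': "?g holomorphic_on ball 0 r"
    using hol by (rule holomorphic_on_subset) auto
  let ?I = "contour_integral (circlepath 0 r) (\<lambda>u. ?g u / (u - 0)\<^sup>2)"
  have "(\<lambda>u. ?g u / (u - 0)\<^sup>2) contour_integrable_on circlepath 0 r"
    and "(?g has_field_derivative (1 / (2 * of_real pi * \<i>) * ?I)) (at 0)"
    using Cauchy_derivative_integral_circlepath[OF cont hol', of 0] r by auto
  moreover have "(?g has_field_derivative frechet_derivative f (at s) w) (at 0)"
    using holo_has_field_derivative_line[OF f, of s 0 w] V[of 0] r by simp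
  ultimately have I: "1 / (2 * of_real pi * \<i>) * ?I = frechet_derivative f (at s) w"
    and "((\<lambda>u. ?g u / (u - 0)\<^sup>2) has_contour_integral ?I) (circlepath 0 r)"
    using DERIV_unique has_contour_integral_integral by blast+
  from circlepath_integral[OF this(2)]
  have "((\<lambda>\<theta>. ?g (circle_point r \<theta>) / (circle_point r \<theta>)\<^sup>2 * (2 * of_real pi * \<i> * circle_point r \<theta>))
      has_integral ?I) (cbox 0 1)" by simp
  from has_integral_mult_right[OF this, of "1 / (2 * of_real pi * \<i>)"]
  have "((\<lambda>\<theta>. ?g (circle_point r \<theta>) * (1 / circle_point r \<theta>)) has_integral frechet_derivative f (at s) w) (cbox 0 1)"
    unfolding I using r
    by (rule_tac has_integral_eq[rotated]) (auto simp: circle_point_def field_simps power2_eq_square)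
  then show ?thesis
    by (simp add: circle_mean_def integral_unique)
qed

text \<open>
  Uniformity in the base point: by compactness the translates of the whole set by nearby base
  points stay in \<open>V\<close>.
\<close>

lemma circle_tube:
  fixes w :: "complex ^ 'k::finite"
  assumes "open V" and "\<And>\<zeta>. \<zeta> \<in> K \<Longrightarrow> s + \<zeta> *s w \<in> V" and "compact K"
  obtains \<delta> where "\<delta> > 0" "\<And>s' \<zeta>. s' \<in> ball s \<delta> \<Longrightarrow> \<zeta> \<in> K \<Longrightarrow> s' + \<zeta> *s w \<in> V"
proof -
  have "compact ((\<lambda>\<zeta>. s + \<zeta> *s w) ` K)"
    using assms(3) by (intro compact_continuous_image continuous_intros)
  moreover have "(\<lambda>\<zeta>. s + \<zeta> *s w) ` K \<subseteq> V" using assms(2) by auto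
  ultimately obtain e where e: "e > 0" "(\<Union>x\<in>(\<lambda>\<zeta>. s + \<zeta> *s w) ` K. ball x e) \<subseteq> V"
    using compact_subset_open_imp_ball_epsilon_subset[of _ V] assms(1) by metis
  show ?thesis
  proof (rule that[OF e(1)])
    fix s' \<zeta> assume "s' \<in> ball s e" "\<zeta> \<in> K"
    then have "s' + \<zeta> *s w \<in> ball (s + \<zeta> *s w) e" by (simp add: dist_norm)
    with \<open>\<zeta> \<in> K\<close> e(2) show "s' + \<zeta> *s w \<in> V" by blast
  qed
qed

lemma circle_mean_continuous:
  assumes "continuous_on V f" "continuous_on (cbox 0 1) c"
    and "\<And>s \<theta>. s \<in> U \<Longrightarrow> s + circle_point r \<theta> *s w \<in> V"
  shows "continuous_on U (circle_mean f c r w)"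
proof -
  have "continuous_on (U \<times> cbox 0 1) (\<lambda>(s, \<theta>). f (s + circle_point r \<theta> *s w) * c \<theta>)"
    unfolding case_prod_unfold
    using assms(3)
    by (intro continuous_intros continuous_on_compose2[OF assms(1)] continuous_on_compose2[OF assms(2)]
       continuous_on_compose2[OF continuous_on_circle_point[of UNIV]]) auto
  from integral_continuous_on_param[OF this]
  show ?thesis unfolding circle_mean_def by simp
qed

lemma small_disc_in_open:
  fixes v :: "complex ^ 'k::finite"
  assumes V: "open V" and s: "s \<in> V"
  obtains r where "r > 0" "\<And>\<zeta>. \<zeta> \<in> cball 0 r \<Longrightarrow> s + \<zeta> *s v \<in> V"
proof -
  obtain e where e: "e > 0" "ball s e \<subseteq> V" using V s open_contains_ball by blast
  define r where "r = e / (2 * (norm v + 1))"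
  have r: "r > 0" using e(1) by (auto simp: r_def intro!: divide_pos_pos add_nonneg_pos)
  have in_V: "s + \<zeta> *s v \<in> V" if "\<zeta> \<in> cball 0 r" for \<zeta>
  proof -
    have "norm (\<zeta> *s v) \<le> r * norm v" using that by (simp add: norm_smult_complex mult_right_mono)
    also have "\<dots> \<le> r * (norm v + 1)" using r by simp
    also have "\<dots> = e / 2"
      using norm_ge_zero[of v] by (simp add: r_def divide_simps; linarith)
    finally show ?thesis using e by (auto simp: dist_norm)
  qed
  show ?thesis by (rule that[OF r in_V])
qed

text \<open>
  Complex differentiability alone, as in the definition of holomorphic functions, implies that
  the derivative is continuous, because Cauchy's formula writes it as an integral of the continuous
  function \<open>f\<close>.
\<close>

lemma frechet_derivative_continuous:
  assumes V: "open V" and f: "holomorphic_fun_on V f"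
  shows "continuous_on V (\<lambda>s. frechet_derivative f (at s) v)"
proof (rule continuous_at_imp_continuous_on, rule ballI)
  fix s assume s: "s \<in> V"
  obtain r where r: "r > 0" and in_V: "\<And>\<zeta>. \<zeta> \<in> cball 0 r \<Longrightarrow> s + \<zeta> *s v \<in> V"
    by (rule small_disc_in_open[OF V s, of v]) blast
  obtain \<delta> where \<delta>: "\<delta> > 0" "\<And>s' \<zeta>. s' \<in> ball s \<delta> \<Longrightarrow> \<zeta> \<in> cball 0 r \<Longrightarrow> s' + \<zeta> *s v \<in> V"
    by (rule circle_tube[OF V in_V, of "cball 0 r"]) auto
  have eq: "circle_mean f (\<lambda>\<theta>. 1 / circle_point r \<theta>) r v s' = frechet_derivative f (at s') v"
    if "s' \<in> ball s \<delta>" for s'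
    using \<delta>(2)[OF that] by (intro circle_mean_derivative[OF f r]) auto
  have "continuous_on (ball s \<delta>) (circle_mean f (\<lambda>\<theta>. 1 / circle_point r \<theta>) r v)"
    using \<delta>(2) r
    by (intro circle_mean_continuous[OF holo_imp_continuous_on[OF f]] continuous_intros) auto
  then have "continuous_on (ball s \<delta>) (\<lambda>s. frechet_derivative f (at s) v)"
    by (rule continuous_on_eq) (simp add: eq)
  then show "isCont (\<lambda>s. frechet_derivative f (at s) v) s"
    using \<delta>(1) by (simp add: continuous_on_eq_continuous_at)
qed

text \<open>
  Differentiation under the integral; it needs the continuity of the derivative just proved.
\<close>

lemma circle_mean_holo:
  assumes V: "open V" and f: "holomorphic_fun_on V f" and c: "continuous_on (cbox 0 1) c"
    and sub: "\<And>s \<theta>. s \<in> ball s0 \<delta> \<Longrightarrow> s + circle_point r \<theta> *s w \<in> V"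
  shows "holomorphic_fun_on (ball s0 \<delta>) (circle_mean f c r w)"
  unfolding holomorphic_fun_on_def
proof
  fix s assume s: "s \<in> ball s0 \<delta>"
  define D where "D = (\<lambda>s \<theta>. Blinfun (\<lambda>v. frechet_derivative f (at (s + circle_point r \<theta> *s w)) v * c \<theta>))"
  have D: "blinfun_apply (D s \<theta>) v = frechet_derivative f (at (s + circle_point r \<theta> *s w)) v * c \<theta>"
    if "s \<in> ball s0 \<delta>" for s \<theta> v
    unfolding D_def
    by (subst bounded_linear_Blinfun_apply)
       (intro bounded_linear_intros has_derivative_bounded_linear[OF holo_pointD(1)[OF f sub[OF that]]], rule refl)
  have der: "((\<lambda>s. f (s + circle_point r \<theta> *s w) * c \<theta>) has_derivative blinfun_apply (D s \<theta>)) (at s within ball s0 \<delta>)"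
    if "s \<in> ball s0 \<delta>" for s \<theta>
  proof -
    have "((\<lambda>s. s + circle_point r \<theta> *s w) has_derivative (\<lambda>v. v)) (at s)"
      by (auto intro!: derivative_eq_intros)
    from diff_chain_at[OF this holo_pointD(1)[OF f sub[OF that]]]
    have "((\<lambda>s. f (s + circle_point r \<theta> *s w)) has_derivative
       frechet_derivative f (at (s + circle_point r \<theta> *s w))) (at s)" by (simp add: o_def)
    then have "((\<lambda>s. f (s + circle_point r \<theta> *s w) * c \<theta>) has_derivative
       (\<lambda>v. frechet_derivative f (at (s + circle_point r \<theta> *s w)) v * c \<theta>)) (at s)"
      by (rule has_derivative_mult_left)
    moreover have "blinfun_apply (D s \<theta>) =
       (\<lambda>v. frechet_derivative f (at (s + circle_point r \<theta> *s w)) v * c \<theta>)"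
      using D[OF that] by auto
    ultimately show ?thesis by (simp add: has_derivative_at_withinI)
  qed
  have cont: "continuous_on (ball s0 \<delta> \<times> cbox 0 1) (\<lambda>(s, \<theta>). D s \<theta>)"
    unfolding case_prod_unfold
  proof (rule continuous_on_blinfun_componentwise)
    fix i :: "complex ^ 'a"
    have "continuous_on (ball s0 \<delta> \<times> cbox 0 1)
       (\<lambda>x. frechet_derivative f (at (fst x + circle_point r (snd x) *s w)) i * c (snd x))"
      using sub
      by (intro continuous_intros continuous_on_compose2[OF frechet_derivative_continuous[OF V f]]
         continuous_on_compose2[OF c] continuous_on_compose2[OF continuous_on_circle_point[of UNIV]]) auto
    then show "continuous_on (ball s0 \<delta> \<times> cbox 0 1) (\<lambda>x. blinfun_apply (D (fst x) (snd x)) i)"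
      by (rule continuous_on_eq) (auto simp: D)
  qed
  have int: "(\<lambda>\<theta>. f (s + circle_point r \<theta> *s w) * c \<theta>) integrable_on cbox 0 1"
    if "s \<in> ball s0 \<delta>" for s
    using sub that
    by (intro integrable_continuous continuous_intros c
       continuous_on_compose2[OF holo_imp_continuous_on[OF f]]) auto
  have "((\<lambda>s. integral (cbox 0 1) (\<lambda>\<theta>. f (s + circle_point r \<theta> *s w) * c \<theta>)) has_derivative
     blinfun_apply (integral (cbox 0 1) (D s))) (at s within ball s0 \<delta>)"
    using der int cont s by (intro leibniz_rule) auto
  then have "((circle_mean f c r w) has_derivative blinfun_apply (integral (cbox 0 1) (D s))) (at s)"
    unfolding circle_mean_def using s by (simp add: at_within_open[OF _ open_ball] cong: if_cong)
  moreover have "blinfun_apply (integral (cbox 0 1) (D s)) (a *s v) = a * blinfun_apply (integral (cbox 0 1) (D s)) v" for a v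
  proof -
    have Dint: "D s integrable_on cbox 0 1"
    proof (rule integrable_continuous)
      have "continuous_on (cbox 0 1) (\<lambda>\<theta>. (case (s, \<theta>) of (s, \<theta>) \<Rightarrow> D s \<theta>))"
        using s by (intro continuous_on_compose2[OF cont] continuous_intros) auto
      then show "continuous_on (cbox 0 1) (D s)" by simp
    qed
    have ap: "blinfun_apply (integral (cbox 0 1) (D s)) u = integral (cbox 0 1) (\<lambda>\<theta>. blinfun_apply (D s \<theta>) u)" for u
      by (rule blinfun_apply_integral[OF Dint])
    have "blinfun_apply (D s \<theta>) (a *s v) = a * blinfun_apply (D s \<theta>) v" for \<theta>
      using D[OF s] holo_pointD(2)[OF f sub[OF s]] by simp
    then show ?thesis unfolding ap by simp
  qed
  ultimately show "\<exists>D. (circle_mean f c r w has_derivative D) (at s) \<and> (\<forall>c v. D (c *s v) = c * D v)"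
    by blast
qed

text \<open>
  Again by Cauchy's formula: the derivative is locally a circle mean of \<open>f\<close>.
\<close>

lemma frechet_derivative_holo:
  assumes V: "open V" and f: "holomorphic_fun_on V f"
  shows "holomorphic_fun_on V (\<lambda>s. frechet_derivative f (at s) v)"
proof (rule holo_local)
  fix s assume s: "s \<in> V"
  obtain r where r: "r > 0" "\<And>\<zeta>. \<zeta> \<in> cball 0 r \<Longrightarrow> s + \<zeta> *s v \<in> V"
    by (rule small_disc_in_open[OF V s, of v]) blast
  obtain \<delta> where \<delta>: "\<delta> > 0" "\<And>s' \<zeta>. s' \<in> ball s \<delta> \<Longrightarrow> \<zeta> \<in> cball 0 r \<Longrightarrow> s' + \<zeta> *s v \<in> V"
    by (rule circle_tube[OF V r(2), of "cball 0 r"]) auto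
  have "holomorphic_fun_on (ball s \<delta>) (circle_mean f (\<lambda>\<theta>. 1 / circle_point r \<theta>) r v)"
    using \<delta>(2) r(1)
    by (intro circle_mean_holo[OF V f] continuous_intros) auto
  then have "holomorphic_fun_on (ball s \<delta>) (\<lambda>s. frechet_derivative f (at s) v)"
    by (rule holo_transform) (use \<delta>(2) in \<open>auto intro!: circle_mean_derivative[OF f r(1)]\<close>)
  then show "\<exists>U. s \<in> U \<and> holomorphic_fun_on U (\<lambda>s. frechet_derivative f (at s) v)"
    using \<delta>(1) centre_in_ball by blast
qed

text \<open>
  The extension is the mean over circles in the first coordinate direction. A circle of this kind around a
  centre near \<open>s0\<close> avoids \<open>s0\<close>, so the mean is holomorphic near \<open>s0\<close>; if the centre has another second
  coordinate than \<open>s0\<close>, then the whole disc avoids \<open>s0\<close> and the mean equals \<open>g\<close>. This is where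
  dimension two enters.
\<close>

lemma hartogs_local:
  fixes g :: "complex ^ 2 \<Rightarrow> complex"
  assumes e: "e > 0" and g: "holomorphic_fun_on (ball s0 e - {s0}) g"
  shows "\<exists>\<delta> h. 0 < \<delta> \<and> \<delta> \<le> e \<and> holomorphic_fun_on (ball s0 \<delta>) h \<and> (\<forall>s\<in>ball s0 \<delta> - {s0}. h s = g s)"
proof -
  define w :: "complex ^ 2" where "w = axis 1 1"
  define w' :: "complex ^ 2" where "w' = axis 2 1"
  have nw: "norm w = 1" by (simp add: w_def)
  let ?V = "ball s0 e - {s0}"
  have V: "open ?V" by (intro open_Diff) auto
  define r where "r = e / 2"
  have r: "r > 0" using e by (simp add: r_def)
  define K where "K = sphere (0::complex) r"
  have K: "s0 + \<zeta> *s w \<in> ?V" if "\<zeta> \<in> K" for \<zeta>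
    using that r e nw by (auto simp: K_def r_def dist_norm norm_smult_complex)
  obtain \<delta>0 where \<delta>0: "\<delta>0 > 0" "\<And>s \<zeta>. s \<in> ball s0 \<delta>0 \<Longrightarrow> \<zeta> \<in> K \<Longrightarrow> s + \<zeta> *s w \<in> ?V"
    by (rule circle_tube[OF V K, of K]) (assumption, simp add: K_def, blast)
  define \<delta> where "\<delta> = min \<delta>0 r"
  have \<delta>: "\<delta> > 0" "\<delta> \<le> e" using \<delta>0(1) r e by (auto simp: \<delta>_def r_def)
  let ?h = "circle_mean g (\<lambda>_. 1) r w"
  have h: "holomorphic_fun_on (ball s0 \<delta>) ?h"
    by (rule circle_mean_holo[OF V g continuous_on_const], rule \<delta>0(2))
       (use r in \<open>auto simp: K_def \<delta>_def\<close>)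
  have eq: "?h s = g s" if s: "s \<in> ball s0 \<delta>" "s $ 2 \<noteq> s0 $ 2" for s :: "complex ^ 2"
  proof (rule circle_mean_value[OF g r])
    fix \<zeta> :: complex assume \<zeta>: "norm \<zeta> \<le> r"
    have "dist s0 (s + \<zeta> *s w) \<le> dist s0 s + norm \<zeta>"
      using nw norm_triangle_ineq4[of "s0 - s" "\<zeta> *s w"]
      by (simp add: dist_norm norm_smult_complex algebra_simps)
    also have "\<dots> < e" using \<zeta> s(1) by (auto simp: \<delta>_def r_def)
    finally have "s + \<zeta> *s w \<in> ball s0 e" by simp
    moreover have "(s + \<zeta> *s w) $ 2 \<noteq> s0 $ 2" using s(2) by (simp add: w_def axis_def)
    ultimately show "s + \<zeta> *s w \<in> ?V" by auto
  qed
  \<comment> \<open>On the line through \<open>s0\<close> along which the means are taken, equality follows by continuity.\<close>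
  have "?h s = g s" if s: "s \<in> ball s0 \<delta> - {s0}" for s
  proof (cases "s $ 2 = s0 $ 2")
    case False then show ?thesis using eq s by auto
  next
    case True
    let ?U = "ball s0 \<delta> - {s0}"
    have "continuous_on ?U (\<lambda>s. ?h s - g s)"
      using \<delta>(2) by (intro continuous_on_diff holo_imp_continuous_on holo_subset[OF h] holo_subset[OF g]) auto
    moreover have U: "open ?U" by (intro open_Diff) auto
    ultimately have c: "isCont (\<lambda>s. ?h s - g s) s"
      using s continuous_on_eq_continuous_at by blast
    have w': "((\<lambda>\<tau>. s + \<tau> *s w') \<longlongrightarrow> s) (at 0)"
    proof -
      have "continuous_on UNIV (\<lambda>\<tau>. s + \<tau> *s w')" by (intro continuous_intros)
      then have "((\<lambda>\<tau>. s + \<tau> *s w') \<longlongrightarrow> s + 0 *s w') (at 0)" unfolding continuous_on_def by blast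
      then show ?thesis by simp
    qed
    have "((\<lambda>\<tau>. ?h (s + \<tau> *s w') - g (s + \<tau> *s w')) \<longlongrightarrow> ?h s - g s) (at 0)"
      by (rule isCont_tendsto_compose[OF c w'])
    moreover have "\<forall>\<^sub>F \<tau> in at 0. s + \<tau> *s w' \<in> ?U"
      using topological_tendstoD[OF w' U s] .
    then have "\<forall>\<^sub>F \<tau> in at 0. ?h (s + \<tau> *s w') - g (s + \<tau> *s w') = 0"
      using eventually_neq_at_within[of 0 0 UNIV]
    proof eventually_elim
      case (elim \<tau>)
      then show ?case using eq[of "s + \<tau> *s w'"] True by (auto simp: w'_def axis_def)
    qed
    then have "((\<lambda>\<tau>. ?h (s + \<tau> *s w') - g (s + \<tau> *s w')) \<longlongrightarrow> 0) (at 0)"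
      by (rule tendsto_eventually)
    ultimately have "?h s - g s = 0" by (rule tendsto_unique[rotated]) simp
    then show ?thesis by simp
  qed
  with h \<delta> show ?thesis by blast
qed

lemma hartogs_finite:
  fixes g :: "complex ^ 2 \<Rightarrow> complex"
  assumes V: "open V" and Z: "finite Z" and g: "holomorphic_fun_on (V - Z) g"
  shows "\<exists>h. holomorphic_fun_on V h \<and> (\<forall>s\<in>V - Z. h s = g s)"
proof -
  have "\<forall>z\<in>V. \<exists>\<delta> h. 0 < \<delta> \<and> ball z \<delta> \<subseteq> V \<and> ball z \<delta> \<inter> Z \<subseteq> {z} \<and>
     holomorphic_fun_on (ball z \<delta>) h \<and> (\<forall>s\<in>ball z \<delta> - {z}. h s = g s)"
  proof
    fix z assume z: "z \<in> V"
    have "open (V - (Z - {z}))" using V Z by (intro open_Diff finite_imp_closed) auto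
    then obtain e where e: "e > 0" "ball z e \<subseteq> V - (Z - {z})"
      using z open_contains_ball by (metis DiffD2 DiffI insertI1)
    have "holomorphic_fun_on (ball z e - {z}) g"
      by (rule holo_subset[OF g]) (use e(2) in auto)
    from hartogs_local[OF e(1) this] obtain \<delta> h where "0 < \<delta>" "\<delta> \<le> e"
      "holomorphic_fun_on (ball z \<delta>) h" "\<forall>s\<in>ball z \<delta> - {z}. h s = g s" by blast
    moreover have "ball z \<delta> \<subseteq> ball z e" using \<open>\<delta> \<le> e\<close> by auto
    ultimately show "\<exists>\<delta> h. 0 < \<delta> \<and> ball z \<delta> \<subseteq> V \<and> ball z \<delta> \<inter> Z \<subseteq> {z} \<and>
       holomorphic_fun_on (ball z \<delta>) h \<and> (\<forall>s\<in>ball z \<delta> - {z}. h s = g s)"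
      using e(2) by (intro exI[of _ \<delta>] exI[of _ h]) auto
  qed
  then obtain \<delta> h where *: "\<And>z. z \<in> V \<Longrightarrow> 0 < \<delta> z \<and> ball z (\<delta> z) \<subseteq> V \<and> ball z (\<delta> z) \<inter> Z \<subseteq> {z} \<and>
     holomorphic_fun_on (ball z (\<delta> z)) (h z) \<and> (\<forall>s\<in>ball z (\<delta> z) - {z}. h z s = g s)"
    by metis
  \<comment> \<open>Each local extension is needed only at its own centre, so no compatibility has to be checked.\<close>
  define k where "k = (\<lambda>s. if s \<in> Z then h s s else g s)"
  have "holomorphic_fun_on V k"
  proof (rule holo_local)
    fix z assume z: "z \<in> V"
    show "\<exists>U. z \<in> U \<and> holomorphic_fun_on U k"
    proof (cases "z \<in> Z")
      case True
      have "holomorphic_fun_on (ball z (\<delta> z)) k"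
        by (rule holo_transform[of _ "h z"]) (use *[OF z] True in \<open>auto simp: k_def\<close>)
      then show ?thesis using *[OF z] centre_in_ball by blast
    next
      case False
      have "open (V - Z)" using V Z by (intro open_Diff finite_imp_closed) auto
      then have "holomorphic_fun_on (V - Z) k"
        by (rule holo_transform[OF g]) (auto simp: k_def)
      then show ?thesis using z False by blast
    qed
  qed
  then show ?thesis by (auto simp: k_def intro!: exI[of _ k])
qed

section \<open>Homogeneous forms with holomorphic coefficients\<close>

text \<open>
  Lagrange interpolation at \<open>0, \<dots>, m\<close>. The matrix \<open>L\<close> does not depend on the coefficients, so the coefficients of a
  family of forms are fixed linear combinations of its values and inherit holomorphy from them.
\<close>

lemma coefficients_from_values:
  "\<exists>L :: nat \<Rightarrow> nat \<Rightarrow> complex. \<forall>c. \<forall>j\<le>m. c j = (\<Sum>l\<le>m. L j l * (\<Sum>i\<le>m. c i * of_nat l ^ i))"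
proof -
  define \<L> :: "nat \<Rightarrow> complex poly" where
    "\<L> = (\<lambda>l. smult (1 / (\<Prod>k\<in>{..m} - {l}. of_nat l - of_nat k)) (\<Prod>k\<in>{..m} - {l}. [:- of_nat k, 1:]))"
  have deg: "degree (\<L> l) \<le> m" if "l \<le> m" for l
  proof -
    have "degree (\<Prod>k\<in>{..m} - {l}. [:- of_nat k, 1:] :: complex poly) \<le> (\<Sum>k\<in>{..m} - {l}. degree [:- of_nat k :: complex, 1:])"
      by (rule degree_prod_sum_le[unfolded o_def]) auto
    also have "\<dots> = m" using that by simp
    finally show ?thesis unfolding \<L>_def by (meson degree_smult_le le_trans)
  qed
  have val: "poly (\<L> l) (of_nat k) = (if k = l then 1 else 0)" if "l \<le> m" "k \<le> m" for l k
  proof (cases "k = l")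
    case True
    have "(\<Prod>k\<in>{..m} - {l}. of_nat l - of_nat k :: complex) \<noteq> 0" by auto
    then show ?thesis using True by (simp add: \<L>_def poly_prod)
  next
    case False
    then have "(\<Prod>j\<in>{..m} - {l}. of_nat k - of_nat j :: complex) = 0" using that by auto
    then show ?thesis using False by (simp add: \<L>_def poly_prod)
  qed
  have "c j = (\<Sum>l\<le>m. coeff (\<L> l) j * (\<Sum>i\<le>m. c i * of_nat l ^ i))" if "j \<le> m" for c :: "nat \<Rightarrow> complex" and j
  proof -
    define p where "p = (\<Sum>i\<le>m. monom (c i) i)"
    have pv: "poly p x = (\<Sum>i\<le>m. c i * x ^ i)" for x by (simp add: p_def poly_sum poly_monom)
    have cp: "coeff p j = c j" using that by (simp add: p_def coeff_sum)
    have dp: "degree p \<le> m" unfolding p_def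
      by (intro degree_sum_le) (auto intro: order.trans[OF degree_monom_le])
    define q where "q = (\<Sum>l\<le>m. smult (poly p (of_nat l)) (\<L> l))"
    have dq: "degree q \<le> m" unfolding q_def
      by (intro degree_sum_le) (auto intro: order.trans[OF degree_smult_le] deg)
    have "p = q"
    proof (rule poly_eqI_degree[of "of_nat ` {..m}"])
      fix x :: complex assume "x \<in> of_nat ` {..m}"
      then obtain k where k: "k \<le> m" "x = of_nat k" by auto
      have "poly q x = (\<Sum>l\<le>m. poly p (of_nat l) * (if k = l then 1 else 0))"
        unfolding q_def poly_sum using k by (intro sum.cong) (auto simp: val)
      also have "\<dots> = poly p x" using k by (simp add: sum.delta' if_distrib cong: if_cong)
      finally show "poly p x = poly q x" by simp
    qed (use dp dq in \<open>auto simp: card_image inj_on_def\<close>)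
    then have "c j = coeff q j" using cp by simp
    also have "\<dots> = (\<Sum>l\<le>m. coeff (\<L> l) j * (\<Sum>i\<le>m. c i * of_nat l ^ i))"
      by (simp add: q_def coeff_sum pv mult.commute)
    finally show ?thesis .
  qed
  then show ?thesis by (intro exI[of _ "\<lambda>j l. coeff (\<L> l) j"]) blast
qed

definition form_on :: "nat \<Rightarrow> (complex ^ 2 \<Rightarrow> complex) \<Rightarrow> bool" where
  "form_on m H \<longleftrightarrow> (\<exists>c. \<forall>v. H v = (\<Sum>j\<le>m. c j * (v $ 1) ^ j * (v $ 2) ^ (m - j)))"

text \<open>
  The extension theorem for functions, applied to the coefficients of the forms.
\<close>

lemma holo_form_extends:
  fixes G :: "complex ^ 2 \<Rightarrow> complex ^ 2 \<Rightarrow> complex"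
  assumes V: "open V" and Z: "finite Z"
    and hol: "\<And>v. holomorphic_fun_on (V - Z) (\<lambda>s. G s v)"
    and form: "\<And>s. s \<in> V - Z \<Longrightarrow> form_on m (G s)"
  shows "\<exists>f. (\<forall>j\<le>m. holomorphic_fun_on V (f j)) \<and>
     (\<forall>s\<in>V - Z. \<forall>v. G s v = (\<Sum>j\<le>m. f j s * (v $ 1) ^ j * (v $ 2) ^ (m - j)))"
proof -
  obtain L :: "nat \<Rightarrow> nat \<Rightarrow> complex"
    where L: "\<And>c j. j \<le> m \<Longrightarrow> c j = (\<Sum>l\<le>m. L j l * (\<Sum>i\<le>m. c i * of_nat l ^ i))"
    using coefficients_from_values by blast
  \<comment> \<open>On the vector \<open>(l, 1)\<close> a form takes the value at \<open>l\<close> of the polynomial with the same coefficients.\<close>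
  define e :: "nat \<Rightarrow> complex ^ 2" where "e = (\<lambda>l. vector [of_nat l, 1])"
  define f0 where "f0 = (\<lambda>j s. \<Sum>l\<le>m. L j l * G s (e l))"
  have "holomorphic_fun_on (V - Z) (f0 j)" for j
    unfolding f0_def by (intro holo_sum holo_mult holo_const hol)
  then have "\<forall>j. \<exists>h. holomorphic_fun_on V h \<and> (\<forall>s\<in>V - Z. h s = f0 j s)"
    using hartogs_finite[OF V Z] by blast
  then obtain f where f: "\<And>j. holomorphic_fun_on V (f j)" "\<And>j s. s \<in> V - Z \<Longrightarrow> f j s = f0 j s"
    by metis
  have "G s v = (\<Sum>j\<le>m. f j s * (v $ 1) ^ j * (v $ 2) ^ (m - j))" if s: "s \<in> V - Z" for s v
  proof -
    obtain c where c: "\<And>v. G s v = (\<Sum>j\<le>m. c j * (v $ 1) ^ j * (v $ 2) ^ (m - j))"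
      using form[OF s] unfolding form_on_def by blast
    have "f j s = c j" if "j \<le> m" for j
      unfolding f(2)[OF s] f0_def c using L[OF that, of c] by (simp add: e_def)
    then show ?thesis unfolding c by simp
  qed
  with f(1) show ?thesis by blast
qed

section \<open>Differentiability through an immersion\<close>

text \<open>
  If \<open>f \<circ> T = g\<close> with \<open>f\<close> immersive at \<open>T s\<close>, then \<open>T\<close> inherits differentiability from \<open>g\<close>, and a left
  inverse \<open>L\<close> of \<open>Df\<close> yields the derivative \<open>L \<circ> Dg\<close>. Continuity of \<open>T\<close> at \<open>s\<close> keeps \<open>T x\<close> in the
  range where the linearization of \<open>f\<close> is accurate; the lower bound \<open>B\<close> for \<open>Df\<close> turns the estimate for \<open>f (T x)\<close>
  into one for \<open>T x\<close>.
\<close>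

lemma has_derivative_through_immersion:
  fixes f :: "'b::euclidean_space \<Rightarrow> 'c::euclidean_space" and g :: "'a::euclidean_space \<Rightarrow> 'c"
  assumes g: "(g has_derivative Dg) (at s)" and f: "(f has_derivative Df) (at (T s))"
    and inj: "inj Df" and T: "isCont T s" and eq: "\<forall>\<^sub>F x in at s. f (T x) = g x" "f (T s) = g s"
  shows "\<exists>DT. (T has_derivative DT) (at s) \<and> (\<forall>v. Df (DT v) = Dg v)"
proof -
  have lf: "linear Df" using f has_derivative_linear by blast
  obtain L where L: "linear L" "L \<circ> Df = id" using linear_injective_left_inverse[OF lf inj] by blast
  obtain B where B: "B > 0" "\<And>x. B * norm x \<le> norm (Df x)"
    by (rule linear_inj_bounded_below_pos[OF lf inj]) blast
  have bL: "bounded_linear L" using L(1) linear_conv_bounded_linear by blast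
  have bg: "bounded_linear Dg" using g has_derivative_bounded_linear by blast
  obtain K where K: "K > 0" "\<And>x. norm (L x) \<le> norm x * K" using bounded_linear.pos_bounded[OF bL] by blast
  obtain M where M: "M > 0" "\<And>x. norm (Dg x) \<le> norm x * M" using bounded_linear.pos_bounded[OF bg] by blast
  have DT: "(T has_derivative (\<lambda>v. L (Dg v))) (at s)"
    unfolding has_derivative_at_alt
  proof (intro conjI allI impI)
    show "bounded_linear (\<lambda>v. L (Dg v))" using bounded_linear_compose[OF bL bg] .
    fix e :: real assume e: "e > 0"
    define e1 where "e1 = min (B / 2) (e * B / (4 * K * (M + 1)))"
    define e2 where "e2 = min 1 (e / (2 * K))"
    have e1: "e1 > 0" "e1 \<le> B / 2" using e B K M by (auto simp: e1_def)
    have e2: "e2 > 0" "e2 \<le> 1" using e K by (auto simp: e2_def)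
    have "e1 * (2 / B * (M + 1)) \<le> e * B / (4 * K * (M + 1)) * (2 / B * (M + 1))"
      using B M by (intro mult_right_mono) (auto simp: e1_def)
    also have "\<dots> = e / (2 * K)"
    proof -
      have *: "e * B / (4 * K * N) * (2 / B * N) = e / (2 * K)" if "N \<noteq> 0" for N
        using that B(1) K(1) by (simp add: field_simps)
      show ?thesis using M(1) by (intro *) simp
    qed
    finally have "e1 * (2 / B * (M + 1)) \<le> e / (2 * K)" .
    moreover have "e2 \<le> e / (2 * K)" by (simp add: e2_def)
    ultimately have "e1 * (2 / B * (M + 1)) + e2 \<le> e / K" by linarith
    then have e12: "K * (e1 * (2 / B * (M + 1)) + e2) \<le> e" using K by (simp add: field_simps)
    obtain d1 where d1: "d1 > 0" "\<And>b. norm (b - T s) < d1 \<Longrightarrow>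
        norm (f b - f (T s) - Df (b - T s)) \<le> e1 * norm (b - T s)"
      using f e1(1) unfolding has_derivative_at_alt by blast
    obtain d2 where d2: "d2 > 0" "\<And>x. norm (x - s) < d2 \<Longrightarrow>
        norm (g x - g s - Dg (x - s)) \<le> e2 * norm (x - s)"
      using g e2(1) unfolding has_derivative_at_alt by blast
    obtain d3 where d3: "d3 > 0" "\<And>x. dist x s < d3 \<Longrightarrow> dist (T x) (T s) < d1"
      using T d1(1) unfolding continuous_at_eps_delta by blast
    obtain d4 where d4: "d4 > 0" "\<And>x. x \<noteq> s \<Longrightarrow> dist x s < d4 \<Longrightarrow> f (T x) = g x"
      using eq(1) unfolding eventually_at by blast
    show "\<exists>d>0. \<forall>x. norm (x - s) < d \<longrightarrow> norm (T x - T s - L (Dg (x - s))) \<le> e * norm (x - s)"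
    proof (intro exI[of _ "min d2 (min d3 d4)"] conjI allI impI)
      show "0 < min d2 (min d3 d4)" using d2 d3 d4 by auto
      fix x assume x: "norm (x - s) < min d2 (min d3 d4)"
      define y where "y = T x - T s"
      have fg: "f (T x) = g x" using x d4(2)[of x] eq(2) by (cases "x = s") (auto simp: dist_norm)
      have rf: "norm (g x - g s - Df y) \<le> e1 * norm y"
        using d1(2)[of "T x"] d3(2)[of x] x unfolding y_def fg eq(2) by (simp add: dist_norm)
      have rg: "norm (g x - g s - Dg (x - s)) \<le> e2 * norm (x - s)" using d2(2) x by simp
      have "norm (Df y) \<le> norm (g x - g s) + e1 * norm y"
        using norm_triangle_ineq2[of "Df y" "g x - g s"] rf by (simp add: norm_minus_commute)
      moreover have "e1 * norm y \<le> B / 2 * norm y" by (intro mult_right_mono e1) auto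
      ultimately have "B / 2 * norm y \<le> norm (g x - g s)" using B(2)[of y] by simp
      also have "\<dots> \<le> norm (Dg (x - s)) + norm (g x - g s - Dg (x - s))"
        using norm_triangle_sub by blast
      also have "\<dots> \<le> norm (x - s) * M + 1 * norm (x - s)"
        by (intro add_mono M order.trans[OF rg] mult_right_mono e2) auto
      finally have y: "norm y \<le> 2 / B * (M + 1) * norm (x - s)"
        using B by (simp add: field_simps)
      have LD: "L (Df y) = y" using L(2) by (simp add: fun_eq_iff)
      have "T x - T s - L (Dg (x - s)) = L (Df y - Dg (x - s))"
        using LD linear_diff[OF L(1)] by (simp add: y_def)
      also have "norm \<dots> \<le> norm (Df y - Dg (x - s)) * K" by (rule K)
      also have "\<dots> \<le> (norm (g x - g s - Df y) + norm (g x - g s - Dg (x - s))) * K"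
        using norm_triangle_ineq4[of "g x - g s - Dg (x - s)" "g x - g s - Df y"] K
        by (intro mult_right_mono) (auto simp: algebra_simps)
      also have "\<dots> \<le> (e1 * (2 / B * (M + 1) * norm (x - s)) + e2 * norm (x - s)) * K"
        using K e1(1) by (intro mult_right_mono add_mono order.trans[OF rf] rg mult_left_mono y) auto
      also have "\<dots> = (K * (e1 * (2 / B * (M + 1)) + e2)) * norm (x - s)"
        by (simp add: algebra_simps)
      also have "\<dots> \<le> e * norm (x - s)" by (intro mult_right_mono e12) auto
      finally show "norm (T x - T s - L (Dg (x - s))) \<le> e * norm (x - s)" .
    qed
  qed
  have "((\<lambda>x. f (T x)) has_derivative (\<lambda>v. Df (L (Dg v)))) (at s)"
    using diff_chain_at[OF DT f] by (simp add: o_def)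
  then have "(g has_derivative (\<lambda>v. Df (L (Dg v)))) (at s)"
    by (rule has_derivative_transform_eventually) (use eq in auto)
  then have "(\<lambda>v. Df (L (Dg v))) = Dg" using g has_derivative_unique by blast
  then show ?thesis using DT by (metis (full_types))
qed

section \<open>Projective space and affine coordinates\<close>

lemma abs_proj_eq_iff:
  assumes "u \<noteq> 0" "v \<noteq> 0"
  shows "abs_proj u = abs_proj v \<longleftrightarrow> (\<exists>c. c \<noteq> 0 \<and> v = c *s (u :: complex ^ 'n::finite))"
proof
  assume "abs_proj u = abs_proj v"
  then show "\<exists>c. c \<noteq> 0 \<and> v = c *s u"
    using Quotient3_rel[OF Quotient3_proj, of u v] assms
    by (metis (mono_tags, lifting) vector_smult_lid zero_neq_one)
next
  assume "\<exists>c. c \<noteq> 0 \<and> v = c *s u"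
  then show "abs_proj u = abs_proj v"
    using Quotient3_rel_abs[OF Quotient3_proj] assms by blast
qed

lemma rep_proj_nonzero: "rep_proj p \<noteq> (0 :: complex ^ 'n::finite)"
  using Quotient3_rep_reflp[OF Quotient3_proj, of p] by blast

lemma abs_rep_proj [simp]: "abs_proj (rep_proj p) = p"
  by (rule Quotient3_abs_rep[OF Quotient3_proj])

lemma rep_abs_proj:
  assumes "u \<noteq> 0"
  obtains c where "c \<noteq> 0" "rep_proj (abs_proj u) = c *s (u :: complex ^ 'n::finite)"
proof -
  have "abs_proj u = abs_proj (rep_proj (abs_proj u))" by simp
  then show ?thesis using abs_proj_eq_iff[OF assms rep_proj_nonzero] that by blast
qed

lemma abs_proj_in_affine_part:
  assumes "u \<noteq> 0"
  shows "abs_proj u \<in> affine_part i \<longleftrightarrow> u $ i \<noteq> 0"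
  using rep_abs_proj[OF assms] unfolding affine_part_def
  by (metis (mono_tags, lifting) mem_Collect_eq mult_eq_0_iff vector_smult_component)

lemma nth_nonzero_imp_nonzero: "(u :: complex ^ 'n) $ i \<noteq> 0 \<Longrightarrow> u \<noteq> 0"
  by auto

lemma affine_coords_abs_proj:
  assumes "u \<noteq> 0"
  shows "affine_coords i (abs_proj u) = (\<chi> k. u $ k / u $ i)"
  using rep_abs_proj[OF assms] unfolding affine_coords_def vec_eq_iff
  by (metis (no_types, lifting) mult_divide_mult_cancel_left vec_lambda_beta vector_smult_component)

lemma affine_coords_nth: "affine_coords i p $ k = rep_proj p $ k / rep_proj p $ i"
  by (simp add: affine_coords_def)

lemma affine_coords_self [simp]: "p \<in> affine_part i \<Longrightarrow> affine_coords i p $ i = 1"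
  by (simp add: affine_coords_nth affine_part_def)

lemma in_affine_part_iff_coords:
  "p \<in> affine_part i \<Longrightarrow> p \<in> affine_part k \<longleftrightarrow> affine_coords i p $ k \<noteq> 0"
  by (simp add: affine_coords_nth affine_part_def)

lemma affine_coords_change:
  assumes "p \<in> affine_part i" "p \<in> affine_part j"
  shows "affine_coords j p = (1 / affine_coords i p $ j) *s affine_coords i p"
  using assms by (simp add: vec_eq_iff affine_coords_nth affine_part_def)

lemma affine_coords_nonzero: "p \<in> affine_part i \<Longrightarrow> affine_coords i p \<noteq> 0"
  using affine_coords_self[of p i] by (metis zero_index zero_neq_one)

lemma abs_proj_affine_coords: "p \<in> affine_part i \<Longrightarrow> abs_proj (affine_coords i p) = p"
proof -
  assume p: "p \<in> affine_part i"
  have "affine_coords i p = (1 / rep_proj p $ i) *s rep_proj p"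
    by (simp add: vec_eq_iff affine_coords_nth)
  moreover have "1 / rep_proj p $ i \<noteq> 0" using p by (simp add: affine_part_def)
  ultimately have "abs_proj (rep_proj p) = abs_proj (affine_coords i p)"
    using abs_proj_eq_iff[OF rep_proj_nonzero affine_coords_nonzero[OF p], of p] by blast
  then show ?thesis by simp
qed

lemma in_some_affine_part: "\<exists>i. p \<in> affine_part i"
  using rep_proj_nonzero[of p] by (auto simp: affine_part_def vec_eq_iff)

lemma open_affine_part: "open (affine_part i :: 'n::finite proj set)"
proof -
  have "{u. u \<noteq> 0 \<and> abs_proj u \<in> affine_part i} = {u :: complex ^ 'n. u $ i \<noteq> 0}"
    by (auto simp: abs_proj_in_affine_part[OF nth_nonzero_imp_nonzero] dest: abs_proj_in_affine_part[THEN iffD1, rotated])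
  moreover have "open {u :: complex ^ 'n. u $ i \<noteq> 0}"
    by (intro open_Collect_neq continuous_intros)
  ultimately show ?thesis by (simp add: open_proj_def)
qed

lemma continuous_on_abs_proj: "continuous_on {u :: complex ^ 'n::finite. u \<noteq> 0} abs_proj"
proof -
  have "open {u :: complex ^ 'n. u \<noteq> 0}" by (simp add: open_Collect_neq)
  then show ?thesis
    unfolding continuous_on_open_vimage[OF \<open>open {u :: complex ^ 'n. u \<noteq> 0}\<close>]
    by (auto simp: open_proj_def vimage_def Int_def conj_commute)
qed

lemma continuous_on_affine_coords: "continuous_on (affine_part i) (affine_coords i :: 'n::finite proj \<Rightarrow> complex ^ 'n)"
  unfolding continuous_on_open_vimage[OF open_affine_part]
proof (intro allI impI)
  fix B :: "(complex ^ 'n) set" assume B: "open B"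
  let ?f = "\<lambda>u :: complex ^ 'n. (\<chi> k. u $ k / u $ i)"
  have "{u. u \<noteq> 0 \<and> abs_proj u \<in> affine_coords i -` B \<inter> affine_part i} = ?f -` B \<inter> {u :: complex ^ 'n. u $ i \<noteq> 0}"
    by (auto simp: abs_proj_in_affine_part affine_coords_abs_proj nth_nonzero_imp_nonzero)
  moreover have "open {u :: complex ^ 'n. u $ i \<noteq> 0}"
    by (intro open_Collect_neq continuous_intros)
  moreover have "continuous_on {u :: complex ^ 'n. u $ i \<noteq> 0} ?f"
    by (intro continuous_on_vec_lambda continuous_intros) auto
  ultimately show "open (affine_coords i -` B \<inter> affine_part i)"
    using B by (simp add: open_proj_def continuous_on_open_vimage)
qed

text \<open>
  For equations invariant under scaling membership can be tested on any representative.
\<close>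

lemma proj_locus_iff:
  assumes "\<And>f c u. f \<in> set fs \<Longrightarrow> c \<noteq> 0 \<Longrightarrow> f u = 0 \<Longrightarrow> f (c *s u) = 0" and "u \<noteq> 0"
  shows "abs_proj u \<in> proj_locus fs \<longleftrightarrow> (\<forall>f\<in>set fs. f (u :: complex ^ 'n::finite) = 0)"
proof
  assume "abs_proj u \<in> proj_locus fs"
  then obtain v where v: "abs_proj u = abs_proj v" "v \<noteq> 0" "\<forall>f\<in>set fs. f v = 0"
    by (auto simp: proj_locus_def)
  then obtain c where "c \<noteq> 0" "u = c *s v" using abs_proj_eq_iff[of v u] assms(2) by metis
  then show "\<forall>f\<in>set fs. f u = 0" using assms(1) v(3) by blast
qed (use assms(2) in \<open>auto simp: proj_locus_def\<close>)

section \<open>Polynomials and jet polynomials\<close>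

lemma eval_xy_simps [simp]:
  "eval_xy 0 x y = 0" "eval_xy 1 x y = 1"
  "eval_xy (F + G) x y = eval_xy F x y + eval_xy G x y"
  "eval_xy (F * G) x y = eval_xy F x y * eval_xy G x y"
  "eval_xy (F ^ n) x y = eval_xy F x y ^ n"
  "eval_xy (pCons p F) x y = poly p x + y * eval_xy F x y"
  by (simp_all add: eval_xy_def poly_power)

lemma eval_xy_sum [simp]: "eval_xy (\<Sum>i\<in>I. F i) x y = (\<Sum>i\<in>I. eval_xy (F i) x y)"
  by (induction I rule: infinite_finite_induct) auto

lemma eval_xy_monom [simp]: "eval_xy (monom (monom c h) i) x y = c * x ^ h * y ^ i"
  by (simp add: eval_xy_def poly_monom algebra_simps)

lemma eval_xy_altdef:
  "eval_xy F x y = (\<Sum>i\<le>degree F. \<Sum>h\<le>degree (coeff F i). coeff_xy F h i * x ^ h * y ^ i)"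
  by (simp add: eval_xy_def poly_altdef[of F] poly_sum poly_altdef[of "coeff F _"] coeff_xy_def
     sum_distrib_right flip: pCons_one)

lemma diff_simps [simp]:
  "diff_x 0 = 0" "diff_y 0 = 0"
  "diff_x (pCons p F) = pCons (pderiv p) (diff_x F)" "diff_y (pCons p F) = F + pCons 0 (diff_y F)"
  by (simp_all add: diff_x_def diff_y_def map_poly_pCons pderiv_pCons)

lemma has_derivative_eval_xy:
  assumes "(f has_derivative f') (at s)" "(g has_derivative g') (at s)"
  shows "((\<lambda>s. eval_xy F (f s) (g s)) has_derivative
    (\<lambda>v. eval_xy (diff_x F) (f s) (g s) * f' v + eval_xy (diff_y F) (f s) (g s) * g' v)) (at s)"
proof (induction F)
  case 0
  then show ?case by simp
next
  case (pCons p F)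
  have "((\<lambda>s. poly p (f s)) has_derivative (\<lambda>v. poly (pderiv p) (f s) * f' v)) (at s)"
    using diff_chain_at[OF assms(1) poly_DERIV[of p "f s", unfolded has_field_derivative_def]]
    by (simp add: o_def mult.commute)
  from has_derivative_add[OF this has_derivative_mult[OF assms(2) pCons(2)]]
  show ?case by (simp add: algebra_simps)
qed

text \<open>
  A nonzero polynomial in \<open>y\<close> over the domain \<open>\<complex>[x]\<close> has finitely many roots, in particular among the
  constants \<open>[:y:]\<close>.
\<close>

lemma eval_xy_eq_0_imp:
  assumes "infinite I" "\<And>y. y \<in> I \<Longrightarrow> infinite {x. eval_xy F x y = 0}"
  shows "F = 0"
proof (rule poly_eqI)
  fix i
  have z: "poly F [:y:] = 0" if "y \<in> I" for y
    using assms(2)[OF that] poly_roots_finite unfolding eval_xy_def by blast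
  have "infinite ((\<lambda>y. [:y:]) ` I)"
    using assms(1) by (simp add: finite_image_iff inj_on_def)
  moreover have "(\<lambda>y. [:y:]) ` I \<subseteq> {q. poly F q = 0}" using z by auto
  ultimately have "infinite {q. poly F q = 0}" using finite_subset by blast
  then have "F = 0" using poly_roots_finite[of F] by blast
  then show "coeff F i = coeff 0 i" by simp
qed

text \<open>
  Equivalent to \<open>total_degree F \<le> n\<close>, but free of the case distinction and the maximum in the definition
  of the total degree.
\<close>

definition tdeg_le :: "poly_xy \<Rightarrow> nat \<Rightarrow> bool" where
  "tdeg_le F n \<longleftrightarrow> (\<forall>h i. coeff_xy F h i \<noteq> 0 \<longrightarrow> h + i \<le> n)"

lemma finite_coeff_xy_support: "finite {(h, i). coeff_xy F h i \<noteq> 0}"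
proof (rule finite_subset)
  show "{(h, i). coeff_xy F h i \<noteq> 0} \<subseteq> (\<Union>i\<in>{..degree F}. (\<lambda>h. (h, i)) ` {..degree (coeff F i)})"
    by (auto simp: coeff_xy_def image_iff) (metis coeff_0 le_degree)+
qed auto

lemma coeff_xy_eq_0_iff: "(\<forall>h i. coeff_xy F h i = 0) \<longleftrightarrow> F = 0"
  by (auto simp: coeff_xy_def poly_eq_iff)

lemma total_degree_set:
  "{h + i | h i. coeff_xy F h i \<noteq> 0} = (\<lambda>(h, i). h + i) ` {(h, i). coeff_xy F h i \<noteq> 0}"
  by auto

lemma tdeg_le_total_degree: "tdeg_le F (total_degree F)"
proof (cases "F = 0")
  case False
  have "finite {h + i | h i. coeff_xy F h i \<noteq> 0}"
    unfolding total_degree_set by (intro finite_imageI finite_coeff_xy_support)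
  then show ?thesis unfolding tdeg_le_def total_degree_def using False by (auto intro!: Max_ge)
qed (simp add: tdeg_le_def coeff_xy_def)

lemma total_degree_le_iff: "total_degree F \<le> n \<longleftrightarrow> tdeg_le F n"
proof
  assume "tdeg_le F n"
  show "total_degree F \<le> n"
  proof (cases "F = 0")
    case False
    let ?A = "{h + i | h i. coeff_xy F h i \<noteq> 0}"
    have "finite ?A"
      unfolding total_degree_set by (intro finite_imageI finite_coeff_xy_support)
    moreover have "?A \<noteq> {}" using False coeff_xy_eq_0_iff[of F] by auto
    ultimately show ?thesis using \<open>tdeg_le F n\<close> False by (auto simp: total_degree_def tdeg_le_def)
  qed (simp add: total_degree_def)
qed (use tdeg_le_total_degree in \<open>force simp: tdeg_le_def\<close>)

lemma tdeg_le_0 [simp]: "tdeg_le 0 n" by (simp add: tdeg_le_def coeff_xy_def)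

lemma tdeg_le_mono: "tdeg_le F m \<Longrightarrow> m \<le> n \<Longrightarrow> tdeg_le F n"
  unfolding tdeg_le_def by (meson le_trans)

lemma tdeg_le_add: "tdeg_le F n \<Longrightarrow> tdeg_le G n \<Longrightarrow> tdeg_le (F + G) n"
  unfolding tdeg_le_def coeff_xy_def by (simp, metis add.right_neutral)

lemma tdeg_le_sum: "(\<And>i. i \<in> I \<Longrightarrow> tdeg_le (F i) n) \<Longrightarrow> tdeg_le (\<Sum>i\<in>I. F i) n"
  by (induction I rule: infinite_finite_induct) (auto intro: tdeg_le_add)

lemma coeff_xy_mult:
  "coeff_xy (F * G) h i = (\<Sum>j\<le>i. \<Sum>k\<le>h. coeff_xy F k j * coeff_xy G (h - k) (i - j))"
  by (simp add: coeff_xy_def coeff_mult coeff_sum)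

lemma tdeg_le_mult:
  assumes "tdeg_le F m" "tdeg_le G n"
  shows "tdeg_le (F * G) (m + n)"
  unfolding tdeg_le_def
proof (intro allI impI)
  fix h i assume "coeff_xy (F * G) h i \<noteq> 0"
  then obtain j where j: "j \<le> i" "(\<Sum>k\<le>h. coeff_xy F k j * coeff_xy G (h - k) (i - j)) \<noteq> 0"
    unfolding coeff_xy_mult by (metis (no_types, lifting) atMost_iff sum.not_neutral_contains_not_neutral)
  then obtain k where "k \<le> h" "coeff_xy F k j \<noteq> 0" "coeff_xy G (h - k) (i - j) \<noteq> 0"
    by (metis (no_types, lifting) atMost_iff mult_eq_0_iff sum.not_neutral_contains_not_neutral)
  then show "h + i \<le> m + n" using assms j(1) unfolding tdeg_le_def by fastforce
qed

lemma tdeg_le_1 [simp]: "tdeg_le 1 n"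
  by (auto simp: tdeg_le_def coeff_xy_def coeff_1)

lemma tdeg_le_diff_x: "tdeg_le F n \<Longrightarrow> tdeg_le (diff_x F) n"
  and tdeg_le_diff_y: "tdeg_le F n \<Longrightarrow> tdeg_le (diff_y F) n"
  unfolding tdeg_le_def coeff_xy_def diff_x_def diff_y_def
  by (force simp: coeff_map_poly coeff_pderiv of_nat_poly)+

lemma finite_monomials [simp]: "finite (monomials a)"
  by (rule finite_subset[of _ "{..nat a} \<times> {..nat a}"]) (auto simp: monomials_def)

lemma finite_jet_exponents [simp]: "finite (jet_exponents m)"
  by (rule finite_subset[of _ "{..m} \<times> {..m} \<times> {..m} \<times> {..m}"]) (auto simp: jet_exponents_def)

lemma coeff_A_poly: "coeff_xy (A_poly a A \<epsilon>) h i = (if (h, i) \<in> monomials a then A (\<epsilon>, (h, i)) else 0)"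
proof -
  have "coeff_xy (A_poly a A \<epsilon>) h i =
    (\<Sum>x\<in>monomials a. if x = (h, i) then A (\<epsilon>, x) else 0)"
    by (auto simp: A_poly_def coeff_xy_def coeff_sum case_prod_unfold prod_eq_iff intro!: sum.cong)
  then show ?thesis by simp
qed

lemma eval_A_poly: "eval_xy (A_poly a A \<epsilon>) x y = (\<Sum>(h, i)\<in>monomials a. A (\<epsilon>, (h, i)) * x ^ h * y ^ i)"
  by (simp add: A_poly_def case_prod_unfold)

lemma tdeg_le_A_poly: "tdeg_le (A_poly a A \<epsilon>) (nat a)"
  by (auto simp: tdeg_le_def coeff_A_poly monomials_def)

lemma eval_jet_simps [simp]:
  "eval_jet 0 x y x' y' = 0"
  "eval_jet (P + Q) x y x' y' = eval_jet P x y x' y' + eval_jet Q x y x' y'"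
  "eval_jet (P * Q) x y x' y' = eval_jet P x y x' y' * eval_jet Q x y x' y'"
  "eval_jet (P ^ n) x y x' y' = eval_jet P x y x' y' ^ n"
  "eval_jet (const_jet F) x y x' y' = eval_xy F x y"
  "eval_jet var_x' x y x' y' = x'" "eval_jet var_y' x y x' y' = y'" "eval_jet var_y x y x' y' = y"
  by (simp_all add: eval_jet_def const_jet_def var_x'_def var_y'_def var_y_def poly_power)

lemma eval_jet_sum [simp]: "eval_jet (\<Sum>i\<in>I. F i) x y x' y' = (\<Sum>i\<in>I. eval_jet (F i) x y x' y')"
  by (induction I rule: infinite_finite_induct) auto

lemma eval_total_diff [simp]:
  "eval_jet (total_diff F) x y x' y' = x' * eval_xy (diff_x F) x y + y' * eval_xy (diff_y F) x y"
  by (simp add: total_diff_def)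

lemma eval_jet_J:
  "eval_jet (jet_J R S m a A) x y x' y' =
   (\<Sum>(j, k, p, q)\<in>jet_exponents m. eval_xy (A_poly a A (j, k, p, q)) x y * x' ^ j * y' ^ k *
      (x' * eval_xy (diff_x R) x y + y' * eval_xy (diff_y R) x y) ^ p *
      (x' * eval_xy (diff_x S) x y + y' * eval_xy (diff_y S) x y) ^ q *
      eval_xy R x y ^ (m - p) * eval_xy S x y ^ (m - q))"
  by (simp add: jet_J_def case_prod_unfold)

definition coeff_jet :: "jet_poly \<Rightarrow> nat \<Rightarrow> nat \<Rightarrow> poly_xy" where
  "coeff_jet P j k = coeff (coeff P k) j"

lemma eval_jet_altdef:
  "eval_jet P x y x' y' = (\<Sum>k\<le>degree P. \<Sum>j\<le>degree (coeff P k). eval_xy (coeff_jet P j k) x y * x' ^ j * y' ^ k)"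
  by (simp add: eval_jet_def poly_altdef[of P] poly_sum poly_altdef[of "coeff P _"] coeff_jet_def
     sum_distrib_right eval_xy_def poly_power)

text \<open>
  Polynomials that are homogeneous of degree \<open>m\<close> in \<open>(x', y')\<close>, with coefficients of degree at most \<open>n\<close>
  in \<open>(x, y)\<close>.
\<close>

definition jet_form :: "nat \<Rightarrow> nat \<Rightarrow> jet_poly \<Rightarrow> bool" where
  "jet_form m n P \<longleftrightarrow> (\<forall>j k. (coeff_jet P j k \<noteq> 0 \<longrightarrow> j + k = m) \<and> tdeg_le (coeff_jet P j k) n)"

lemma coeff_jet_mult:
  "coeff_jet (P * Q) j k = (\<Sum>l\<le>k. \<Sum>i\<le>j. coeff_jet P i l * coeff_jet Q (j - i) (k - l))"
  by (simp add: coeff_jet_def coeff_mult coeff_sum)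

lemma jet_form_mult:
  assumes "jet_form m n P" "jet_form m' n' Q"
  shows "jet_form (m + m') (n + n') (P * Q)"
  unfolding jet_form_def
proof (intro allI conjI impI)
  fix j k
  show "tdeg_le (coeff_jet (P * Q) j k) (n + n')"
    unfolding coeff_jet_mult using assms by (intro tdeg_le_sum tdeg_le_mult) (auto simp: jet_form_def)
  assume "coeff_jet (P * Q) j k \<noteq> 0"
  then obtain l where l: "l \<le> k" "(\<Sum>i\<le>j. coeff_jet P i l * coeff_jet Q (j - i) (k - l)) \<noteq> 0"
    unfolding coeff_jet_mult by (metis (no_types, lifting) atMost_iff sum.not_neutral_contains_not_neutral)
  then obtain i where "i \<le> j" "coeff_jet P i l \<noteq> 0" "coeff_jet Q (j - i) (k - l) \<noteq> 0"
    by (metis (no_types, lifting) atMost_iff mult_eq_0_iff sum.not_neutral_contains_not_neutral)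
  then show "j + k = m + m'" using assms l(1) unfolding jet_form_def by fastforce
qed

lemma jet_form_add: "jet_form m n P \<Longrightarrow> jet_form m n Q \<Longrightarrow> jet_form m n (P + Q)"
  unfolding jet_form_def coeff_jet_def by (auto intro: tdeg_le_add) (metis add.right_neutral)

lemma jet_form_0: "jet_form m n 0" by (simp add: jet_form_def coeff_jet_def)

lemma jet_form_sum: "(\<And>i. i \<in> I \<Longrightarrow> jet_form m n (P i)) \<Longrightarrow> jet_form m n (\<Sum>i\<in>I. P i)"
  by (induction I rule: infinite_finite_induct) (auto intro: jet_form_add jet_form_0)

lemma jet_form_const: "tdeg_le F n \<Longrightarrow> jet_form 0 n (const_jet F)"
  by (auto simp: jet_form_def coeff_jet_def const_jet_def coeff_pCons split: nat.splits)

lemma jet_form_var_x': "jet_form 1 0 var_x'" and jet_form_var_y': "jet_form 1 0 var_y'"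
  by (auto simp: jet_form_def coeff_jet_def var_x'_def var_y'_def coeff_pCons coeff_1 split: nat.splits)

lemma jet_form_power: "jet_form m n P \<Longrightarrow> jet_form (k * m) (k * n) (P ^ k)"
proof (induction k)
  case 0
  have "jet_form 0 0 (const_jet 1)" by (rule jet_form_const) simp
  then show ?case by (simp add: const_jet_def flip: one_pCons)
next
  case (Suc k)
  then show ?case using jet_form_mult by fastforce
qed

lemma jet_form_total_diff: "tdeg_le F n \<Longrightarrow> jet_form 1 n (total_diff F)"
  unfolding total_diff_def
  using jet_form_mult[OF jet_form_var_x' jet_form_const] jet_form_mult[OF jet_form_var_y' jet_form_const]
  by (intro jet_form_add) (simp_all add: tdeg_le_diff_x tdeg_le_diff_y)

text \<open>
  The factor \<open>dR\<^sup>p R\<^bsup>m-p\<^esup>\<close> has degree \<open>m d\<close> in \<open>(x, y)\<close> for all \<open>p\<close>, and likewise for \<open>S\<close>, so all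
  terms obey the same bound.
\<close>

lemma jet_form_J:
  assumes "tdeg_le R d" "tdeg_le S e"
  shows "jet_form m (nat a + m * (d + e)) (jet_J R S m a A)"
  unfolding jet_J_def
proof (intro jet_form_sum, clarify)
  fix j k p q assume "(j, k, p, q) \<in> jet_exponents m"
  then have m: "j + k + p + q = m" by (simp add: jet_exponents_def)
  have "jet_form (0 + j * 1 + k * 1 + p * 1 + q * 1 + (m - p) * 0 + (m - q) * 0)
      (nat a + j * 0 + k * 0 + p * d + q * e + (m - p) * d + (m - q) * e)
     (const_jet (A_poly a A (j, k, p, q)) * var_x' ^ j * var_y' ^ k *
        total_diff R ^ p * total_diff S ^ q * const_jet R ^ (m - p) * const_jet S ^ (m - q))"
    by (intro jet_form_mult jet_form_power jet_form_const jet_form_var_x' jet_form_var_y'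
       jet_form_total_diff assms tdeg_le_A_poly)
  moreover have pq: "p * d + (m - p) * d = m * d" "q * e + (m - q) * e = m * e"
    using m by (simp_all flip: add_mult_distrib)
  have "nat a + j * 0 + k * 0 + p * d + q * e + (m - p) * d + (m - q) * e = nat a + m * (d + e)"
    unfolding add_mult_distrib2 pq[symmetric] by simp
  moreover have "0 + j * 1 + k * 1 + p * 1 + q * 1 + (m - p) * 0 + (m - q) * 0 = m" using m by simp
  ultimately show "jet_form m (nat a + m * (d + e)) (const_jet (A_poly a A (j, k, p, q)) * var_x' ^ j * var_y' ^ k *
        total_diff R ^ p * total_diff S ^ q * const_jet R ^ (m - p) * const_jet S ^ (m - q))"
    by (simp only:)
qed

lemma coeff_jet_var_y_mult: "coeff_jet (var_y ^ d * P) j k = [:0, 1:] ^ d * coeff_jet P j k"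
proof -
  have "var_y ^ d * P = smult ([: [:0, 1:] ^ d :]) P"
  proof -
    have "var_y ^ d = [: [: [:0, 1:] ^ d :] :]"
      by (induction d) (simp_all add: var_y_def const_jet_def one_pCons)
    then show ?thesis by simp
  qed
  then show ?thesis by (simp add: coeff_jet_def)
qed

lemma coeff_X_power_mult: "coeff ([:0, 1:] ^ d * P) n = (if n < d then 0 else coeff (P :: poly_xy) (n - d))"
proof -
  have "[:0, 1:] ^ d = (monom 1 d :: poly_xy)" by (simp add: monom_altdef)
  then show ?thesis by (simp add: coeff_monom_mult)
qed

text \<open>
  The quotient is obtained by shifting all coefficients by \<open>d\<close> places in \<open>y\<close>.
\<close>

lemma var_y_power_dvd_iff:
  "var_y ^ d dvd P \<longleftrightarrow> (\<forall>j k. \<forall>i<d. \<forall>h. coeff_xy (coeff_jet P j k) h i = 0)"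
proof
  assume "var_y ^ d dvd P"
  then obtain Q where "P = var_y ^ d * Q" ..
  then show "\<forall>j k. \<forall>i<d. \<forall>h. coeff_xy (coeff_jet P j k) h i = 0"
    by (simp add: coeff_jet_var_y_mult coeff_xy_def coeff_X_power_mult)
next
  assume *: "\<forall>j k. \<forall>i<d. \<forall>h. coeff_xy (coeff_jet P j k) h i = 0"
  define Q where "Q = map_poly (map_poly (poly_shift d)) P"
  have cQ: "coeff_jet Q j k = poly_shift d (coeff_jet P j k)" for j k
    by (simp add: Q_def coeff_jet_def coeff_map_poly)
  have "coeff_jet P j k = coeff_jet (var_y ^ d * Q) j k" for j k
    unfolding coeff_jet_var_y_mult cQ
    by (rule poly_eqI)
       (use * in \<open>auto simp: coeff_X_power_mult coeff_poly_shift coeff_xy_def poly_eq_iff\<close>)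
  then have "P = var_y ^ d * Q" by (simp add: poly_eq_iff coeff_jet_def)
  then show "var_y ^ d dvd P" by simp
qed

section \<open>Charts and their transition maps\<close>

text \<open>
  The chart \<open>\<alpha>\<close> read in the affine coordinates of index \<open>i\<close>, which are normalized to have \<open>i\<close>-th
  coordinate \<open>1\<close>.
\<close>

definition aff :: "('k::finite, 'n::finite) chart \<Rightarrow> 'n \<Rightarrow> complex ^ 'k \<Rightarrow> complex ^ 'n" where
  "aff \<alpha> i = affine_coords i \<circ> snd \<alpha>"

abbreviation daff where "daff \<alpha> i s \<equiv> frechet_derivative (aff \<alpha> i) (at s)"

definition chart_dom :: "('k::finite, 'n::finite) chart \<Rightarrow> 'n \<Rightarrow> (complex ^ 'k) set" where
  "chart_dom \<alpha> i = {s \<in> fst \<alpha>. snd \<alpha> s \<in> affine_part i}"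

context
  fixes X :: "'n::finite proj set" and \<alpha> :: "('k::finite, 'n) chart"
  assumes chart: "\<alpha> \<in> charts X"
begin

lemma chart_open: "open (fst \<alpha>)"
  and chart_homeo: "\<exists>\<kappa>. homeomorphism (fst \<alpha>) (snd \<alpha> ` fst \<alpha>) (snd \<alpha>) \<kappa>"
  and chart_openin: "openin (top_of_set X) (snd \<alpha> ` fst \<alpha>)"
  using chart by (auto simp: charts_def)

lemma chart_continuous: "continuous_on (fst \<alpha>) (snd \<alpha>)"
  using chart_homeo by (auto simp: homeomorphism_def)

lemma chart_inj: "inj_on (snd \<alpha>) (fst \<alpha>)"
  using chart_homeo unfolding homeomorphism_def by (metis inj_on_inverseI)

lemma chart_in: "s \<in> fst \<alpha> \<Longrightarrow> snd \<alpha> s \<in> X"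
  using openin_imp_subset[OF chart_openin] by auto

lemma open_chart_dom: "open (chart_dom \<alpha> i)"
proof -
  have "chart_dom \<alpha> i = snd \<alpha> -` affine_part i \<inter> fst \<alpha>" by (auto simp: chart_dom_def)
  then show ?thesis
    using chart_continuous open_affine_part continuous_on_open_vimage[OF chart_open] by metis
qed

lemma aff_derivative:
  assumes "s \<in> chart_dom \<alpha> i"
  shows "(aff \<alpha> i has_derivative daff \<alpha> i s) (at s)"
    "daff \<alpha> i s (c *s v) = c *s daff \<alpha> i s v" "inj (daff \<alpha> i s)"
proof -
  obtain D where D: "(aff \<alpha> i has_derivative D) (at s)" "\<forall>c v. D (c *s v) = c *s D v" "inj D"
    using assms chart unfolding chart_dom_def charts_def aff_def by auto blast
  moreover have "D = daff \<alpha> i s" using D(1) by (rule frechet_derivative_at)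
  ultimately show "(aff \<alpha> i has_derivative daff \<alpha> i s) (at s)"
    "daff \<alpha> i s (c *s v) = c *s daff \<alpha> i s v" "inj (daff \<alpha> i s)" by auto
qed

lemma aff_nth_derivative:
  assumes "s \<in> chart_dom \<alpha> i"
  shows "((\<lambda>s. aff \<alpha> i s $ k) has_derivative (\<lambda>v. daff \<alpha> i s v $ k)) (at s)"
  using bounded_linear.has_derivative[OF bounded_linear_vec_nth aff_derivative(1)[OF assms]] .

lemma aff_nth_holo: "holomorphic_fun_on (chart_dom \<alpha> i) (\<lambda>s. aff \<alpha> i s $ k)"
  unfolding holomorphic_fun_on_def
proof
  fix s assume s: "s \<in> chart_dom \<alpha> i"
  show "\<exists>D. ((\<lambda>s. aff \<alpha> i s $ k) has_derivative D) (at s) \<and> (\<forall>c v. D (c *s v) = c * D v)"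
    using aff_nth_derivative[OF s, of k] aff_derivative(2)[OF s]
    by (intro exI[of _ "\<lambda>v. daff \<alpha> i s v $ k"]) simp
qed

text \<open>
  Charts are only assumed to be differentiable; the derivative is holomorphic by Cauchy's formula.
\<close>

lemma daff_nth_holo: "holomorphic_fun_on (chart_dom \<alpha> i) (\<lambda>s. daff \<alpha> i s v $ k)"
proof (rule holo_transform[OF frechet_derivative_holo[OF open_chart_dom aff_nth_holo[of i k], of v] open_chart_dom])
  fix s assume "s \<in> chart_dom \<alpha> i"
  from fun_cong[OF frechet_derivative_at[OF aff_nth_derivative[OF this, of k]], of v]
  show "frechet_derivative (\<lambda>s. aff \<alpha> i s $ k) (at s) v = daff \<alpha> i s v $ k" by simp
qed

lemma aff_self: "s \<in> chart_dom \<alpha> i \<Longrightarrow> aff \<alpha> i s $ i = 1"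
  by (simp add: aff_def chart_dom_def)

lemma daff_self:
  assumes "s \<in> chart_dom \<alpha> i"
  shows "daff \<alpha> i s v $ i = 0"
proof -
  have "((\<lambda>s. 1 :: complex) has_derivative (\<lambda>v. daff \<alpha> i s v $ i)) (at s)"
    using has_derivative_transform_within_open[OF aff_nth_derivative[OF assms, of i] open_chart_dom[of i] assms, of "\<lambda>s. 1"]
      aff_self by blast
  from fun_cong[OF has_derivative_unique[OF this has_derivative_const], of v] show ?thesis .
qed

lemma aff_nonzero_iff: "s \<in> chart_dom \<alpha> i \<Longrightarrow> aff \<alpha> i s $ j \<noteq> 0 \<longleftrightarrow> s \<in> chart_dom \<alpha> j"
  using in_affine_part_iff_coords[of "snd \<alpha> s" i j] unfolding chart_dom_def aff_def by simp

text \<open>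
  Changing from index \<open>i\<close> to index \<open>j\<close> rescales the point by a function of \<open>s\<close>. By the product rule
  the tangent vector is rescaled in the same way and receives in addition a multiple of the point itself;
  expressions in homogeneous coordinates have to be invariant under both.
\<close>

lemma aff_change:
  assumes "s \<in> chart_dom \<alpha> i" "s \<in> chart_dom \<alpha> j"
  shows "aff \<alpha> j s = (1 / aff \<alpha> i s $ j) *s aff \<alpha> i s"
    "\<exists>c'. daff \<alpha> j s v = (1 / aff \<alpha> i s $ j) *s daff \<alpha> i s v + c' *s aff \<alpha> i s"
proof -
  have eq: "aff \<alpha> j s = (1 / aff \<alpha> i s $ j) *s aff \<alpha> i s" if "s \<in> chart_dom \<alpha> i \<inter> chart_dom \<alpha> j" for s
    using that unfolding aff_def chart_dom_def by (simp add: affine_coords_change[of "snd \<alpha> s" i j])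
  then show "aff \<alpha> j s = (1 / aff \<alpha> i s $ j) *s aff \<alpha> i s" using assms by blast
  have nz: "aff \<alpha> i s $ j \<noteq> 0" using assms aff_nonzero_iff by blast
  define c' where "c' = - daff \<alpha> i s v $ j / (aff \<alpha> i s $ j)\<^sup>2"
  have "daff \<alpha> j s v $ k = ((1 / aff \<alpha> i s $ j) *s daff \<alpha> i s v + c' *s aff \<alpha> i s) $ k" for k
  proof -
    have "((\<lambda>s. aff \<alpha> i s $ k / aff \<alpha> i s $ j) has_derivative
      (\<lambda>v. (daff \<alpha> i s v $ k * aff \<alpha> i s $ j - aff \<alpha> i s $ k * daff \<alpha> i s v $ j) / (aff \<alpha> i s $ j * aff \<alpha> i s $ j))) (at s)"
      by (rule has_derivative_divide'[OF aff_nth_derivative[OF assms(1)] aff_nth_derivative[OF assms(1)] nz])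
    then have "((\<lambda>s. aff \<alpha> j s $ k) has_derivative
      (\<lambda>v. (daff \<alpha> i s v $ k * aff \<alpha> i s $ j - aff \<alpha> i s $ k * daff \<alpha> i s v $ j) / (aff \<alpha> i s $ j * aff \<alpha> i s $ j))) (at s)"
      by (rule has_derivative_transform_within_open[OF _ open_Int[OF open_chart_dom[of i] open_chart_dom[of j]]])
         (use assms eq in auto)
    from fun_cong[OF has_derivative_unique[OF this aff_nth_derivative[OF assms(2)]], of v]
    have "daff \<alpha> j s v $ k = (daff \<alpha> i s v $ k * aff \<alpha> i s $ j - aff \<alpha> i s $ k * daff \<alpha> i s v $ j) / (aff \<alpha> i s $ j * aff \<alpha> i s $ j)"
      by simp
    then show ?thesis using nz by (simp add: c'_def field_simps power2_eq_square)
  qed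
  then show "\<exists>c'. daff \<alpha> j s v = (1 / aff \<alpha> i s $ j) *s daff \<alpha> i s v + c' *s aff \<alpha> i s"
    unfolding vec_eq_iff by blast
qed

lemma finite_chart_preimage: "finite Z \<Longrightarrow> finite {s \<in> fst \<alpha>. snd \<alpha> s \<in> Z}"
  using finite_vimage_IntI[OF _ chart_inj, of Z] by (simp add: vimage_def Int_def conj_commute)

end

lemma form_on_0: "form_on m (\<lambda>v. 0)"
  unfolding form_on_def by (auto intro!: exI[of _ "\<lambda>_. 0"])

lemma form_on_add: "form_on m f \<Longrightarrow> form_on m g \<Longrightarrow> form_on m (\<lambda>v. f v + g v)"
  unfolding form_on_def
proof (elim exE)
  fix c c' assume "\<forall>v. f v = (\<Sum>j\<le>m. c j * (v $ 1) ^ j * (v $ 2) ^ (m - j))"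
    "\<forall>v. g v = (\<Sum>j\<le>m. c' j * (v $ 1) ^ j * (v $ 2) ^ (m - j))"
  then show "\<exists>c. \<forall>v. f v + g v = (\<Sum>j\<le>m. c j * (v $ 1) ^ j * (v $ 2) ^ (m - j))"
    by (intro exI[of _ "\<lambda>j. c j + c' j"]) (simp add: algebra_simps sum.distrib)
qed

lemma form_on_scale: "form_on m f \<Longrightarrow> form_on m (\<lambda>v. a * f v)"
  unfolding form_on_def
proof (elim exE)
  fix c assume "\<forall>v. f v = (\<Sum>j\<le>m. c j * (v $ 1) ^ j * (v $ 2) ^ (m - j))"
  then show "\<exists>c. \<forall>v. a * f v = (\<Sum>j\<le>m. c j * (v $ 1) ^ j * (v $ 2) ^ (m - j))"
    by (intro exI[of _ "\<lambda>j. a * c j"]) (simp add: sum_distrib_left mult.assoc)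
qed

lemma form_on_sum: "(\<And>i. i \<in> I \<Longrightarrow> form_on m (f i)) \<Longrightarrow> form_on m (\<lambda>v. \<Sum>i\<in>I. f i v)"
  by (induction I rule: infinite_finite_induct) (auto intro: form_on_0 form_on_add)

lemma form_on_mult_1: "form_on m f \<Longrightarrow> form_on (Suc m) (\<lambda>v. v $ 1 * f v)"
  unfolding form_on_def
proof (elim exE)
  fix c assume "\<forall>v. f v = (\<Sum>j\<le>m. c j * (v $ 1) ^ j * (v $ 2) ^ (m - j))"
  then show "\<exists>c. \<forall>v. v $ 1 * f v = (\<Sum>j\<le>Suc m. c j * (v $ 1) ^ j * (v $ 2) ^ (Suc m - j))"
    by (intro exI[of _ "\<lambda>j. case j of 0 \<Rightarrow> 0 | Suc j \<Rightarrow> c j"])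
       (simp add: sum.atMost_Suc_shift sum_distrib_left mult_ac del: sum.atMost_Suc)
qed

lemma form_on_mult_2: "form_on m f \<Longrightarrow> form_on (Suc m) (\<lambda>v. v $ 2 * f v)"
  unfolding form_on_def
proof (elim exE)
  fix c assume "\<forall>v. f v = (\<Sum>j\<le>m. c j * (v $ 1) ^ j * (v $ 2) ^ (m - j))"
  then show "\<exists>c. \<forall>v. v $ 2 * f v = (\<Sum>j\<le>Suc m. c j * (v $ 1) ^ j * (v $ 2) ^ (Suc m - j))"
    by (intro exI[of _ "\<lambda>j. if j \<le> m then c j else 0"])
       (simp add: sum_distrib_left Suc_diff_le mult_ac)
qed

lemma form_on_mult:
  assumes "form_on m f" "form_on n g"
  shows "form_on (m + n) (\<lambda>v. f v * g v)"
proof -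
  obtain c where c: "\<And>v. f v = (\<Sum>j\<le>m. c j * (v $ 1) ^ j * (v $ 2) ^ (m - j))"
    using assms(1) unfolding form_on_def by blast
  have 2: "form_on (l + n) (\<lambda>v. v $ 2 ^ l * g v)" for l
    by (induction l) (use assms(2) form_on_mult_2 in \<open>auto simp: mult.assoc\<close>)
  have 1: "form_on (j + l + n) (\<lambda>v. v $ 1 ^ j * (v $ 2 ^ l * g v))" for j l
    by (induction j) (use 2 form_on_mult_1 in \<open>auto simp: mult.assoc\<close>)
  have "form_on (m + n) (\<lambda>v. \<Sum>j\<le>m. c j * (v $ 1 ^ j * (v $ 2 ^ (m - j) * g v)))"
  proof (intro form_on_sum form_on_scale)
    fix j assume "j \<in> {..m}"
    then have "j + (m - j) + n = m + n" by simp
    then show "form_on (m + n) (\<lambda>v. v $ 1 ^ j * (v $ 2 ^ (m - j) * g v))" using 1[of j "m - j"] by simp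
  qed
  then show ?thesis by (simp add: c sum_distrib_right mult.assoc)
qed

lemma form_on_const: "form_on 0 (\<lambda>v. c)"
  unfolding form_on_def by (auto intro!: exI[of _ "\<lambda>_. c"])

lemma form_on_power: "form_on m f \<Longrightarrow> form_on (k * m) (\<lambda>v. f v ^ k)"
  by (induction k) (auto intro: form_on_const form_on_mult)

lemma form_on_linear:
  fixes L :: "complex ^ 2 \<Rightarrow> complex"
  assumes "\<And>u v. L (u + v) = L u + L v" "\<And>c v. L (c *s v) = c * L v"
  shows "form_on 1 L"
proof -
  have "L v = L (axis 1 1) * v $ 1 + L (axis 2 1) * v $ 2" for v
  proof -
    have "v = v $ 1 *s axis 1 1 + v $ 2 *s axis 2 1"
      by (simp add: vec_eq_iff axis_def forall_2)
    then have "L v = L (v $ 1 *s axis 1 1 + v $ 2 *s axis 2 1)" by simp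
    also have "\<dots> = L (axis 1 1) * v $ 1 + L (axis 2 1) * v $ 2"
      by (simp only: assms mult.commute)
    finally show ?thesis .
  qed
  then obtain a b where "\<And>v. L v = a * v $ 1 + b * v $ 2" by blast
  then show ?thesis unfolding form_on_def
    by (intro exI[of _ "\<lambda>j. if j = 0 then b else a"]) simp
qed

lemma form_on_daff:
  fixes \<alpha> :: "(2, 'n::finite) chart"
  assumes "\<alpha> \<in> charts X" "s \<in> chart_dom \<alpha> i"
  shows "form_on 1 (\<lambda>v. daff \<alpha> i s v $ k)"
proof (rule form_on_linear)
  fix u v :: "complex ^ 2" and c
  show "daff \<alpha> i s (u + v) $ k = daff \<alpha> i s u $ k + daff \<alpha> i s v $ k"
    using linear_add[OF has_derivative_linear[OF aff_derivative(1)[OF assms]]] by simp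
  show "daff \<alpha> i s (c *s v) $ k = c * daff \<alpha> i s v $ k"
    using aff_derivative(2)[OF assms] by simp
qed

text \<open>
  The transition map satisfies \<open>aff \<beta> i \<circ> T = aff \<alpha> i\<close>. It is continuous since charts are homeomorphisms, and then
  differentiable since \<open>aff \<beta> i\<close> is an immersion. Injectivity of the derivative of \<open>aff \<beta> i\<close> also transfers complex
  linearity to that of \<open>T\<close>.
\<close>

lemma transition_facts:
  fixes \<alpha> \<beta> :: "('k::finite, 'n::finite) chart"
  assumes \<alpha>: "\<alpha> \<in> charts X" and \<beta>: "\<beta> \<in> charts X"
  fixes W :: "(complex ^ 'k) set" and T :: "complex ^ 'k \<Rightarrow> complex ^ 'k"
  assumes W_def: "W = {s \<in> fst \<alpha>. snd \<alpha> s \<in> snd \<beta> ` fst \<beta>}" and T_def: "T = transition \<alpha> \<beta>"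
  shows "open W" "\<And>s. s \<in> W \<Longrightarrow> T s \<in> fst \<beta>" "\<And>s. s \<in> W \<Longrightarrow> snd \<beta> (T s) = snd \<alpha> s"
    "continuous_on W T"
    "\<And>s i v. s \<in> W \<Longrightarrow> s \<in> chart_dom \<alpha> i \<Longrightarrow>
        T s \<in> chart_dom \<beta> i \<and> daff \<beta> i (T s) (frechet_derivative T (at s) v) = daff \<alpha> i s v"
    "\<And>k. holomorphic_fun_on W (\<lambda>s. T s $ k)"
    "\<And>s k v. s \<in> W \<Longrightarrow> frechet_derivative (\<lambda>s. T s $ k) (at s) v = frechet_derivative T (at s) v $ k"
proof -
  obtain U where U: "open U" "snd \<beta> ` fst \<beta> = X \<inter> U"
    using chart_openin[OF \<beta>] by (auto simp: openin_open)
  have "W = snd \<alpha> -` U \<inter> fst \<alpha>"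
    using U(2) chart_in[OF \<alpha>] by (auto simp: W_def)
  then show W: "open W"
    using U(1) chart_continuous[OF \<alpha>] continuous_on_open_vimage[OF chart_open[OF \<alpha>]] by metis
  show T1: "T s \<in> fst \<beta>" if "s \<in> W" for s
    using that by (auto simp: T_def transition_def W_def intro: inv_into_into)
  show T2: "snd \<beta> (T s) = snd \<alpha> s" if "s \<in> W" for s
    using that by (auto simp: T_def transition_def W_def f_inv_into_f)
  obtain \<kappa> where \<kappa>: "homeomorphism (fst \<beta>) (snd \<beta> ` fst \<beta>) (snd \<beta>) \<kappa>" using chart_homeo[OF \<beta>] by blast
  have T\<kappa>: "T s = \<kappa> (snd \<alpha> s)" if "s \<in> W" for s
    using homeomorphism_apply1[OF \<kappa> T1[OF that]] T2[OF that] by simp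
  have "continuous_on W (\<lambda>s. \<kappa> (snd \<alpha> s))"
    by (rule continuous_on_compose2[OF homeomorphism_cont2[OF \<kappa>] continuous_on_subset[OF chart_continuous[OF \<alpha>]]])
       (auto simp: W_def)
  then show cT: "continuous_on W T" using T\<kappa> by (simp cong: continuous_on_cong)
  have W_i: "T s \<in> chart_dom \<beta> i" if "s \<in> W" "s \<in> chart_dom \<alpha> i" for s i
    using that T1 T2 by (simp add: chart_dom_def)
  have DT: "\<exists>DT. (T has_derivative DT) (at s) \<and> (\<forall>v. daff \<beta> i (T s) (DT v) = daff \<alpha> i s v)"
    if s: "s \<in> W" "s \<in> chart_dom \<alpha> i" for s i
  proof (rule has_derivative_through_immersion)
    show "(aff \<alpha> i has_derivative daff \<alpha> i s) (at s)" by (rule aff_derivative[OF \<alpha> s(2)])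
    show "(aff \<beta> i has_derivative daff \<beta> i (T s)) (at (T s))" "inj (daff \<beta> i (T s))"
      by (rule aff_derivative[OF \<beta> W_i[OF s]])+
    show "isCont T s" using cT W s(1) continuous_on_eq_continuous_at by blast
    have eq: "aff \<beta> i (T s) = aff \<alpha> i s" if "s \<in> W" for s using T2[OF that] by (simp add: aff_def)
    show "\<forall>\<^sub>F x in at s. aff \<beta> i (T x) = aff \<alpha> i x"
      using eventually_at_in_open'[OF W s(1)] by eventually_elim (rule eq)
    show "aff \<beta> i (T s) = aff \<alpha> i s" by (rule eq[OF s(1)])
  qed
  have some_i: "\<exists>i. s \<in> chart_dom \<alpha> i" if "s \<in> W" for s
    using that in_some_affine_part[of "snd \<alpha> s"] by (auto simp: W_def chart_dom_def)
  have DT': "(T has_derivative frechet_derivative T (at s)) (at s) \<and>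
      (\<forall>v. daff \<beta> i (T s) (frechet_derivative T (at s) v) = daff \<alpha> i s v)"
    if s: "s \<in> W" "s \<in> chart_dom \<alpha> i" for s i
  proof -
    obtain DT where DT: "(T has_derivative DT) (at s)" "\<forall>v. daff \<beta> i (T s) (DT v) = daff \<alpha> i s v"
      using DT[OF s] by blast
    moreover have "DT = frechet_derivative T (at s)" by (rule frechet_derivative_at[OF DT(1)])
    ultimately show ?thesis by simp
  qed
  have fT: "(T has_derivative frechet_derivative T (at s)) (at s)" if "s \<in> W" for s
    using DT' some_i[OF that] that by blast
  show lin: "T s \<in> chart_dom \<beta> i \<and> daff \<beta> i (T s) (frechet_derivative T (at s) v) = daff \<alpha> i s v"
    if s: "s \<in> W" "s \<in> chart_dom \<alpha> i" for s i v
    using DT'[OF s] W_i[OF s] by blast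
  have cl: "frechet_derivative T (at s) (c *s v) = c *s frechet_derivative T (at s) v" if s: "s \<in> W" for s c v
  proof -
    obtain i where i: "s \<in> chart_dom \<alpha> i" using some_i[OF s] by blast
    have "daff \<beta> i (T s) (frechet_derivative T (at s) (c *s v)) = daff \<beta> i (T s) (c *s frechet_derivative T (at s) v)"
      using lin[OF s i] aff_derivative(2)[OF \<alpha> i] aff_derivative(2)[OF \<beta> W_i[OF s i]] by simp
    then show ?thesis using aff_derivative(3)[OF \<beta> W_i[OF s i]] by (simp add: inj_eq)
  qed
  have fTk: "((\<lambda>s. T s $ k) has_derivative (\<lambda>v. frechet_derivative T (at s) v $ k)) (at s)" if "s \<in> W" for s k
    by (rule bounded_linear.has_derivative[OF bounded_linear_vec_nth fT[OF that]])
  then show "frechet_derivative (\<lambda>s. T s $ k) (at s) v = frechet_derivative T (at s) v $ k" if "s \<in> W" for s k v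
    using fun_cong[OF frechet_derivative_at[OF fTk[OF that]], of v] by simp
  show "holomorphic_fun_on W (\<lambda>s. T s $ k)" for k
    unfolding holomorphic_fun_on_def
  proof
    fix s assume s: "s \<in> W"
    show "\<exists>D. ((\<lambda>s. T s $ k) has_derivative D) (at s) \<and> (\<forall>c v. D (c *s v) = c * D v)"
      using fTk[OF s, of k] cl[OF s]
      by (intro exI[of _ "\<lambda>v. frechet_derivative T (at s) v $ k"]) simp
  qed
qed

section \<open>The jet differential in homogeneous coordinates\<close>

lemma exhaust_5: "x = 0 \<or> x = 1 \<or> x = 2 \<or> x = 3 \<or> x = 4" for x :: 5
proof (induct x)
  case (of_int z)
  then have "0 \<le> z" and "z < 5" by simp_all
  then have "z = 0 \<or> z = 1 \<or> z = 2 \<or> z = 3 \<or> z = 4" by arith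
  then show ?case by auto
qed

lemma forall_5: "(\<forall>i :: 5. P i) \<longleftrightarrow> P 0 \<and> P 1 \<and> P 2 \<and> P 3 \<and> P 4"
  by (metis exhaust_5)

definition point5 :: "complex \<Rightarrow> complex \<Rightarrow> complex \<Rightarrow> complex \<Rightarrow> complex \<Rightarrow> complex ^ 5" where
  "point5 w x y z t = (\<chi> k. if k = 0 then w else if k = 1 then x else if k = 2 then y else if k = 3 then z else t)"

lemma point5_nth [simp]:
  "point5 w x y z t $ 0 = w" "point5 w x y z t $ 1 = x" "point5 w x y z t $ 2 = y"
  "point5 w x y z t $ 3 = z" "point5 w x y z t $ 4 = t"
  by (simp_all add: point5_def)

lemma homogenize_scale: "homogenize F (c *s u) = c ^ total_degree F * homogenize F u"
  unfolding homogenize_def sum_distrib_left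
proof (intro sum.cong refl)
  fix i h
  show "coeff_xy F h i * ((c *s u) $ 0) ^ (total_degree F - h - i) * ((c *s u) $ 1) ^ h * ((c *s u) $ 2) ^ i =
    c ^ total_degree F * (coeff_xy F h i * (u $ 0) ^ (total_degree F - h - i) * (u $ 1) ^ h * (u $ 2) ^ i)"
  proof (cases "coeff_xy F h i = 0")
    case False
    then have "h + i \<le> total_degree F" using tdeg_le_total_degree[of F] by (auto simp: tdeg_le_def)
    then have "total_degree F = (total_degree F - h - i) + h + i" by simp
    then have "c ^ total_degree F = c ^ (total_degree F - h - i) * c ^ h * c ^ i" by (metis power_add)
    then show ?thesis by (simp add: power_mult_distrib mult_ac)
  qed simp
qed

lemma homogenize_affine: "u $ 0 = 1 \<Longrightarrow> homogenize F u = eval_xy F (u $ 1) (u $ 2)"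
  by (simp add: homogenize_def eval_xy_altdef)

lemma eqn_scale:
  "eqn_z R (c *s u) = c ^ total_degree R * eqn_z R u" "eqn_t R (c *s u) = c ^ total_degree R * eqn_t R u"
  by (simp_all add: eqn_z_def eqn_t_def homogenize_scale power_mult_distrib algebra_simps)

lemma abs_proj_in_surface_iff:
  assumes "u \<noteq> 0"
  shows "abs_proj u \<in> surface R S \<longleftrightarrow> eqn_z R u = 0 \<and> eqn_t S u = 0"
  unfolding surface_def by (subst proj_locus_iff) (use assms in \<open>auto simp: eqn_scale\<close>)

lemma surface_affine_coords:
  assumes "p \<in> surface R S" "p \<in> affine_part 0"
  shows "affine_coords 0 p $ 3 ^ total_degree R = eval_xy R (affine_coords 0 p $ 1) (affine_coords 0 p $ 2)"
    "affine_coords 0 p $ 4 ^ total_degree S = eval_xy S (affine_coords 0 p $ 1) (affine_coords 0 p $ 2)"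
  using assms abs_proj_in_surface_iff[OF affine_coords_nonzero[OF assms(2)], of R S]
  by (simp_all add: abs_proj_affine_coords eqn_z_def eqn_t_def homogenize_affine)

text \<open>
  Homogeneous form of the differential \<open>d(u\<^sub>k/u\<^sub>0)\<close>, after multiplication by \<open>u\<^sub>0\<^sup>2\<close>.
\<close>

definition wedge :: "5 \<Rightarrow> complex ^ 5 \<Rightarrow> complex ^ 5 \<Rightarrow> complex" where
  "wedge k u u' = u $ 0 * u' $ k - u $ k * u' $ 0"

text \<open>
  The jet differential times \<open>y\<^bsup>d\<^esup>\<close>, in homogeneous coordinates \<open>u\<close> with tangent vector \<open>u'\<close>, after elimination of \<open>dR\<close> and \<open>dS\<close>
  in favour of \<open>dz\<close> and \<open>dt\<close>. The power of \<open>u\<^sub>0\<close> is the one that makes every term homogeneous of degree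
  \<open>d\<close>; for \<open>a \<le> d - 4m\<close> the subtraction of natural numbers in its exponent is exact.
\<close>

definition hom_jet :: "nat \<Rightarrow> nat \<Rightarrow> nat \<Rightarrow> int \<Rightarrow> coeff_family \<Rightarrow> complex ^ 5 \<Rightarrow> complex ^ 5 \<Rightarrow> complex" where
  "hom_jet d e m a A u u' = (\<Sum>(j, k, p, q)\<in>jet_exponents m. \<Sum>(h, i)\<in>monomials a.
     A ((j, k, p, q), (h, i)) * (u $ 0 ^ (d + p + q - (4 * m + h + i)) * u $ 1 ^ h * u $ 2 ^ i * u $ 3 ^ (m - p) * u $ 4 ^ (m - q)) *
      (wedge 1 u u' ^ j * wedge 2 u u' ^ k * (of_nat d * wedge 3 u u') ^ p * (of_nat e * wedge 4 u u') ^ q))"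

lemma wedge_scale: "wedge k (c *s u) (c *s u' + c' *s u) = c ^ 2 * wedge k u u'"
  by (simp add: wedge_def algebra_simps power2_eq_square)

text \<open>
  Each wedge is quadratic in the scaling factor and insensitive to multiples of \<open>u\<close> in \<open>u'\<close>. Thus
  \<open>hom_jet\<close> divided by \<open>u\<^sub>2\<^bsup>d\<^esup>\<close> depends only on the point and on the tangent vector of projective space.
\<close>

lemma hom_jet_scale:
  assumes "a \<le> int d - 4 * int m"
  shows "hom_jet d e m a A (c *s u) (c *s u' + c' *s u) = c ^ d * hom_jet d e m a A u u'"
  unfolding hom_jet_def sum_distrib_left
proof (intro sum.cong refl, clarify, unfold sum_distrib_left, intro sum.cong refl, clarify)
  fix j k p q h i assume "(j, k, p, q) \<in> jet_exponents m" "(h, i) \<in> monomials a"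
  then have m: "j + k + p + q = m" and "4 * m + h + i \<le> d"
    using assms by (auto simp: jet_exponents_def monomials_def)
  then have "d = (d + p + q - (4 * m + h + i)) + h + i + (m - p) + (m - q) + (2 * j + 2 * k + 2 * p + 2 * q)"
    by simp
  from arg_cong[OF this, of "\<lambda>n. c ^ n"]
  have cd: "c ^ d = c ^ (d + p + q - (4 * m + h + i)) * c ^ h * c ^ i * c ^ (m - p) * c ^ (m - q) *
     ((c ^ 2) ^ j * (c ^ 2) ^ k * (c ^ 2) ^ p * (c ^ 2) ^ q)" by (simp only: power_add power_mult)
  show "A ((j, k, p, q), (h, i)) * ((c *s u) $ 0 ^ (d + p + q - (4 * m + h + i)) * (c *s u) $ 1 ^ h * (c *s u) $ 2 ^ i * (c *s u) $ 3 ^ (m - p) * (c *s u) $ 4 ^ (m - q)) *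
      (wedge 1 (c *s u) (c *s u' + c' *s u) ^ j * wedge 2 (c *s u) (c *s u' + c' *s u) ^ k *
       (of_nat d * wedge 3 (c *s u) (c *s u' + c' *s u)) ^ p * (of_nat e * wedge 4 (c *s u) (c *s u' + c' *s u)) ^ q) =
     c ^ d * (A ((j, k, p, q), (h, i)) * (u $ 0 ^ (d + p + q - (4 * m + h + i)) * u $ 1 ^ h * u $ 2 ^ i * u $ 3 ^ (m - p) * u $ 4 ^ (m - q)) *
      (wedge 1 u u' ^ j * wedge 2 u u' ^ k * (of_nat d * wedge 3 u u') ^ p * (of_nat e * wedge 4 u u') ^ q))"
    by (simp only: cd wedge_scale power_mult_distrib vector_smult_component mult_ac)
qed

text \<open>
  The powers of \<open>z\<close> match because \<open>m (d - 1) + (m - p) = (d - 1) p + d (m - p)\<close>: the first summand turns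
  \<open>(d dz)\<^sup>p\<close> into \<open>dR\<^sup>p\<close> and the second gives \<open>R\<^bsup>m-p\<^esup>\<close>. The same happens for \<open>t\<close>.
\<close>

lemma hom_jet_affine:
  fixes u u' :: "complex ^ 5"
  assumes d: "d \<ge> 1" "e \<ge> 1" and u: "u $ 0 = 1" "u' $ 0 = 0"
    and z: "u $ 3 ^ d = eval_xy R (u $ 1) (u $ 2)" and t: "u $ 4 ^ e = eval_xy S (u $ 1) (u $ 2)"
    and z': "of_nat d * u $ 3 ^ (d - 1) * u' $ 3 =
      eval_xy (diff_x R) (u $ 1) (u $ 2) * u' $ 1 + eval_xy (diff_y R) (u $ 1) (u $ 2) * u' $ 2"
    and t': "of_nat e * u $ 4 ^ (e - 1) * u' $ 4 =
      eval_xy (diff_x S) (u $ 1) (u $ 2) * u' $ 1 + eval_xy (diff_y S) (u $ 1) (u $ 2) * u' $ 2"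
  shows "u $ 3 ^ (m * (d - 1)) * u $ 4 ^ (m * (e - 1)) * hom_jet d e m a A u u' =
    eval_jet (jet_J R S m a A) (u $ 1) (u $ 2) (u' $ 1) (u' $ 2)"
  unfolding hom_jet_def eval_jet_J sum_distrib_left
proof (intro sum.cong refl, clarify)
  fix j k p q assume "(j, k, p, q) \<in> jet_exponents m"
  then have m: "j + k + p + q = m" by (auto simp: jet_exponents_def)
  have exps: "m * (d - 1) + (m - p) = (d - 1) * p + d * (m - p)" if "d \<ge> 1" "p \<le> m" for d p :: nat
  proof -
    obtain d' where "d = Suc d'" using \<open>d \<ge> 1\<close> by (cases d) auto
    moreover obtain r where "m = p + r" using \<open>p \<le> m\<close> le_Suc_ex by blast
    ultimately show ?thesis by (simp add: algebra_simps)
  qed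
  have pz: "u $ 3 ^ (m * (d - 1)) * u $ 3 ^ (m - p) * (of_nat d * u' $ 3) ^ p =
     (u' $ 1 * eval_xy (diff_x R) (u $ 1) (u $ 2) + u' $ 2 * eval_xy (diff_y R) (u $ 1) (u $ 2)) ^ p *
     eval_xy R (u $ 1) (u $ 2) ^ (m - p)"
  proof -
    have "p \<le> m" using m by simp
    from arg_cong[OF exps[OF d(1) this], of "\<lambda>n. u $ 3 ^ n"]
    have E: "u $ 3 ^ (m * (d - 1)) * u $ 3 ^ (m - p) = (u $ 3 ^ (d - 1)) ^ p * (u $ 3 ^ d) ^ (m - p)"
      by (simp only: power_add power_mult)
    have "u $ 3 ^ (m * (d - 1)) * u $ 3 ^ (m - p) * (of_nat d * u' $ 3) ^ p =
       (of_nat d * u $ 3 ^ (d - 1) * u' $ 3) ^ p * (u $ 3 ^ d) ^ (m - p)"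
      unfolding E by (simp only: power_mult_distrib mult_ac)
    then show ?thesis unfolding z z' by (simp add: mult.commute)
  qed
  have pt: "u $ 4 ^ (m * (e - 1)) * u $ 4 ^ (m - q) * (of_nat e * u' $ 4) ^ q =
     (u' $ 1 * eval_xy (diff_x S) (u $ 1) (u $ 2) + u' $ 2 * eval_xy (diff_y S) (u $ 1) (u $ 2)) ^ q *
     eval_xy S (u $ 1) (u $ 2) ^ (m - q)"
  proof -
    have "q \<le> m" using m by simp
    from arg_cong[OF exps[OF d(2) this], of "\<lambda>n. u $ 4 ^ n"]
    have E: "u $ 4 ^ (m * (e - 1)) * u $ 4 ^ (m - q) = (u $ 4 ^ (e - 1)) ^ q * (u $ 4 ^ e) ^ (m - q)"
      by (simp only: power_add power_mult)
    have "u $ 4 ^ (m * (e - 1)) * u $ 4 ^ (m - q) * (of_nat e * u' $ 4) ^ q =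
       (of_nat e * u $ 4 ^ (e - 1) * u' $ 4) ^ q * (u $ 4 ^ e) ^ (m - q)"
      unfolding E by (simp only: power_mult_distrib mult_ac)
    then show ?thesis unfolding t t' by (simp add: mult.commute)
  qed
  have w: "wedge k u u' = u' $ k" for k using u by (simp add: wedge_def)
  let ?x = "u $ 1" and ?y = "u $ 2"
  let ?L = "u $ 3 ^ (m * (d - 1)) * u $ 3 ^ (m - p) * (of_nat d * u' $ 3) ^ p"
  let ?M = "u $ 4 ^ (m * (e - 1)) * u $ 4 ^ (m - q) * (of_nat e * u' $ 4) ^ q"
  have "u $ 3 ^ (m * (d - 1)) * u $ 4 ^ (m * (e - 1)) *
     (\<Sum>(h, i)\<in>monomials a. A ((j, k, p, q), (h, i)) * (u $ 0 ^ (d + p + q - (4 * m + h + i)) * ?x ^ h * ?y ^ i * u $ 3 ^ (m - p) * u $ 4 ^ (m - q)) *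
      (wedge 1 u u' ^ j * wedge 2 u u' ^ k * (of_nat d * wedge 3 u u') ^ p * (of_nat e * wedge 4 u u') ^ q)) =
     (\<Sum>(h, i)\<in>monomials a. A ((j, k, p, q), (h, i)) * ?x ^ h * ?y ^ i) * (u' $ 1 ^ j * u' $ 2 ^ k * ?L * ?M)"
    unfolding sum_distrib_left sum_distrib_right
    by (intro sum.cong refl, clarify, simp only: w u power_one mult_1_left mult_1_right mult_ac)
  also have "\<dots> = eval_xy (A_poly a A (j, k, p, q)) ?x ?y * u' $ 1 ^ j * u' $ 2 ^ k *
      (u' $ 1 * eval_xy (diff_x R) ?x ?y + u' $ 2 * eval_xy (diff_y R) ?x ?y) ^ p *
      (u' $ 1 * eval_xy (diff_x S) ?x ?y + u' $ 2 * eval_xy (diff_y S) ?x ?y) ^ q *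
      eval_xy R ?x ?y ^ (m - p) * eval_xy S ?x ?y ^ (m - q)"
    unfolding pz pt eval_A_poly by (simp only: mult_ac)
  finally show "u $ 3 ^ (m * (d - 1)) * u $ 4 ^ (m * (e - 1)) *
     (\<Sum>(h, i)\<in>monomials a. A ((j, k, p, q), (h, i)) * (u $ 0 ^ (d + p + q - (4 * m + h + i)) * ?x ^ h * ?y ^ i * u $ 3 ^ (m - p) * u $ 4 ^ (m - q)) *
      (wedge 1 u u' ^ j * wedge 2 u u' ^ k * (of_nat d * wedge 3 u u') ^ p * (of_nat e * wedge 4 u u') ^ q)) =
     eval_xy (A_poly a A (j, k, p, q)) ?x ?y * u' $ 1 ^ j * u' $ 2 ^ k *
      (u' $ 1 * eval_xy (diff_x R) ?x ?y + u' $ 2 * eval_xy (diff_y R) ?x ?y) ^ p *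
      (u' $ 1 * eval_xy (diff_x S) ?x ?y + u' $ 2 * eval_xy (diff_y S) ?x ?y) ^ q *
      eval_xy R ?x ?y ^ (m - p) * eval_xy S ?x ?y ^ (m - q)" .
qed

text \<open>
  The last two equations come from differentiating the first two along the chart.
\<close>

lemma chart_surface_equations:
  fixes v :: "complex ^ 'k::finite"
  assumes \<alpha>: "\<alpha> \<in> charts (surface R S)" and s: "s \<in> chart_dom \<alpha> 0"
  defines "u \<equiv> aff \<alpha> 0 s" and "u' \<equiv> daff \<alpha> 0 s v"
  shows "u $ 3 ^ total_degree R = eval_xy R (u $ 1) (u $ 2)"
    "u $ 4 ^ total_degree S = eval_xy S (u $ 1) (u $ 2)"
    "of_nat (total_degree R) * u $ 3 ^ (total_degree R - 1) * u' $ 3 =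
      eval_xy (diff_x R) (u $ 1) (u $ 2) * u' $ 1 + eval_xy (diff_y R) (u $ 1) (u $ 2) * u' $ 2"
    "of_nat (total_degree S) * u $ 4 ^ (total_degree S - 1) * u' $ 4 =
      eval_xy (diff_x S) (u $ 1) (u $ 2) * u' $ 1 + eval_xy (diff_y S) (u $ 1) (u $ 2) * u' $ 2"
proof -
  have eq: "aff \<alpha> 0 s $ 3 ^ total_degree R = eval_xy R (aff \<alpha> 0 s $ 1) (aff \<alpha> 0 s $ 2)"
    "aff \<alpha> 0 s $ 4 ^ total_degree S = eval_xy S (aff \<alpha> 0 s $ 1) (aff \<alpha> 0 s $ 2)"
    if "s \<in> chart_dom \<alpha> 0" for s
    using that surface_affine_coords[of "snd \<alpha> s" R S] chart_in[OF \<alpha>, of s] by (auto simp: chart_dom_def aff_def)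
  show "u $ 3 ^ total_degree R = eval_xy R (u $ 1) (u $ 2)"
    "u $ 4 ^ total_degree S = eval_xy S (u $ 1) (u $ 2)"
    using eq[OF s] by (simp_all add: u_def)
  note D = aff_nth_derivative[OF \<alpha> s]
  have *: "of_nat n * aff \<alpha> 0 s $ k ^ (n - 1) * daff \<alpha> 0 s v $ k =
     eval_xy (diff_x F) (aff \<alpha> 0 s $ 1) (aff \<alpha> 0 s $ 2) * daff \<alpha> 0 s v $ 1 +
     eval_xy (diff_y F) (aff \<alpha> 0 s $ 1) (aff \<alpha> 0 s $ 2) * daff \<alpha> 0 s v $ 2"
    if "\<And>s. s \<in> chart_dom \<alpha> 0 \<Longrightarrow> aff \<alpha> 0 s $ k ^ n = eval_xy F (aff \<alpha> 0 s $ 1) (aff \<alpha> 0 s $ 2)" for n k F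
  proof -
    have "((\<lambda>s. eval_xy F (aff \<alpha> 0 s $ 1) (aff \<alpha> 0 s $ 2)) has_derivative
      (\<lambda>v. of_nat n * daff \<alpha> 0 s v $ k * aff \<alpha> 0 s $ k ^ (n - 1))) (at s)"
      by (rule has_derivative_transform_within_open[OF has_derivative_power[OF D[of k], of n] open_chart_dom[OF \<alpha>] s])
         (rule that)
    from fun_cong[OF has_derivative_unique[OF this has_derivative_eval_xy[OF D[of 1] D[of 2]]], of v]
    show ?thesis by (simp add: mult_ac)
  qed
  show "of_nat (total_degree R) * u $ 3 ^ (total_degree R - 1) * u' $ 3 =
      eval_xy (diff_x R) (u $ 1) (u $ 2) * u' $ 1 + eval_xy (diff_y R) (u $ 1) (u $ 2) * u' $ 2"
    "of_nat (total_degree S) * u $ 4 ^ (total_degree S - 1) * u' $ 4 =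
      eval_xy (diff_x S) (u $ 1) (u $ 2) * u' $ 1 + eval_xy (diff_y S) (u $ 1) (u $ 2) * u' $ 2"
    unfolding u_def u'_def by (rule *, rule eq, assumption)+
qed

section \<open>The finite set of indeterminacy points\<close>

text \<open>
  The points covered neither by the expression valid for \<open>u\<^sub>2 \<noteq> 0\<close> nor by the one valid for \<open>u\<^sub>0, u\<^sub>3, u\<^sub>4 \<noteq> 0\<close>.
\<close>

definition bad_points :: "poly_xy \<Rightarrow> poly_xy \<Rightarrow> 5 proj set" where
  "bad_points R S = {p \<in> surface R S. p \<notin> affine_part 2 \<and>
     (p \<notin> affine_part 0 \<or> p \<notin> affine_part 3 \<or> p \<notin> affine_part 4)}"

lemma finite_roots_of_power: "n \<ge> 1 \<Longrightarrow> finite {z :: complex. z ^ n = c}"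
  by (rule finite_subset[OF _ poly_roots_finite[of "monom 1 n - [:c:]"]])
     (auto simp: poly_monom monom_eq_const_iff)

lemma finite_axis_zeros:
  assumes "G1 R S"
  shows "finite {x. eval_xy R x 0 = 0}" "finite {x. eval_xy S x 0 = 0}"
proof -
  have "finite {x. eval_xy F x 0 = 0}" if "coeff_xy F n 0 \<noteq> 0" for F n
  proof -
    have "{x. eval_xy F x 0 = 0} = {x. poly (coeff F 0) x = 0}"
      by (simp add: eval_xy_def poly_0_coeff_0)
    moreover have "coeff F 0 \<noteq> 0" using that by (auto simp: coeff_xy_def)
    ultimately show ?thesis using poly_roots_finite by simp
  qed
  then show "finite {x. eval_xy R x 0 = 0}" "finite {x. eval_xy S x 0 = 0}"
    using assms unfolding G1_def by blast+
qed

text \<open>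
  At finite distance such a point has \<open>y = 0\<close> and \<open>z = 0\<close> or \<open>t = 0\<close>, so \<open>x\<close> is a zero of \<open>R(x,0)\<close>
  or of \<open>S(x,0)\<close>, both nonzero by (G1). At infinity \<open>u\<^sub>0 = u\<^sub>2 = 0\<close>, and (G6) applies
  once \<open>u\<^sub>1 \<noteq> 0\<close> is known.
\<close>

lemma finite_bad_points:
  assumes "G1 R S" "G6 R S" "total_degree R \<ge> 1" "total_degree S \<ge> 1"
  shows "finite (bad_points R S)"
proof -
  define Q where "Q = (\<lambda>(x, z, t). abs_proj (point5 1 x 0 z t))"
  define E where "E = {x. eval_xy R x 0 = 0} \<union> {x. eval_xy S x 0 = 0}"
  let ?F = "(SIGMA x:E. {z. z ^ total_degree R = eval_xy R x 0} \<times> {t. t ^ total_degree S = eval_xy S x 0})"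
  have "finite ?F"
    unfolding E_def using finite_axis_zeros[OF assms(1)] assms(3,4)
    by (intro finite_SigmaI finite_UnI finite_cartesian_product finite_roots_of_power) auto
  then have fin1: "finite (Q ` ?F)" by blast
  have fin2: "finite (surface R S \<inter> proj_locus [\<lambda>u. u $ 0] \<inter> affine_part 1 \<inter> proj_locus [\<lambda>u. u $ 2])"
    using assms(2) unfolding G6_def by blast
  have "bad_points R S \<subseteq> Q ` ?F \<union> (surface R S \<inter> proj_locus [\<lambda>u. u $ 0] \<inter> affine_part 1 \<inter> proj_locus [\<lambda>u. u $ 2])"
  proof
    fix p assume p: "p \<in> bad_points R S"
    then have pX: "p \<in> surface R S" and p2: "p \<notin> affine_part 2" by (auto simp: bad_points_def)
    show "p \<in> Q ` ?F \<union> (surface R S \<inter> proj_locus [\<lambda>u. u $ 0] \<inter> affine_part 1 \<inter> proj_locus [\<lambda>u. u $ 2])"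
    proof (cases "p \<in> affine_part 0")
      case True
      define u where "u = affine_coords 0 p"
      have u0: "u $ 0 = 1" using True by (simp add: u_def)
      have u2: "u $ 2 = 0" using in_affine_part_iff_coords[OF True, of 2] p2 by (simp add: u_def)
      have "u $ 3 = 0 \<or> u $ 4 = 0"
        using in_affine_part_iff_coords[OF True] p True by (auto simp: u_def bad_points_def)
      moreover note eqs = surface_affine_coords[OF pX True, folded u_def, unfolded u2]
      ultimately have "(u $ 1, u $ 3, u $ 4) \<in> ?F" using assms(3,4) by (auto simp: E_def power_0_left)
      moreover have "u = point5 1 (u $ 1) 0 (u $ 3) (u $ 4)"
        using u0 u2 by (simp add: vec_eq_iff forall_5)
      then have "p = Q (u $ 1, u $ 3, u $ 4)"
        unfolding Q_def using abs_proj_affine_coords[OF True] by (simp add: u_def)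
      ultimately show ?thesis by blast
    next
      case False
      define v where "v = rep_proj p"
      have v: "v \<noteq> 0" "abs_proj v = p" "v $ 0 = 0" "v $ 2 = 0"
        using rep_proj_nonzero[of p] False p2 by (auto simp: v_def affine_part_def)
      have eqs: "eqn_z R v = 0" "eqn_t S v = 0"
        using pX abs_proj_in_surface_iff[OF v(1)] v(2) by auto
      have "v $ 1 \<noteq> 0"
      proof
        \<comment> \<open>Then \<open>R\<close> and \<open>S\<close> vanish at \<open>v\<close>, and the equations of the surface force \<open>v = 0\<close>.\<close>
        assume v1: "v $ 1 = 0"
        have h0: "homogenize F v = 0" if "total_degree F \<ge> 1" for F
        proof -
          have "homogenize F v = homogenize F (0 *s v)" using v v1 by (simp add: homogenize_def)
          then show ?thesis using homogenize_scale[of F 0 v] that by (simp add: power_0_left)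
        qed
        have "v $ 3 = 0" "v $ 4 = 0"
          using eqs h0[OF assms(3)] h0[OF assms(4)] by (auto simp: eqn_z_def eqn_t_def)
        then have "v = 0" using v v1 by (simp add: vec_eq_iff forall_5)
        then show False using v(1) by blast
      qed
      then have "p \<in> affine_part 1" by (simp add: affine_part_def v_def)
      moreover have "p \<in> proj_locus [\<lambda>u. u $ 0]" "p \<in> proj_locus [\<lambda>u. u $ 2]"
        using v unfolding proj_locus_def by auto
      ultimately show ?thesis using pX by blast
    qed
  qed
  then show ?thesis using fin1 fin2 finite_subset by blast
qed

section \<open>Extension of the differential over the surface\<close>

lemma holo_eval_xy:
  "holomorphic_fun_on V f \<Longrightarrow> holomorphic_fun_on V g \<Longrightarrow> holomorphic_fun_on V (\<lambda>s. eval_xy F (f s) (g s))"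
  unfolding eval_xy_altdef by (intro holo_sum holo_mult holo_power holo_const)

lemma hom_jet_holo:
  assumes "\<alpha> \<in> charts X"
  shows "holomorphic_fun_on (chart_dom \<alpha> i) (\<lambda>s. hom_jet d e m a A (aff \<alpha> i s) (daff \<alpha> i s v))"
  unfolding hom_jet_def wedge_def case_prod_unfold
  by (intro holo_sum holo_mult holo_power holo_const holo_diff aff_nth_holo[OF assms] daff_nth_holo[OF assms])

lemma form_on_hom_jet:
  fixes \<alpha> :: "(2, 5) chart"
  assumes "\<alpha> \<in> charts X" "s \<in> chart_dom \<alpha> i"
  shows "form_on m (\<lambda>v. hom_jet d e m a A (aff \<alpha> i s) (daff \<alpha> i s v))"
  unfolding hom_jet_def
proof (intro form_on_sum, unfold case_prod_unfold, intro form_on_sum form_on_scale)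
  fix x assume "x \<in> jet_exponents m"
  then have m: "fst x * 1 + fst (snd x) * 1 + fst (snd (snd x)) * 1 + snd (snd (snd x)) * 1 = m"
    by (auto simp: jet_exponents_def)
  have w: "form_on 1 (\<lambda>v. wedge k (aff \<alpha> i s) (daff \<alpha> i s v))" for k
    unfolding wedge_def
    using form_on_add[OF form_on_scale[OF form_on_daff[OF assms], of "aff \<alpha> i s $ 0" k]
       form_on_scale[OF form_on_daff[OF assms], of "- aff \<alpha> i s $ k" 0]] by simp
  show "form_on m (\<lambda>v. wedge 1 (aff \<alpha> i s) (daff \<alpha> i s v) ^ fst x * wedge 2 (aff \<alpha> i s) (daff \<alpha> i s v) ^ fst (snd x) *
      (of_nat d * wedge 3 (aff \<alpha> i s) (daff \<alpha> i s v)) ^ fst (snd (snd x)) *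
      (of_nat e * wedge 4 (aff \<alpha> i s) (daff \<alpha> i s v)) ^ snd (snd (snd x)))"
    by (subst m[symmetric]) (intro form_on_mult form_on_power form_on_scale w)
qed

lemma coeff_jet_form_degree:
  assumes "jet_J R S m a A = var_y ^ d * P" "coeff_jet P j k \<noteq> 0"
  shows "j + k = m"
proof -
  have "coeff_jet (jet_J R S m a A) j k \<noteq> 0"
    using assms by (simp add: coeff_jet_var_y_mult)
  then show ?thesis using jet_form_J[OF tdeg_le_total_degree tdeg_le_total_degree] unfolding jet_form_def by blast
qed

text \<open>
  The section in the chart \<open>\<alpha>\<close>, off the indeterminacy points. In the first case the affine coordinates with \<open>u\<^sub>2 = 1\<close>
  are used, so that the denominator \<open>u\<^sub>2\<^bsup>d\<^esup>\<close> disappears.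
\<close>

definition local_form :: "nat \<Rightarrow> nat \<Rightarrow> nat \<Rightarrow> int \<Rightarrow> coeff_family \<Rightarrow> jet_poly \<Rightarrow> (2, 5) chart \<Rightarrow> complex ^ 2 \<Rightarrow> complex ^ 2 \<Rightarrow> complex" where
  "local_form d e m a A P \<alpha> s v =
    (if s \<in> chart_dom \<alpha> 2 then hom_jet d e m a A (aff \<alpha> 2 s) (daff \<alpha> 2 s v)
     else eval_jet P (aff \<alpha> 0 s $ 1) (aff \<alpha> 0 s $ 2) (daff \<alpha> 0 s v $ 1) (daff \<alpha> 0 s v $ 2) /
       (aff \<alpha> 0 s $ 3 ^ (m * (d - 1)) * aff \<alpha> 0 s $ 4 ^ (m * (e - 1))))"

context
  fixes R S :: poly_xy and d e m :: nat and a :: int and A :: coeff_family and P :: jet_poly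
  assumes d: "total_degree R = d" "d \<ge> 1" and e: "total_degree S = e" "e \<ge> 1"
    and a: "a \<le> int d - 4 * int m" and J: "jet_J R S m a A = var_y ^ d * P"
begin

text \<open>
  Both sides are the jet differential, by the scaling law and by the division of \<open>J\<close> by \<open>y\<^bsup>d\<^esup>\<close>.
\<close>

lemma hom_jet_eq_quotient:
  assumes \<alpha>: "\<alpha> \<in> charts (surface R S)"
    and s: "s \<in> chart_dom \<alpha> 2" "s \<in> chart_dom \<alpha> 0" "s \<in> chart_dom \<alpha> 3" "s \<in> chart_dom \<alpha> 4"
  shows "hom_jet d e m a A (aff \<alpha> 2 s) (daff \<alpha> 2 s v) =
    eval_jet P (aff \<alpha> 0 s $ 1) (aff \<alpha> 0 s $ 2) (daff \<alpha> 0 s v $ 1) (daff \<alpha> 0 s v $ 2) /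
       (aff \<alpha> 0 s $ 3 ^ (m * (d - 1)) * aff \<alpha> 0 s $ 4 ^ (m * (e - 1)))"
proof -
  let ?u = "aff \<alpha> 0 s" and ?u' = "daff \<alpha> 0 s v"
  have nz: "?u $ 2 \<noteq> 0" "?u $ 3 \<noteq> 0" "?u $ 4 \<noteq> 0" using s aff_nonzero_iff[OF \<alpha> s(2)] by blast+
  obtain c' where c': "daff \<alpha> 2 s v = (1 / ?u $ 2) *s ?u' + c' *s ?u"
    using aff_change(2)[OF \<alpha> s(2,1)] by blast
  have "hom_jet d e m a A (aff \<alpha> 2 s) (daff \<alpha> 2 s v) =
     hom_jet d e m a A ((1 / ?u $ 2) *s ?u) ((1 / ?u $ 2) *s ?u' + c' *s ?u)"
    unfolding c' aff_change(1)[OF \<alpha> s(2,1)] ..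
  also have "\<dots> = (1 / ?u $ 2) ^ d * hom_jet d e m a A ?u ?u'"
    by (rule hom_jet_scale[OF a])
  finally have 1: "hom_jet d e m a A (aff \<alpha> 2 s) (daff \<alpha> 2 s v) * ?u $ 2 ^ d = hom_jet d e m a A ?u ?u'"
    using nz by (simp add: power_divide)
  have "?u $ 3 ^ (m * (d - 1)) * ?u $ 4 ^ (m * (e - 1)) * hom_jet d e m a A ?u ?u' =
     eval_jet (jet_J R S m a A) (?u $ 1) (?u $ 2) (?u' $ 1) (?u' $ 2)"
    using chart_surface_equations[OF \<alpha> s(2)] aff_self[OF \<alpha> s(2)] daff_self[OF \<alpha> s(2)] d e
    by (intro hom_jet_affine) auto
  also have "\<dots> = ?u $ 2 ^ d * eval_jet P (?u $ 1) (?u $ 2) (?u' $ 1) (?u' $ 2)"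
    unfolding J by simp
  finally have "?u $ 2 ^ d * (?u $ 3 ^ (m * (d - 1)) * ?u $ 4 ^ (m * (e - 1)) * hom_jet d e m a A (aff \<alpha> 2 s) (daff \<alpha> 2 s v)) =
     ?u $ 2 ^ d * eval_jet P (?u $ 1) (?u $ 2) (?u' $ 1) (?u' $ 2)"
    unfolding 1[symmetric] by (simp only: mult_ac)
  then have "?u $ 3 ^ (m * (d - 1)) * ?u $ 4 ^ (m * (e - 1)) * hom_jet d e m a A (aff \<alpha> 2 s) (daff \<alpha> 2 s v) =
     eval_jet P (?u $ 1) (?u $ 2) (?u' $ 1) (?u' $ 2)"
    using nz by simp
  then show ?thesis using nz by (simp add: field_simps)
qed

lemma local_form_holo:
  assumes \<alpha>: "\<alpha> \<in> charts (surface R S)"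
  defines "Z \<equiv> {s \<in> fst \<alpha>. snd \<alpha> s \<in> bad_points R S}"
  shows "holomorphic_fun_on (fst \<alpha> - Z) (\<lambda>s. local_form d e m a A P \<alpha> s v)"
    "s \<in> fst \<alpha> - Z \<Longrightarrow> form_on m (local_form d e m a A P \<alpha> s)"
proof -
  let ?D = "chart_dom \<alpha> 0 \<inter> chart_dom \<alpha> 3 \<inter> chart_dom \<alpha> 4"
  let ?Q = "\<lambda>s v. eval_jet P (aff \<alpha> 0 s $ 1) (aff \<alpha> 0 s $ 2) (daff \<alpha> 0 s v $ 1) (daff \<alpha> 0 s v $ 2) /
       (aff \<alpha> 0 s $ 3 ^ (m * (d - 1)) * aff \<alpha> 0 s $ 4 ^ (m * (e - 1)))"
  have cover: "fst \<alpha> - Z = chart_dom \<alpha> 2 \<union> ?D"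
    using chart_in[OF \<alpha>] by (auto simp: Z_def bad_points_def chart_dom_def)
  have nz: "aff \<alpha> 0 s $ 3 \<noteq> 0" "aff \<alpha> 0 s $ 4 \<noteq> 0" if "s \<in> ?D" for s
    using that aff_nonzero_iff[OF \<alpha>, of s 0] by blast+
  have eq: "local_form d e m a A P \<alpha> s v = ?Q s v" if "s \<in> ?D" for s v
    using hom_jet_eq_quotient[OF \<alpha>, of s v] that by (auto simp: local_form_def)
  have sub: "?D \<subseteq> chart_dom \<alpha> 0" by blast
  have opD: "open ?D" by (intro open_Int open_chart_dom[OF \<alpha>])
  have "holomorphic_fun_on ?D (\<lambda>s. ?Q s v)"
    unfolding eval_jet_altdef
    by (intro holo_divide holo_sum holo_mult holo_power holo_eval_xy
       holo_subset[OF aff_nth_holo[OF \<alpha>] sub] holo_subset[OF daff_nth_holo[OF \<alpha>] sub]) (use nz in auto)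
  then have 1: "holomorphic_fun_on ?D (\<lambda>s. local_form d e m a A P \<alpha> s v)"
    by (rule holo_transform[OF _ opD]) (simp add: eq)
  have 2: "holomorphic_fun_on (chart_dom \<alpha> 2) (\<lambda>s. local_form d e m a A P \<alpha> s v)"
    by (rule holo_transform[OF hom_jet_holo[OF \<alpha>] open_chart_dom[OF \<alpha>]]) (simp add: local_form_def)
  show "holomorphic_fun_on (fst \<alpha> - Z) (\<lambda>s. local_form d e m a A P \<alpha> s v)"
    unfolding cover holo_Un using 1 2 by blast
  assume s: "s \<in> fst \<alpha> - Z"
  show "form_on m (local_form d e m a A P \<alpha> s)"
  proof (cases "s \<in> chart_dom \<alpha> 2")
    case True
    then show ?thesis using form_on_hom_jet[OF \<alpha> True, of m d e a A] by (simp add: local_form_def[abs_def])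
  next
    case False
    then have sD: "s \<in> ?D" using s cover by blast
    have "form_on m (\<lambda>v. eval_xy (coeff_jet P j k) (aff \<alpha> 0 s $ 1) (aff \<alpha> 0 s $ 2) * (daff \<alpha> 0 s v $ 1 ^ j * daff \<alpha> 0 s v $ 2 ^ k))" for j k
    proof (cases "coeff_jet P j k = 0")
      case True
      then show ?thesis by (simp add: form_on_0)
    next
      case False
      then have jk: "j * 1 + k * 1 = m" using coeff_jet_form_degree[OF J] by simp
      show ?thesis
        by (subst jk[symmetric]) (intro form_on_scale form_on_mult form_on_power form_on_daff[OF \<alpha>], use sD in auto)
    qed
    then have "form_on m (\<lambda>v. inverse (aff \<alpha> 0 s $ 3 ^ (m * (d - 1)) * aff \<alpha> 0 s $ 4 ^ (m * (e - 1))) *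
        eval_jet P (aff \<alpha> 0 s $ 1) (aff \<alpha> 0 s $ 2) (daff \<alpha> 0 s v $ 1) (daff \<alpha> 0 s v $ 2))"
      unfolding eval_jet_altdef mult.assoc by - (rule form_on_scale, intro form_on_sum)
    then show ?thesis using False by (simp add: local_form_def[abs_def] divide_inverse mult.commute)
  qed
qed

lemma local_form_regular:
  assumes \<alpha>: "\<alpha> \<in> charts (surface R S)"
    and s: "s \<in> chart_dom \<alpha> 2" "s \<in> chart_dom \<alpha> 0" "s \<in> chart_dom \<alpha> 3" "s \<in> chart_dom \<alpha> 4"
  shows "local_form d e m a A P \<alpha> s v = jet_differential R S m a A (aff \<alpha> 0 s) (daff \<alpha> 0 s v)"
proof -
  have nz: "aff \<alpha> 0 s $ 2 \<noteq> 0" using s aff_nonzero_iff[OF \<alpha> s(2)] by blast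
  then show ?thesis
    using hom_jet_eq_quotient[OF \<alpha> s, of v] s(1) by (simp add: local_form_def jet_differential_def J d(1) e(1))
qed

text \<open>
  In each chart the coefficients extend over the finitely many indeterminacy points. The local
  expression depends only on the point and the tangent vector, which gives the transition law off these
  points, and by continuity at them.
\<close>

lemma section_extends:
  assumes fin: "finite (bad_points R S)"
  shows "\<exists>\<omega>\<in>holomorphic_sections (surface R S) m. \<forall>\<alpha>\<in>charts (surface R S). \<forall>s\<in>fst \<alpha>. \<forall>v.
    snd \<alpha> s \<notin> bad_points R S \<longrightarrow> \<omega> (\<alpha>, s, v) = local_form d e m a A P \<alpha> s v"
proof -
  let ?X = "surface R S"
  define Z :: "(2, 5) chart \<Rightarrow> (complex ^ 2) set" where "Z = (\<lambda>\<alpha>. {s \<in> fst \<alpha>. snd \<alpha> s \<in> bad_points R S})"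
  have finZ: "finite (Z \<alpha>)" if "\<alpha> \<in> charts ?X" for \<alpha> :: "(2, 5) chart"
    unfolding Z_def by (rule finite_chart_preimage[OF that fin])
  have "\<forall>\<alpha>\<in>(charts ?X :: (2, 5) chart set). \<exists>f. (\<forall>j\<le>m. holomorphic_fun_on (fst \<alpha>) (f j)) \<and>
     (\<forall>s\<in>fst \<alpha> - Z \<alpha>. \<forall>v. local_form d e m a A P \<alpha> s v = (\<Sum>j\<le>m. f j s * (v $ 1) ^ j * (v $ 2) ^ (m - j)))"
  proof
    fix \<alpha> :: "(2, 5) chart" assume \<alpha>: "\<alpha> \<in> charts ?X"
    have Z\<alpha>: "Z \<alpha> = {s \<in> fst \<alpha>. snd \<alpha> s \<in> bad_points R S}" by (simp add: Z_def)
    show "\<exists>f. (\<forall>j\<le>m. holomorphic_fun_on (fst \<alpha>) (f j)) \<and>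
     (\<forall>s\<in>fst \<alpha> - Z \<alpha>. \<forall>v. local_form d e m a A P \<alpha> s v = (\<Sum>j\<le>m. f j s * (v $ 1) ^ j * (v $ 2) ^ (m - j)))"
      by (rule holo_form_extends[OF chart_open[OF \<alpha>] finZ[OF \<alpha>]])
         (use local_form_holo[OF \<alpha>] in \<open>simp_all add: Z\<alpha>\<close>)
  qed
  from bchoice[OF this] obtain f where ff: "\<forall>\<alpha>\<in>(charts ?X :: (2, 5) chart set). (\<forall>j\<le>m. holomorphic_fun_on (fst \<alpha>) (f \<alpha> j)) \<and>
     (\<forall>s\<in>fst \<alpha> - Z \<alpha>. \<forall>v. local_form d e m a A P \<alpha> s v = (\<Sum>j\<le>m. f \<alpha> j s * (v $ 1) ^ j * (v $ 2) ^ (m - j)))" ..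
  have f: "holomorphic_fun_on (fst \<alpha>) (f \<alpha> j)" if "\<alpha> \<in> charts ?X" "j \<le> m" for \<alpha> j
    using ff that by blast
  have f_eq: "local_form d e m a A P \<alpha> s v = (\<Sum>j\<le>m. f \<alpha> j s * (v $ 1) ^ j * (v $ 2) ^ (m - j))"
    if "\<alpha> \<in> charts ?X" "s \<in> fst \<alpha> - Z \<alpha>" for \<alpha> s v
    using ff that by blast
  define F where "F = (\<lambda>\<alpha> s v :: complex ^ 2. \<Sum>j\<le>m. f \<alpha> j s * (v $ 1) ^ j * (v $ 2) ^ (m - j))"
  define \<omega> where "\<omega> = (\<lambda>(\<alpha>, s, v). if \<alpha> \<in> charts ?X \<and> s \<in> fst \<alpha> then F \<alpha> s v else 0)"
  have trans: "F \<alpha> s v = F \<beta> (transition \<alpha> \<beta> s) (frechet_derivative (transition \<alpha> \<beta>) (at s) v)"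
    if \<alpha>: "\<alpha> \<in> charts ?X" and \<beta>: "\<beta> \<in> charts ?X" and s: "s \<in> fst \<alpha>" "snd \<alpha> s \<in> snd \<beta> ` fst \<beta>" for \<alpha> \<beta> s v
  proof -
    define W where "W = {s \<in> fst \<alpha>. snd \<alpha> s \<in> snd \<beta> ` fst \<beta>}"
    define T where "T = transition \<alpha> \<beta>"
    define T' where "T' = (\<lambda>s. frechet_derivative T (at s))"
    note tr = transition_facts[OF \<alpha> \<beta> W_def T_def, folded T'_def]
    have sW: "s \<in> W" using s by (simp add: W_def)
    have good: "F \<alpha> s v = F \<beta> (T s) (T' s v)" if "s \<in> W - Z \<alpha>" for s v
    proof -
      have s: "s \<in> W" "s \<in> fst \<alpha> - Z \<alpha>" using that by (auto simp: W_def)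
      then have Ts: "T s \<in> fst \<beta> - Z \<beta>" using tr(2,3)[OF s(1)] by (auto simp: Z_def W_def)
      have dom: "s \<in> chart_dom \<alpha> i \<longleftrightarrow> T s \<in> chart_dom \<beta> i" for i
        using tr(2,3)[OF s(1)] s(2) by (auto simp: chart_dom_def)
      have q: "aff \<alpha> i s = aff \<beta> i (T s)" for i
        using tr(3)[OF s(1)] by (simp add: aff_def)
      have q': "daff \<alpha> i s v = daff \<beta> i (T s) (T' s v)" if "s \<in> chart_dom \<alpha> i" for i
        using tr(5)[OF s(1) that] by (simp add: T'_def)
      have "s \<in> chart_dom \<alpha> 2 \<or> s \<in> chart_dom \<alpha> 0"
        using s(2) chart_in[OF \<alpha>] by (auto simp: Z_def bad_points_def chart_dom_def)
      then have "local_form d e m a A P \<alpha> s v = local_form d e m a A P \<beta> (T s) (T' s v)"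
        unfolding local_form_def using dom q q' by auto
      then show ?thesis using f_eq[OF \<alpha> s(2), of v] f_eq[OF \<beta> Ts, of "T' s v"] by (simp add: F_def)
    qed
    show ?thesis
    proof (cases "s \<in> Z \<alpha>")
      case False
      then show ?thesis using good[of s v] sW by (simp add: T_def T'_def)
    next
      case True
      \<comment> \<open>At an indeterminacy point both sides are continuous, and they agree nearby.\<close>
      have ev: "\<forall>\<^sub>F x in at s. x \<in> W - Z \<alpha>"
      proof -
        have "open (W - (Z \<alpha> - {s}))"
          using tr(1) finZ[OF \<alpha>] by (intro open_Diff finite_imp_closed) auto
        then have "\<forall>\<^sub>F x in at s. x \<in> W - (Z \<alpha> - {s})"
          by (rule eventually_at_in_open') (use sW in auto)
        then show ?thesis
          using eventually_neq_at_within[of s s UNIV] by eventually_elim auto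
      qed
      have lim_at: "(g \<longlongrightarrow> g s) (at s)" if "continuous_on U g" "open U" "s \<in> U" for U and g :: "complex ^ 2 \<Rightarrow> complex"
        using that continuous_on_eq_continuous_at isCont_def by blast
      have lim1: "((\<lambda>x. F \<alpha> x v) \<longlongrightarrow> F \<alpha> s v) (at s)"
        unfolding F_def
        by (intro tendsto_intros lim_at[OF holo_imp_continuous_on[OF f[OF \<alpha>]]] chart_open[OF \<alpha>] s) auto
      have T: "(T \<longlongrightarrow> T s) (at s)"
        using tr(1,4) sW continuous_on_eq_continuous_at isCont_def by blast
      have fT: "((\<lambda>x. f \<beta> j (T x)) \<longlongrightarrow> f \<beta> j (T s)) (at s)" if "j \<le> m" for j
      proof (rule isCont_tendsto_compose[OF _ T])
        show "isCont (f \<beta> j) (T s)"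
          using holo_imp_continuous_on[OF f[OF \<beta> that]] chart_open[OF \<beta>] tr(2)[OF sW]
            continuous_on_eq_continuous_at by blast
      qed
      have T': "((\<lambda>x. T' x v $ k) \<longlongrightarrow> T' s v $ k) (at s)" for k
      proof (rule lim_at[OF _ tr(1) sW])
        show "continuous_on W (\<lambda>x. T' x v $ k)"
          using frechet_derivative_continuous[OF tr(1) tr(6)[of k], of v] tr(7) by (simp add: T'_def cong: continuous_on_cong)
      qed
      have lim2: "((\<lambda>x. F \<beta> (T x) (T' x v)) \<longlongrightarrow> F \<beta> (T s) (T' s v)) (at s)"
        unfolding F_def by (intro tendsto_intros fT T') auto
      have "\<forall>\<^sub>F x in at s. F \<alpha> x v = F \<beta> (T x) (T' x v)"
        using ev by eventually_elim (rule good)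
      then have "((\<lambda>x. F \<alpha> x v) \<longlongrightarrow> F \<beta> (T s) (T' s v)) (at s)"
        using lim2 by (simp add: tendsto_cong)
      then have "F \<alpha> s v = F \<beta> (T s) (T' s v)"
        using lim1 tendsto_unique[of "at s"] by (metis at_neq_bot)
      then show ?thesis by (simp add: T_def T'_def)
    qed
  qed
  have "\<omega> \<in> holomorphic_sections ?X m"
    unfolding holomorphic_sections_def mem_Collect_eq
  proof (intro conjI)
    show "\<forall>V \<phi> s v. (V, \<phi>) \<notin> charts ?X \<or> s \<notin> V \<longrightarrow> \<omega> ((V, \<phi>), s, v) = 0"
      by (auto simp: \<omega>_def)
    show "\<forall>(V, \<phi>)\<in>charts ?X. \<exists>f. (\<forall>j\<le>m. holomorphic_fun_on V (f j)) \<and>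
       (\<forall>s\<in>V. \<forall>v. \<omega> ((V, \<phi>), s, v) = (\<Sum>j\<le>m. f j s * v $ 1 ^ j * v $ 2 ^ (m - j)))"
    proof (intro ballI, clarify)
      fix V and \<phi> :: "complex ^ 2 \<Rightarrow> 5 proj" assume "(V, \<phi>) \<in> charts ?X"
      then show "\<exists>f. (\<forall>j\<le>m. holomorphic_fun_on V (f j)) \<and>
       (\<forall>s\<in>V. \<forall>v. \<omega> ((V, \<phi>), s, v) = (\<Sum>j\<le>m. f j s * v $ 1 ^ j * v $ 2 ^ (m - j)))"
        using f by (intro exI[of _ "f (V, \<phi>)"]) (force simp: \<omega>_def F_def)
    qed
    show "\<forall>\<alpha>\<in>charts ?X. \<forall>\<beta>\<in>charts ?X. \<forall>s\<in>fst \<alpha>. snd \<alpha> s \<in> snd \<beta> ` fst \<beta> \<longrightarrow>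
        (\<forall>v. \<omega> (\<alpha>, s, v) = \<omega> (\<beta>, transition \<alpha> \<beta> s, frechet_derivative (transition \<alpha> \<beta>) (at s) v))"
    proof (intro ballI impI allI)
      fix \<alpha> \<beta> :: "(2, 5) chart" and s v
      assume *: "\<alpha> \<in> charts ?X" "\<beta> \<in> charts ?X" "s \<in> fst \<alpha>" "snd \<alpha> s \<in> snd \<beta> ` fst \<beta>"
      have "transition \<alpha> \<beta> s \<in> fst \<beta>"
        by (rule transition_facts(2)[OF *(1,2) refl refl]) (use * in auto)
      then show "\<omega> (\<alpha>, s, v) = \<omega> (\<beta>, transition \<alpha> \<beta> s, frechet_derivative (transition \<alpha> \<beta>) (at s) v)"
        using trans[OF *] * by (simp add: \<omega>_def)
    qed
  qed
  moreover have "\<omega> (\<alpha>, s, v) = local_form d e m a A P \<alpha> s v"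
    if "\<alpha> \<in> charts ?X" "s \<in> fst \<alpha>" "snd \<alpha> s \<notin> bad_points R S" for \<alpha> s v
    using that f_eq[of \<alpha> s v] by (simp add: \<omega>_def F_def Z_def)
  ultimately show ?thesis by blast
qed

end

section \<open>Density of the regular points\<close>

lemma exists_nonroot:
  assumes "F \<noteq> 0"
  shows "\<exists>x y. eval_xy F x y \<noteq> 0"
proof (rule ccontr)
  assume "\<not> ?thesis"
  then have "F = 0"
    by (intro eval_xy_eq_0_imp[of UNIV]) (auto simp: infinite_UNIV_char_0)
  with assms show False by simp
qed

lemma homogenize_cong: "u $ 0 = v $ 0 \<Longrightarrow> u $ 1 = v $ 1 \<Longrightarrow> u $ 2 = v $ 2 \<Longrightarrow> homogenize F u = homogenize F v"
  by (simp add: homogenize_def)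

text \<open>
  The power map is open, also at its branch point \<open>z = 0\<close>.
\<close>

lemma nearby_root:
  fixes z :: complex
  assumes "n \<ge> 1" "r > 0"
  shows "\<exists>\<delta>>0. \<forall>w. dist w (z ^ n) < \<delta> \<longrightarrow> (\<exists>z'. dist z' z < r \<and> z' ^ n = w)"
proof -
  have "open ((\<lambda>x. x ^ n) ` ball z r)"
  proof (rule open_mapping_thm[of _ UNIV])
    show "\<not> (\<lambda>x :: complex. x ^ n) constant_on UNIV"
      using assms(1) unfolding constant_on_def by (metis UNIV_I one_neq_zero power_one zero_power less_le_trans zero_less_one)
  qed (auto intro!: holomorphic_intros)
  moreover have "z ^ n \<in> (\<lambda>x. x ^ n) ` ball z r" using assms(2) by auto
  ultimately obtain \<delta> where "\<delta> > 0" "ball (z ^ n) \<delta> \<subseteq> (\<lambda>x. x ^ n) ` ball z r"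
    using open_contains_ball by metis
  then show ?thesis by (intro exI[of _ \<delta>]) (force simp: dist_commute subset_iff)
qed

lemma norm_vec5_le:
  fixes v :: "complex ^ 5"
  assumes "\<And>k. norm (v $ k) \<le> r / 10" "r > 0"
  shows "norm v < r"
proof -
  have "norm v \<le> (\<Sum>k\<in>UNIV. norm (v $ k))" unfolding norm_vec_def by (rule L2_set_le_sum) simp
  also have "\<dots> \<le> of_nat (card (UNIV :: 5 set)) * (r / 10)" by (rule sum_bounded_above) (rule assms)
  finally show ?thesis using assms(2) by simp
qed

text \<open>
  A given point is moved along the complex line through \<open>(u\<^sub>0, u\<^sub>1, u\<^sub>2)\<close> and a generic point of the plane. On this
  line \<open>u\<^sub>0 u\<^sub>2 R S\<close> is a nonzero holomorphic function, hence nonzero arbitrarily near the start, and the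
  coordinates \<open>u\<^sub>3\<close> and \<open>u\<^sub>4\<close> follow as nearby roots.
\<close>

lemma surface_subset_closure_regular:
  assumes R: "total_degree R \<ge> 1" and S: "total_degree S \<ge> 1"
  shows "surface R S \<subseteq> closure (surface R S \<inter>
    (affine_part 0 \<inter> {p. affine_coords 0 p \<in> {q. q $ 2 \<noteq> 0 \<and> q $ 3 \<noteq> 0 \<and> q $ 4 \<noteq> 0}}))" (is "_ \<subseteq> closure ?Y")
proof
  fix p assume p: "p \<in> surface R S"
  have "U \<inter> ?Y \<noteq> {}" if U: "open U" "p \<in> U" for U
  proof -
    define u where "u = rep_proj p"
    have u: "u \<noteq> 0" "abs_proj u = p" by (simp_all add: u_def rep_proj_nonzero)
    have eqs: "u $ 3 ^ total_degree R = homogenize R u" "u $ 4 ^ total_degree S = homogenize S u"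
      using p abs_proj_in_surface_iff[OF u(1), of R S] u(2) by (auto simp: eqn_z_def eqn_t_def)
    have "open {u. u \<noteq> 0 \<and> abs_proj u \<in> U}" using U(1) by (simp add: open_proj_def)
    then obtain r where r: "r > 0" "ball u r \<subseteq> {u. u \<noteq> 0 \<and> abs_proj u \<in> U}"
      using u U(2) open_contains_ball by (metis (mono_tags, lifting) mem_Collect_eq)
    have "[:0, 1:] * R * S \<noteq> 0" using R S by (auto simp: total_degree_def split: if_splits)
    then obtain x y where xy: "eval_xy ([:0, 1:] * R * S) x y \<noteq> 0" using exists_nonroot by blast
    \<comment> \<open>Only the first three coordinates of this endpoint matter.\<close>
    define w where "w = point5 1 x y 0 0"
    define c where "c = (\<lambda>\<tau>. u + \<tau> *s (w - u))"
    have hol: "(\<lambda>\<tau>. homogenize F (c \<tau>)) holomorphic_on UNIV" for F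
      unfolding homogenize_def c_def by (auto intro!: holomorphic_intros)
    have cont: "((\<lambda>\<tau>. homogenize F (c \<tau>)) \<longlongrightarrow> homogenize F u) (at 0)" for F
    proof -
      have "isCont (\<lambda>\<tau>. homogenize F (c \<tau>)) 0"
        using holomorphic_on_imp_continuous_on[OF hol[of F]] continuous_on_eq_continuous_at by blast
      then show ?thesis by (simp add: isCont_def c_def)
    qed
    define g where "g = (\<lambda>\<tau>. c \<tau> $ 0 * c \<tau> $ 2 * homogenize R (c \<tau>) * homogenize S (c \<tau>))"
    have "g holomorphic_on UNIV"
      unfolding g_def by (intro holomorphic_intros hol) (auto simp: c_def intro!: holomorphic_intros)
    moreover have "g 1 \<noteq> 0"
      using xy by (simp add: g_def c_def w_def homogenize_affine)
    ultimately have ev1: "\<forall>\<^sub>F \<tau> in at 0. g \<tau> \<noteq> 0 \<and> \<tau> \<in> UNIV"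
      by (intro non_zero_neighbour_alt[of g UNIV 0 1]) auto
    have ev2: "\<forall>\<^sub>F \<tau> in at 0. \<forall>k. norm (\<tau> * (w - u) $ k) \<le> r / 10"
    proof -
      have "\<forall>\<^sub>F \<tau> in at 0. norm (\<tau> * (w - u) $ k) < r / 10" for k
      proof -
        have "((\<lambda>\<tau>. norm (\<tau> * (w - u) $ k)) \<longlongrightarrow> norm (0 * (w - u) $ k)) (at 0)" by (intro tendsto_intros)
        then show ?thesis by (rule order_tendstoD(2)) (use r in auto)
      qed
      then have "\<forall>\<^sub>F \<tau> in at 0. \<forall>k\<in>UNIV. norm (\<tau> * (w - u) $ k) < r / 10"
        by (intro eventually_ball_finite) auto
      then show ?thesis by eventually_elim (auto intro: less_imp_le)
    qed
    obtain \<delta>1 where \<delta>1: "\<delta>1 > 0" "\<And>w. dist w (u $ 3 ^ total_degree R) < \<delta>1 \<Longrightarrow> \<exists>z. dist z (u $ 3) < r / 10 \<and> z ^ total_degree R = w"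
      using nearby_root[OF R, of "r / 10" "u $ 3"] r by auto
    obtain \<delta>2 where \<delta>2: "\<delta>2 > 0" "\<And>w. dist w (u $ 4 ^ total_degree S) < \<delta>2 \<Longrightarrow> \<exists>z. dist z (u $ 4) < r / 10 \<and> z ^ total_degree S = w"
      using nearby_root[OF S, of "r / 10" "u $ 4"] r by auto
    have ev3: "\<forall>\<^sub>F \<tau> in at 0. dist (homogenize R (c \<tau>)) (homogenize R u) < \<delta>1"
      "\<forall>\<^sub>F \<tau> in at 0. dist (homogenize S (c \<tau>)) (homogenize S u) < \<delta>2"
      using tendstoD[OF cont] \<delta>1(1) \<delta>2(1) by blast+
    have "\<forall>\<^sub>F \<tau> in at (0::complex). g \<tau> \<noteq> 0 \<and> (\<forall>k. norm (\<tau> * (w - u) $ k) \<le> r / 10) \<and>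
       dist (homogenize R (c \<tau>)) (homogenize R u) < \<delta>1 \<and> dist (homogenize S (c \<tau>)) (homogenize S u) < \<delta>2"
      using ev1 ev2 ev3 by eventually_elim auto
    from eventually_happens'[OF at_neq_bot this] obtain \<tau> where \<tau>: "g \<tau> \<noteq> 0" "\<And>k. norm (\<tau> * (w - u) $ k) \<le> r / 10"
       "dist (homogenize R (c \<tau>)) (homogenize R u) < \<delta>1" "dist (homogenize S (c \<tau>)) (homogenize S u) < \<delta>2"
      by blast
    obtain z where z: "dist z (u $ 3) < r / 10" "z ^ total_degree R = homogenize R (c \<tau>)"
      using \<delta>1(2)[of "homogenize R (c \<tau>)"] \<tau>(3) unfolding eqs by blast
    obtain t where t: "dist t (u $ 4) < r / 10" "t ^ total_degree S = homogenize S (c \<tau>)"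
      using \<delta>2(2)[of "homogenize S (c \<tau>)"] \<tau>(4) unfolding eqs by blast
    define v where "v = point5 (c \<tau> $ 0) (c \<tau> $ 1) (c \<tau> $ 2) z t"
    have hv: "homogenize F v = homogenize F (c \<tau>)" for F by (rule homogenize_cong) (simp_all add: v_def)
    have "norm (v - u) < r"
    proof (rule norm_vec5_le)
      have "\<forall>k. norm ((v - u) $ k) \<le> r / 10"
        unfolding forall_5 using \<tau>(2)[of 0] \<tau>(2)[of 1] \<tau>(2)[of 2] z(1) t(1)
        by (auto simp: v_def c_def dist_norm right_diff_distrib)
      then show "norm ((v - u) $ k) \<le> r / 10" for k by blast
    qed (rule r)
    then have vU: "v \<noteq> 0" "abs_proj v \<in> U" using r(2) by (auto simp: dist_norm norm_minus_commute subset_iff)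
    have "abs_proj v \<in> surface R S"
      unfolding abs_proj_in_surface_iff[OF vU(1)] eqn_z_def eqn_t_def hv
      using z(2) t(2) by (simp add: v_def)
    moreover have nz: "v $ 0 \<noteq> 0" "v $ 2 \<noteq> 0" "v $ 3 \<noteq> 0" "v $ 4 \<noteq> 0"
      using \<tau>(1) z(2) t(2) R S by (auto simp: g_def v_def power_0_left)
    moreover have "abs_proj v \<in> affine_part 0" using abs_proj_in_affine_part[OF vU(1)] nz(1) by blast
    ultimately have "abs_proj v \<in> ?Y" by (simp add: affine_coords_abs_proj[OF vU(1)])
    then show ?thesis using vU(2) by blast
  qed
  then show "p \<in> closure ?Y"
    unfolding closure_iff_nhds_not_empty by blast
qed

lemma jet_differential_extends:
  assumes G: "G1 R S" "G6 R S" and R: "total_degree R \<ge> 1" and S: "total_degree S \<ge> 1"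
    and a: "a \<le> int (total_degree R) - 4 * int m" and dvd: "var_y ^ total_degree R dvd jet_J R S m a A"
  shows "restriction_holomorphic (surface R S) m {q. q $ 2 \<noteq> 0 \<and> q $ 3 \<noteq> 0 \<and> q $ 4 \<noteq> 0} (jet_differential R S m a A)"
proof -
  obtain P where P: "jet_J R S m a A = var_y ^ total_degree R * P" using dvd by (elim dvdE)
  obtain \<omega> where \<omega>: "\<omega> \<in> holomorphic_sections (surface R S) m"
    "\<And>\<alpha> s v. \<alpha> \<in> charts (surface R S) \<Longrightarrow> s \<in> fst \<alpha> \<Longrightarrow> snd \<alpha> s \<notin> bad_points R S \<Longrightarrow>
       \<omega> (\<alpha>, s, v) = local_form (total_degree R) (total_degree S) m a A P \<alpha> s v"
    using section_extends[OF refl R refl S a P finite_bad_points[OF G R S]] by blast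
  have "\<omega> ((V, \<phi>), s, v) = jet_differential R S m a A (affine_coords 0 (\<phi> s)) (frechet_derivative (affine_coords 0 \<circ> \<phi>) (at s) v)"
    if \<alpha>: "(V, \<phi>) \<in> charts (surface R S)" and s: "s \<in> V"
      and reg: "\<phi> s \<in> affine_part 0" "affine_coords 0 (\<phi> s) $ 2 \<noteq> 0" "affine_coords 0 (\<phi> s) $ 3 \<noteq> 0" "affine_coords 0 (\<phi> s) $ 4 \<noteq> 0"
    for V \<phi> s v
  proof -
    have dom: "s \<in> chart_dom (V, \<phi>) 0" "s \<in> chart_dom (V, \<phi>) 2" "s \<in> chart_dom (V, \<phi>) 3" "s \<in> chart_dom (V, \<phi>) 4"
      using s reg in_affine_part_iff_coords[OF reg(1)] by (simp_all add: chart_dom_def)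
    then have "\<phi> s \<notin> bad_points R S" by (auto simp: bad_points_def chart_dom_def)
    then have "\<omega> ((V, \<phi>), s, v) = local_form (total_degree R) (total_degree S) m a A P (V, \<phi>) s v"
      using \<omega>(2)[OF \<alpha>, of s v] s by simp
    also have "\<dots> = jet_differential R S m a A (aff (V, \<phi>) 0 s) (daff (V, \<phi>) 0 s v)"
      by (rule local_form_regular[OF refl R refl S a P \<alpha> dom(2,1,3,4)])
    finally show ?thesis by (simp add: aff_def)
  qed
  then show ?thesis
    unfolding restriction_holomorphic_def Let_def
    using surface_subset_closure_regular[OF R S] \<omega>(1) by (intro conjI bexI[of _ \<omega>]) auto
qed

section \<open>Dimension of common kernels\<close>

definition cfun_functional :: "(('i \<Rightarrow> complex) \<Rightarrow> complex) \<Rightarrow> bool" where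
  "cfun_functional l \<longleftrightarrow> (\<forall>f g. l (f + g) = l f + l g) \<and> (\<forall>c f. l (\<lambda>x. c * f x) = c * l f)"

lemma cfun_functionalD:
  assumes "cfun_functional l"
  shows "l (f + g) = l f + l g" "l (\<lambda>x. c * f x) = c * l f" "l 0 = 0"
proof -
  show *: "l (f + g) = l f + l g" "l (\<lambda>x. c * f x) = c * l f" for f g c
    using assms by (auto simp: cfun_functional_def)
  show "l 0 = 0" using *(1)[of 0 0] by simp
qed

lemma sum_fun_apply: "(\<Sum>i\<in>I. f i) x = (\<Sum>i\<in>I. f i x)"
  by (induction I rule: infinite_finite_induct) auto

lemma independent_image:
  fixes h :: "'b \<Rightarrow> 'i \<Rightarrow> complex"
  assumes "finite B" and indep: "\<And>u b. (\<Sum>b\<in>B. (\<lambda>x. u b * h b x)) = 0 \<Longrightarrow> b \<in> B \<Longrightarrow> u b = 0"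
  shows "inj_on h B" "cfun.independent (h ` B)"
proof -
  show inj: "inj_on h B"
  proof (rule inj_onI, rule ccontr)
    fix b b' assume b: "b \<in> B" "b' \<in> B" "h b = h b'" "b \<noteq> b'"
    define u where "u = (\<lambda>x. if x = b then 1 else if x = b' then - 1 else (0 :: complex))"
    have "(\<Sum>x\<in>B. (\<lambda>y. u x * h x y)) = (\<Sum>x\<in>{b, b'}. (\<lambda>y. u x * h x y))"
      using b assms(1) by (intro sum.mono_neutral_right) (auto simp: u_def zero_fun_def)
    also have "\<dots> = 0" using b(3,4) by (auto simp: u_def fun_eq_iff)
    finally have "u b = 0" using indep b(1) by blast
    then show False by (simp add: u_def)
  qed
  show "cfun.independent (h ` B)"
  proof (subst cfun.dependent_finite)
    show "finite (h ` B)" using assms(1) by simp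
    show "\<not> (\<exists>u. (\<exists>v\<in>h ` B. u v \<noteq> 0) \<and> (\<Sum>v\<in>h ` B. (\<lambda>x. u v * v x)) = 0)"
    proof (intro notI, elim exE conjE bexE)
      fix u v assume u: "v \<in> h ` B" "u v \<noteq> 0" "(\<Sum>v\<in>h ` B. (\<lambda>x. u v * v x)) = 0"
      then have "(\<Sum>b\<in>B. (\<lambda>x. u (h b) * h b x)) = 0"
        using u(3) unfolding sum.reindex[OF inj] by (simp only: o_def)
      then show False using indep[of "u \<circ> h"] u(1,2) by auto
    qed
  qed
qed

text \<open>
  One functional costs at most one dimension: if \<open>l b0 \<noteq> 0\<close>, multiples of \<open>b0\<close> are subtracted from
  the other elements of \<open>B\<close>.
\<close>

lemma independent_kernel:
  assumes "finite B" "cfun.independent B" "cfun_functional (l :: ('i \<Rightarrow> complex) \<Rightarrow> complex)"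
  shows "\<exists>B'. finite B' \<and> cfun.independent B' \<and> B' \<subseteq> cfun.span B \<and> (\<forall>f\<in>B'. l f = 0) \<and> card B \<le> Suc (card B')"
proof (cases "\<forall>f\<in>B. l f = 0")
  case True
  then show ?thesis using assms cfun.span_superset[of B] by (intro exI[of _ B]) auto
next
  case False
  then obtain b0 where b0: "b0 \<in> B" "l b0 \<noteq> 0" by blast
  define c where "c = (\<lambda>b. l b / l b0)"
  define h where "h = (\<lambda>b. b - (\<lambda>x. c b * b0 x))"
  let ?B = "B - {b0}"
  have indep: "u b = 0" if "(\<Sum>b\<in>?B. (\<lambda>x. u b * h b x)) = 0" "b \<in> ?B" for u b
  proof -
    define v where "v = (\<lambda>b. if b = b0 then - (\<Sum>b\<in>?B. u b * c b) else u b)"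
    have "(\<Sum>b\<in>B. (\<lambda>x. v b * b x)) = (\<lambda>x. v b0 * b0 x) + (\<Sum>b\<in>?B. (\<lambda>x. v b * b x))"
      using assms(1) b0(1) by (simp add: sum.remove)
    also have "(\<Sum>b\<in>?B. (\<lambda>x. v b * b x)) = (\<Sum>b\<in>?B. (\<lambda>x. u b * b x))"
      by (intro sum.cong) (auto simp: v_def)
    also have "(\<lambda>x. v b0 * b0 x) + (\<Sum>b\<in>?B. (\<lambda>x. u b * b x)) = (\<Sum>b\<in>?B. (\<lambda>x. u b * h b x))"
      by (rule ext) (simp add: v_def h_def sum_fun_apply algebra_simps sum.distrib sum_subtractf sum_distrib_left sum_distrib_right)
    finally have "(\<Sum>b\<in>B. (\<lambda>x. v b * b x)) = 0" using that(1) by simp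
    then have "v b = 0" if "b \<in> B" for b
      using assms(1,2) that cfun.dependent_finite[OF assms(1)] by blast
    from this[of b] that(2) show ?thesis by (simp add: v_def)
  qed
  have inj: "inj_on h ?B"
    by (rule independent_image) (use assms(1) indep in auto)
  have "cfun.independent (h ` ?B)"
    by (rule independent_image) (use assms(1) indep in auto)
  moreover have "h ` ?B \<subseteq> cfun.span B"
  proof (rule image_subsetI)
    fix b assume "b \<in> ?B"
    then have "b \<in> B" by simp
    then show "h b \<in> cfun.span B"
      unfolding h_def
      by (intro cfun.span_diff cfun.span_scale[OF cfun.span_base[OF b0(1)]] cfun.span_base)
  qed
  moreover have "l (h b) = 0" for b
  proof -
    have "l b = l (h b + (\<lambda>x. c b * b0 x))" by (simp add: h_def)
    also have "\<dots> = l (h b) + c b * l b0" by (simp add: cfun_functionalD(1,2)[OF assms(3)])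
    finally show ?thesis using b0(2) by (simp add: c_def)
  qed
  moreover have "card (h ` ?B) = card B - 1" using card_image[OF inj] b0(1) assms(1) by simp
  ultimately show ?thesis using assms(1) by (intro exI[of _ "h ` ?B"]) auto
qed

lemma cfun_functional_zero_on_span:
  assumes "cfun_functional l" "\<And>f. f \<in> B \<Longrightarrow> l f = 0" "f \<in> cfun.span B"
  shows "l f = 0"
  using assms(3)
proof (induction rule: cfun.span_induct_alt)
  case base
  show ?case by (rule cfun_functionalD[OF assms(1)])
next
  case (step c x y)
  have "l ((\<lambda>a. c * x a) + y) = c * l x + l y" by (simp only: cfun_functionalD(1,2)[OF assms(1)])
  then show ?case using step assms(2) by (simp only: mult_zero_right add_0_right)
qed

lemma independent_common_kernel:
  assumes "finite E" "\<And>l. l \<in> E \<Longrightarrow> cfun_functional l" "finite B0" "cfun.independent B0"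
  shows "\<exists>B. finite B \<and> cfun.independent B \<and> B \<subseteq> cfun.span B0 \<and> (\<forall>f\<in>B. \<forall>l\<in>E. l f = 0) \<and> card B0 \<le> card B + card E"
  using assms(1,2)
proof (induction E rule: finite_induct)
  case empty
  then show ?case using assms(3,4) cfun.span_superset by (intro exI[of _ B0]) auto
next
  case (insert l E)
  then obtain B where B: "finite B" "cfun.independent B" "B \<subseteq> cfun.span B0"
    "\<forall>f\<in>B. \<forall>l\<in>E. l f = 0" "card B0 \<le> card B + card E" by (metis insertCI)
  obtain B' where B': "finite B'" "cfun.independent B'" "B' \<subseteq> cfun.span B" "\<forall>f\<in>B'. l f = 0" "card B \<le> Suc (card B')"
    using independent_kernel[OF B(1,2)] insert.prems by blast
  have "B' \<subseteq> cfun.span B0"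
    using B'(3) cfun.span_mono[OF B(3)] cfun.span_span by blast
  moreover have "l' f = 0" if "f \<in> B'" "l' \<in> insert l E" for f l'
    using that B'(3,4) B(4) cfun_functional_zero_on_span[of l' B f] insert.prems by blast
  ultimately show ?case
    using B' B(5) insert.hyps by (intro exI[of _ B']) auto
qed

lemma delta_independent:
  fixes I :: "'i set"
  assumes "finite I"
  defines "\<delta> \<equiv> (\<lambda>i j. if j = i then 1 else (0 :: complex))"
  shows "finite (\<delta> ` I)" "cfun.independent (\<delta> ` I)" "card (\<delta> ` I) = card I"
    "cfun.span (\<delta> ` I) = {f. \<forall>j. j \<notin> I \<longrightarrow> f j = 0}"
proof -
  show fin: "finite (\<delta> ` I)" using assms(1) by simp
  have ev: "(\<Sum>i\<in>I. (\<lambda>x. u i * \<delta> i x)) j = (if j \<in> I then u j else 0)" for u :: "'i \<Rightarrow> complex" and j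
  proof -
    have "(\<Sum>i\<in>I. (\<lambda>x. u i * \<delta> i x)) j = (\<Sum>i\<in>I. if i = j then u j else 0)"
      unfolding sum_fun_apply by (intro sum.cong) (auto simp: \<delta>_def)
    then show ?thesis using assms(1) by simp
  qed
  have indep: "u i = 0" if "(\<Sum>i\<in>I. (\<lambda>x. u i * \<delta> i x)) = 0" "i \<in> I" for u i
    using fun_cong[OF that(1), of i] that(2) by (simp add: ev)
  show "cfun.independent (\<delta> ` I)"
    by (rule independent_image[OF assms(1)]) (use indep in blast)
  have "inj_on \<delta> I"
    by (rule independent_image[OF assms(1)]) (use indep in blast)
  then show "card (\<delta> ` I) = card I" by (rule card_image)
  show "cfun.span (\<delta> ` I) = {f. \<forall>j. j \<notin> I \<longrightarrow> f j = 0}"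
  proof (intro equalityI subsetI)
    fix f assume "f \<in> cfun.span (\<delta> ` I)"
    then show "f \<in> {f. \<forall>j. j \<notin> I \<longrightarrow> f j = 0}"
      by (induction rule: cfun.span_induct_alt) (auto simp: \<delta>_def split: if_splits)
  next
    fix f :: "'i \<Rightarrow> complex" assume f: "f \<in> {f. \<forall>j. j \<notin> I \<longrightarrow> f j = 0}"
    have "f = (\<Sum>i\<in>I. (\<lambda>x. f i * \<delta> i x))"
      by (rule ext) (use f in \<open>simp add: ev\<close>)
    moreover have "(\<Sum>i\<in>I. (\<lambda>x. f i * \<delta> i x)) \<in> cfun.span (\<delta> ` I)"
      by (intro cfun.span_sum cfun.span_scale cfun.span_base) auto
    ultimately show "f \<in> cfun.span (\<delta> ` I)" by simp
  qed
qed

text \<open>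
  The finite spanning set \<open>B0\<close> excludes the convention that \<open>cfun.dim\<close> is zero on spaces without a finite basis.
\<close>

lemma cfun_dim_ge:
  assumes "W \<subseteq> cfun.span B0" "finite B0" "B \<subseteq> W" "cfun.independent B"
  shows "card B \<le> cfun.dim W" "finite B"
proof -
  obtain C where C: "C \<subseteq> W" "cfun.independent C" "W \<subseteq> cfun.span C" "card C = cfun.dim W"
    using cfun.basis_exists by blast
  have "finite C" using cfun.independent_span_bound[OF assms(2) C(2)] C(1) assms(1) by blast
  then have "finite B \<and> card B \<le> card C"
    using cfun.independent_span_bound[OF _ assms(4)] assms(3) C(3) by blast
  then show "card B \<le> cfun.dim W" "finite B" using C(4) by auto
qed

section \<open>Divisibility as a linear system\<close>

text \<open>
  The contribution of a single coefficient of the family \<open>A\<close> to \<open>J\<close>.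
\<close>

definition jet_term :: "poly_xy \<Rightarrow> poly_xy \<Rightarrow> nat \<Rightarrow> (nat \<times> nat \<times> nat \<times> nat) \<times> (nat \<times> nat) \<Rightarrow> jet_poly" where
  "jet_term R S m = (\<lambda>((j, k, p, q), (h, i)). const_jet (monom (monom 1 h) i) * var_x' ^ j * var_y' ^ k *
        total_diff R ^ p * total_diff S ^ q * const_jet R ^ (m - p) * const_jet S ^ (m - q))"

definition jet_coeff :: "jet_poly \<Rightarrow> nat \<times> nat \<times> nat \<times> nat \<Rightarrow> complex" where
  "jet_coeff P = (\<lambda>(j, k, h, i). coeff_xy (coeff_jet P j k) h i)"

lemma const_jet_add: "const_jet (F + G) = const_jet F + const_jet G"
  and const_jet_mult: "const_jet (F * G) = const_jet F * const_jet G"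
  and const_jet_0: "const_jet 0 = 0"
  by (simp_all add: const_jet_def)

lemma const_jet_sum: "const_jet (\<Sum>i\<in>I. F i) = (\<Sum>i\<in>I. const_jet (F i))"
  by (induction I rule: infinite_finite_induct) (auto simp: const_jet_add const_jet_0)

lemma jet_J_eq_sum: "jet_J R S m a A = (\<Sum>\<iota>\<in>coeff_indices m a. const_jet [:[:A \<iota>:]:] * jet_term R S m \<iota>)"
proof -
  have mon: "const_jet (monom (monom c h) i) = const_jet [:[:c:]:] * const_jet (monom (monom 1 h) i)" for c h i
    by (simp add: smult_monom flip: const_jet_mult)
  have "const_jet (A_poly a A (j, k, p, q)) * var_x' ^ j * var_y' ^ k *
        total_diff R ^ p * total_diff S ^ q * const_jet R ^ (m - p) * const_jet S ^ (m - q) =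
     (\<Sum>y\<in>monomials a. const_jet [:[:A ((j, k, p, q), y):]:] * jet_term R S m ((j, k, p, q), y))" for j k p q
    unfolding A_poly_def const_jet_sum sum_distrib_right
    by (intro sum.cong refl, clarify, subst mon, simp only: jet_term_def prod.case mult.assoc)
  then show ?thesis
    unfolding jet_J_def coeff_indices_def sum.cartesian_product' by (auto intro!: sum.cong)
qed

lemma jet_coeff_sum: "jet_coeff (\<Sum>i\<in>I. P i) \<kappa> = (\<Sum>i\<in>I. jet_coeff (P i) \<kappa>)"
  by (simp add: jet_coeff_def case_prod_unfold coeff_xy_def coeff_jet_def coeff_sum)

lemma jet_coeff_scale: "jet_coeff (const_jet [:[:c:]:] * P) \<kappa> = c * jet_coeff P \<kappa>"
  by (simp add: jet_coeff_def case_prod_unfold coeff_xy_def coeff_jet_def const_jet_def)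

lemma jet_coeff_J: "jet_coeff (jet_J R S m a A) \<kappa> = (\<Sum>\<iota>\<in>coeff_indices m a. jet_coeff (jet_term R S m \<iota>) \<kappa> * A \<iota>)"
  unfolding jet_J_eq_sum jet_coeff_sum jet_coeff_scale by (simp add: mult.commute)

text \<open>
  A set containing the exponents \<open>(j, k, h, i)\<close> of all monomials \<open>x\<^sup>h y\<^sup>i (x')\<^sup>j (y')\<^sup>k\<close> with \<open>i < d\<close> that can
  occur in a form of degree \<open>m\<close> with coefficients of degree at most \<open>D\<close>. For \<open>i > D\<close> the
  truncated difference \<open>D - i\<close> adds indices with \<open>h = 0\<close>, whose coefficients vanish anyway.
\<close>

definition system_indices :: "nat \<Rightarrow> nat \<Rightarrow> nat \<Rightarrow> (nat \<times> nat \<times> nat \<times> nat) set" where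
  "system_indices m d D = (\<lambda>(j, i, h). (j, m - j, h, i)) ` ({..m} \<times> (SIGMA i:{..<d}. {..D - i}))"

lemma card_system_indices: "card (system_indices m d D) \<le> (m + 1) * (\<Sum>i<d. D - i + 1)" "finite (system_indices m d D)"
proof -
  have "card (system_indices m d D) \<le> card ({..m} \<times> (SIGMA i:{..<d}. {..D - i}))"
    unfolding system_indices_def by (rule card_image_le) auto
  also have "\<dots> = (m + 1) * (\<Sum>i<d. D - i + 1)" by (simp add: card_cartesian_product)
  finally show "card (system_indices m d D) \<le> (m + 1) * (\<Sum>i<d. D - i + 1)" .
qed (auto simp: system_indices_def)

lemma dvd_iff_system:
  assumes "jet_form m D P"
  shows "var_y ^ d dvd P \<longleftrightarrow> (\<forall>\<kappa>\<in>system_indices m d D. jet_coeff P \<kappa> = 0)"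
proof
  assume "var_y ^ d dvd P"
  then show "\<forall>\<kappa>\<in>system_indices m d D. jet_coeff P \<kappa> = 0"
    unfolding var_y_power_dvd_iff by (auto simp: system_indices_def jet_coeff_def)
next
  assume *: "\<forall>\<kappa>\<in>system_indices m d D. jet_coeff P \<kappa> = 0"
  show "var_y ^ d dvd P"
    unfolding var_y_power_dvd_iff
  proof (intro allI impI, rule ccontr)
    fix j k i h assume i: "i < d" and nz: "coeff_xy (coeff_jet P j k) h i \<noteq> 0"
    then have "coeff_jet P j k \<noteq> 0" by (auto simp: coeff_xy_def)
    then have "j + k = m" "h + i \<le> D"
      using assms nz unfolding jet_form_def tdeg_le_def by (auto simp: coeff_xy_def)
    then have "(j, k, h, i) \<in> system_indices m d D"
      using i unfolding system_indices_def by (intro image_eqI[of _ _ "(j, i, h)"]) auto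
    then show False using * nz by (auto simp: jet_coeff_def)
  qed
qed

lemma finite_coeff_indices [simp]: "finite (coeff_indices m a)"
  by (simp add: coeff_indices_def)

lemma divisibility_linear_system:
  fixes R S :: poly_xy and m :: nat and a :: int
  defines "D \<equiv> nat a + m * (total_degree R + total_degree S)"
  shows "\<exists>E :: coeff_family set. finite E \<and> card E \<le> (m + 1) * (\<Sum>i<d. D - i + 1) \<and>
    (\<forall>A. var_y ^ d dvd jet_J R S m a A \<longleftrightarrow> (\<forall>l\<in>E. (\<Sum>\<iota>\<in>coeff_indices m a. l \<iota> * A \<iota>) = 0))"
proof (intro exI conjI allI)
  let ?E = "(\<lambda>\<kappa> \<iota>. jet_coeff (jet_term R S m \<iota>) \<kappa>) ` system_indices m d D"
  show "finite ?E" by (simp add: card_system_indices(2))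
  show "card ?E \<le> (m + 1) * (\<Sum>i<d. D - i + 1)"
    by (rule order.trans[OF card_image_le card_system_indices(1)]) (rule card_system_indices(2))
  show "var_y ^ d dvd jet_J R S m a A \<longleftrightarrow> (\<forall>l\<in>?E. (\<Sum>\<iota>\<in>coeff_indices m a. l \<iota> * A \<iota>) = 0)" for A
    using dvd_iff_system[OF jet_form_J[OF tdeg_le_total_degree tdeg_le_total_degree], of d R S m a A]
    by (simp add: D_def jet_coeff_J)
qed

text \<open>
  Unknowns minus equations. The independent set itself is recorded, because the sections it induces
  are shown to be independent later.
\<close>

lemma dim_solutions_ge:
  fixes R S :: poly_xy and m :: nat and a :: int
  defines "D \<equiv> nat a + m * (total_degree R + total_degree S)"
  shows "\<exists>B. finite B \<and> B \<subseteq> solutions R S m a \<and> cfun.independent B \<and> card B \<le> cfun.dim (solutions R S m a) \<and>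
    card (coeff_indices m a) \<le> card B + (m + 1) * (\<Sum>i<total_degree R. D - i + 1)"
proof -
  from divisibility_linear_system[where m = m and d = "total_degree R" and a = a and R = R and S = S, folded D_def]
  obtain E where E0: "finite E \<and> card E \<le> (m + 1) * (\<Sum>i<total_degree R. D - i + 1) \<and>
    (\<forall>A. var_y ^ total_degree R dvd jet_J R S m a A \<longleftrightarrow> (\<forall>l\<in>E. (\<Sum>\<iota>\<in>coeff_indices m a. l \<iota> * A \<iota>) = 0))" ..
  then have E: "finite E" "card E \<le> (m + 1) * (\<Sum>i<total_degree R. D - i + 1)"
    "\<And>A. var_y ^ total_degree R dvd jet_J R S m a A \<longleftrightarrow> (\<forall>l\<in>E. (\<Sum>\<iota>\<in>coeff_indices m a. l \<iota> * A \<iota>) = 0)"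
    by simp_all
  define E' where "E' = (\<lambda>l A. \<Sum>\<iota>\<in>coeff_indices m a. l \<iota> * A \<iota>) ` E"
  have E'f: "cfun_functional l" if "l \<in> E'" for l
    using that by (auto simp: E'_def cfun_functional_def algebra_simps sum.distrib sum_distrib_left)
  note \<delta> = delta_independent[OF finite_coeff_indices, of m a]
  have fam: "coeff_families m a = cfun.span ((\<lambda>i j. if j = i then 1 else 0) ` coeff_indices m a)"
    unfolding \<delta>(4) by (simp add: coeff_families_def)
  have "finite E'" unfolding E'_def using E(1) by simp
  from independent_common_kernel[OF this E'f \<delta>(1,2), unfolded \<delta>(3) fam[symmetric]]
  obtain B where B': "finite B \<and> cfun.independent B \<and> B \<subseteq> coeff_families m a \<and>
    (\<forall>f\<in>B. \<forall>l\<in>E'. l f = 0) \<and> card (coeff_indices m a) \<le> card B + card E'" ..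
  then have B: "finite B" "cfun.independent B" "B \<subseteq> coeff_families m a"
    "\<forall>f\<in>B. \<forall>l\<in>E'. l f = 0" "card (coeff_indices m a) \<le> card B + card E'" by simp_all
  have "B \<subseteq> solutions R S m a"
    using B(3,4) E(3) by (auto simp: solutions_def E'_def)
  moreover have "card B \<le> cfun.dim (solutions R S m a)"
    by (rule cfun_dim_ge[OF _ \<delta>(1)]) (use \<open>B \<subseteq> solutions R S m a\<close> B(2) fam in \<open>auto simp: solutions_def\<close>)
  moreover have "card E' \<le> card E" unfolding E'_def by (rule card_image_le[OF E(1)])
  ultimately show ?thesis using B E(2) by (intro exI[of _ B]) auto
qed

section \<open>Counting unknowns and equations\<close>

lemma card_monomials:
  "real (card {(h :: nat, i). h + i \<le> n}) = (real n + 1) * (real n + 2) / 2"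
proof -
  have "{(h, i). h + i \<le> n} = (SIGMA h:{..n}. {..n - h})" by auto
  then have "card {(h, i). h + i \<le> n} = (\<Sum>h\<le>n. Suc (n - h))" by (simp add: card_SigmaI)
  also have "\<dots> = (\<Sum>h\<le>n. Suc h)" using sum.nat_diff_reindex[of Suc "Suc n"] by (simp add: lessThan_Suc_atMost)
  also have "real \<dots> = (real n + 1) * (real n + 2) / 2"
    by (induction n) (auto simp: field_simps)
  finally show ?thesis .
qed

lemma card_jet_exponents: "real (card (jet_exponents m)) = (real m + 1) * (real m + 2) * (real m + 3) / 6"
proof -
  have "bij_betw (\<lambda>(j, k, p). (j, k, p, m - j - k - p)) (SIGMA j:{..m}. {(k, p). k + p \<le> m - j}) (jet_exponents m)"
    by (rule bij_betw_byWitness[of _ "\<lambda>(j, k, p, q). (j, k, p)"]) (auto simp: jet_exponents_def)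
  then have "card (jet_exponents m) = card (SIGMA j:{..m}. {(k, p). k + p \<le> m - j})"
    by (simp add: bij_betw_same_card)
  also have "\<dots> = (\<Sum>j\<le>m. card {(k, p). k + p \<le> m - j})"
  proof (rule card_SigmaI)
    have "finite {(k, p). k + p \<le> m - j}" for j
      by (rule finite_subset[of _ "{..m} \<times> {..m}"]) auto
    then show "\<forall>j\<in>{..m}. finite {(k, p). k + p \<le> m - j}" by blast
  qed simp
  also have "\<dots> = (\<Sum>j\<le>m. card {(k :: nat, p). k + p \<le> j})"
    using sum.nat_diff_reindex[of "\<lambda>j. card {(k :: nat, p). k + p \<le> j}" "Suc m"] by (simp add: lessThan_Suc_atMost)
  also have "real \<dots> = (\<Sum>j\<le>m. (real j + 1) * (real j + 2) / 2)" by (simp add: card_monomials)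
  also have "\<dots> = (real m + 1) * (real m + 2) * (real m + 3) / 6"
    by (induction m) (auto simp: field_simps)
  finally show ?thesis .
qed

lemma card_coeff_indices:
  assumes "0 \<le> a"
  shows "real (card (coeff_indices m a)) = (real_of_int a + 1) * (real_of_int a + 2) / 2 *
           ((real m + 1) * (real m + 2) * (real m + 3) / (1 * 2 * 3))"
proof -
  have "monomials a = {(h, i). h + i \<le> nat a}" using assms by (auto simp: monomials_def)
  then have "real (card (monomials a)) = (real_of_int a + 1) * (real_of_int a + 2) / 2"
    using card_monomials[of "nat a"] assms by simp
  then show ?thesis using card_jet_exponents[of m]
    by (simp only: coeff_indices_def card_cartesian_product of_nat_mult) simp
qed

lemma sum_equations:
  assumes "d \<le> D + 1"
  shows "real (\<Sum>i<d. D - i + 1) = real d * (real D + 1) - real d * (real d - 1) / 2"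
  using assms by (induction d) (auto simp: field_simps of_nat_diff)

text \<open>
  Here \<open>d = 12 m + r\<close>, and \<open>752 \<le> d\<close> forces \<open>m \<ge> 62\<close>. Expanded in \<open>k = m - 62\<close>, the difference of both sides
  has only nonnegative coefficients apart from those of \<open>r\<^sup>3\<close>, which are outweighed by those of \<open>r\<^sup>2\<close>
  since \<open>r \<le> 11\<close>.
\<close>

lemma counting_inequality_poly:
  fixes k r :: real
  assumes k: "k \<ge> 0" and r: "0 \<le> r" "r \<le> 11"
  defines "m \<equiv> k + 62"
  defines "d \<equiv> 12 * m + r" and "a \<equiv> 8 * m + r"
  shows "1 / 93312 * d ^ 3 - 61 / 7776 * d ^ 2 - 17 / 108 * d - 28 / 27 \<le>
    (a + 1) * (a + 2) / 2 * ((m + 1) * (m + 2) * (m + 3) / 6) -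
    (m + 1) * (d * (a + m * (d + d ^ 2 / 648) + 1) - d * (d - 1) / 2)"
proof -
  have "(a + 1) * (a + 2) / 2 * ((m + 1) * (m + 2) * (m + 3) / 6) -
    (m + 1) * (d * (a + m * (d + d ^ 2 / 648) + 1) - d * (d - 1) / 2) -
    (1 / 93312 * d ^ 3 - 61 / 7776 * d ^ 2 - 17 / 108 * d - 28 / 27) =
    (20388039848 / 27 + 1904325401 / 324 * r + (34591411 / 7776 - 562465 / 93312 * r) * r\<^sup>2) +
     k ^ 1 * (4778586265 / 54 + 35985211 / 81 * r + (650231 / 2592 - 125 / 648 * r) * r\<^sup>2) +
     k ^ 2 * (201895579 / 54 + 2658239 / 216 * r + (83 / 18 - 1 / 648 * r) * r\<^sup>2) +
     k ^ 3 * (2010640 / 27 + 1787 / 12 * r + 1 / 36 * r\<^sup>2) +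
     k ^ 4 * (714 + 2 / 3 * r) +
     k ^ 5 * (8 / 3)"
    unfolding d_def a_def m_def by (simp add: field_simps power_numeral_reduce)
  also have "\<dots> \<ge> 0"
    using k r by (intro add_nonneg_nonneg mult_nonneg_nonneg zero_le_power) auto
  finally show ?thesis by simp
qed

text \<open>
  The number of equations is increasing in \<open>e\<close>, which may therefore be replaced by its upper bound \<open>d\<^sup>2/648\<close>.
\<close>

lemma counting_inequality:
  fixes d e :: nat
  assumes d: "752 \<le> d" and e: "real e \<le> 1 / 648 * real d ^ 2"
  defines "m \<equiv> d div 12"
  defines "a \<equiv> d - 4 * m"
  shows "1 / 93312 * real d ^ 3 - 61 / 7776 * real d ^ 2 - 17 / 108 * real d - 28 / 27 \<le>
    (real a + 1) * (real a + 2) / 2 * ((real m + 1) * (real m + 2) * (real m + 3) / 6) -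
    (real m + 1) * real (\<Sum>i<d. (a + m * (d + e)) - i + 1)"
proof -
  define r where "r = d mod 12"
  have dm: "d = 12 * m + r" by (simp add: m_def r_def)
  have r: "r \<le> 11" by (simp add: r_def)
  have m: "m \<ge> 62" using d dm r by linarith
  have am: "a = 8 * m + r" using dm by (simp add: a_def)
  have "d \<le> 1 * (d + e)" by simp
  also have "\<dots> \<le> m * (d + e)" using m by (intro mult_right_mono) auto
  finally have "d \<le> m * (d + e)" .
  then have "real (\<Sum>i<d. (a + m * (d + e)) - i + 1) = real d * (real (a + m * (d + e)) + 1) - real d * (real d - 1) / 2"
    by (intro sum_equations) simp
  also have "\<dots> \<le> real d * (real a + real m * (real d + real d ^ 2 / 648) + 1) - real d * (real d - 1) / 2"
    using e by (intro diff_right_mono mult_left_mono add_right_mono) (auto intro!: mult_left_mono)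
  finally have "(real m + 1) * real (\<Sum>i<d. (a + m * (d + e)) - i + 1) \<le>
      (real m + 1) * (real d * (real a + real m * (real d + real d ^ 2 / 648) + 1) - real d * (real d - 1) / 2)"
    by (rule mult_left_mono) simp
  moreover have "1 / 93312 * real d ^ 3 - 61 / 7776 * real d ^ 2 - 17 / 108 * real d - 28 / 27 \<le>
    (real a + 1) * (real a + 2) / 2 * ((real m + 1) * (real m + 2) * (real m + 3) / 6) -
    (real m + 1) * (real d * (real a + real m * (real d + real d ^ 2 / 648) + 1) - real d * (real d - 1) / 2)"
    using counting_inequality_poly[of "real m - 62" "real r"] m r dm am by simp
  ultimately show ?thesis by linarith
qed

section \<open>Polynomials vanishing on a complete intersection\<close>

lemma nontrivial_solution:
  fixes I :: "'i set" and l :: "'e \<Rightarrow> 'i \<Rightarrow> complex"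
  assumes "finite I" "finite E" "card E < card I"
  shows "\<exists>f. f \<noteq> (\<lambda>_. 0) \<and> (\<forall>i. i \<notin> I \<longrightarrow> f i = 0) \<and> (\<forall>\<kappa>\<in>E. (\<Sum>i\<in>I. l \<kappa> i * f i) = 0)"
proof -
  define E' where "E' = (\<lambda>\<kappa> f. \<Sum>i\<in>I. l \<kappa> i * f i) ` E"
  have E'f: "cfun_functional l'" if "l' \<in> E'" for l'
    using that by (auto simp: E'_def cfun_functional_def algebra_simps sum.distrib sum_distrib_left)
  have finE': "finite E'" "card E' \<le> card E" using assms(2) card_image_le by (auto simp: E'_def)
  note \<delta> = delta_independent[OF assms(1)]
  from independent_common_kernel[OF finE'(1) E'f \<delta>(1,2), unfolded \<delta>(3,4)] obtain B where
    B: "finite B" "cfun.independent B" "B \<subseteq> {f. \<forall>j. j \<notin> I \<longrightarrow> f j = 0}" "\<forall>f\<in>B. \<forall>l\<in>E'. l f = 0" "card I \<le> card B + card E'"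
    by auto
  then have "B \<noteq> {}" using finE'(2) assms(3) by auto
  then obtain f where f: "f \<in> B" by blast
  have "f \<noteq> 0" using B(2) f cfun.dependent_zero by blast
  then show ?thesis
    using B(3,4) f by (intro exI[of _ f]) (auto simp: E'_def zero_fun_def)
qed

text \<open>
  A product of linear forms, one through each point of \<open>Z\<close> other than \<open>z\<close> and not through \<open>z\<close>.
\<close>

lemma interpolation_poly:
  fixes Z :: "(complex \<times> complex) set"
  assumes "finite Z"
  shows "\<exists>P. tdeg_le P (card Z) \<and> (\<forall>w\<in>Z. eval_xy P (fst w) (snd w) = (if w = z then 1 else 0))"
proof -
  define q :: "complex \<times> complex \<Rightarrow> poly_xy" where
    "q = (\<lambda>w. if fst z \<noteq> fst w then [:[:- fst w, 1:]:] else [:[:- snd w:], 1:])"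
  have q: "eval_xy (q w) (fst z) (snd z) \<noteq> 0" "eval_xy (q w) (fst w) (snd w) = 0" "tdeg_le (q w) 1" if "w \<noteq> z" for w
    using that by (auto simp: q_def prod_eq_iff tdeg_le_def coeff_xy_def coeff_pCons one_pCons split: nat.splits)
  define Q where "Q = (\<Prod>w\<in>Z - {z}. q w)"
  have ev: "eval_xy Q x y = (\<Prod>w\<in>Z - {z}. eval_xy (q w) x y)" for x y
    unfolding Q_def by (induction "Z - {z}" rule: infinite_finite_induct) (simp_all add: eval_xy_def poly_prod)
  have td: "tdeg_le (\<Prod>w\<in>W. q w) (card W)" if "finite W" "z \<notin> W" for W
    using that
  proof (induction W rule: finite_induct)
    case (insert w W)
    have "tdeg_le (q w) 1" by (rule q(3)) (use insert in auto)
    moreover have "tdeg_le (prod q W) (card W)" using insert by simp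
    ultimately show ?case using insert tdeg_le_mult[of "q w" 1 "prod q W" "card W"] by simp
  qed simp
  define c where "c = eval_xy Q (fst z) (snd z)"
  have c: "c \<noteq> 0" using assms q(1) by (auto simp: c_def ev)
  define P where "P = [:[:1 / c:]:] * Q"
  have "tdeg_le Q (card Z)"
    unfolding Q_def using td[of "Z - {z}"] assms by (auto intro: tdeg_le_mono card_mono)
  then have "tdeg_le P (card Z)"
    by (auto simp: P_def tdeg_le_def coeff_xy_def)
  moreover have evP: "eval_xy P x y = 1 / c * eval_xy Q x y" for x y
    unfolding P_def eval_xy_simps(4) by simp
  have "eval_xy P (fst w) (snd w) = (if w = z then 1 else 0)" if "w \<in> Z" for w
  proof (cases "w = z")
    case True
    then show ?thesis using c by (simp add: evP flip: c_def)
  next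
    case False
    then have "eval_xy Q (fst w) (snd w) = 0"
      unfolding ev using assms that q(2)[OF False] False by (intro prod_zero bexI[of _ w]) auto
    then show ?thesis using False by (simp add: evP)
  qed
  ultimately show ?thesis by blast
qed

text \<open>
  The module structure over \<open>\<complex>\<close>; the scalar multiplication \<open>smult\<close> of this ring has scalars in \<open>\<complex>[x]\<close>.
\<close>

definition scale_xy :: "complex \<Rightarrow> poly_xy \<Rightarrow> poly_xy" where
  "scale_xy c P = [:[:c:]:] * P"

lemma scale_xy_simps:
  "coeff_xy (scale_xy c P) h i = c * coeff_xy P h i"
  "eval_xy (scale_xy c P) x y = c * eval_xy P x y"
  "scale_xy c (P * Q) = scale_xy c P * Q"
proof -
  show "eval_xy (scale_xy c P) x y = c * eval_xy P x y"
    unfolding scale_xy_def eval_xy_simps(4) by simp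
qed (simp_all add: scale_xy_def coeff_xy_def)

text \<open>
  Bezout's inequality by linear algebra. Among the polynomials of large degree \<open>k\<close> consider all
  \<open>\<alpha> F + \<beta> G + \<gamma>\<close>, with \<open>\<beta>\<close> of degree less than \<open>m\<close> in \<open>y\<close> and \<open>\<gamma>\<close> interpolating
  arbitrary values on \<open>Z\<close>. The number of free coefficients exceeds the dimension of the target by \<open>card Z - m n\<close>.
  If this were positive, some nontrivial combination would vanish. Evaluation on \<open>Z\<close> gives \<open>\<gamma> = 0\<close>; then
  \<open>F\<close> divides \<open>\<beta> G\<close> and hence \<open>\<beta>\<close>, which by its degree in \<open>y\<close> is zero, and so is \<open>\<alpha>\<close>. The
  assumption \<open>degree F = m\<close> on the degree in \<open>y\<close> replaces a change of coordinates.
\<close>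

lemma bezout_bound:
  fixes F G :: poly_xy
  assumes F: "degree F = m" "F \<noteq> 0" "tdeg_le F m" and G: "tdeg_le G n" and cop: "\<And>H. F dvd H * G \<Longrightarrow> F dvd H"
    and Z: "finite Z" "\<And>z. z \<in> Z \<Longrightarrow> eval_xy F (fst z) (snd z) = 0 \<and> eval_xy G (fst z) (snd z) = 0"
  shows "card Z \<le> m * n"
proof (rule ccontr)
  assume "\<not> card Z \<le> m * n"
  then have N: "card Z > m * n" by simp
  \<comment> \<open>Any sufficiently large \<open>k\<close> would do.\<close>
  define k where "k = card Z + m + n"
  obtain L where L: "\<And>z. tdeg_le (L z) (card Z)" "\<And>z w. w \<in> Z \<Longrightarrow> eval_xy (L z) (fst w) (snd w) = (if w = z then 1 else 0)"
    using interpolation_poly[OF Z(1)] by metis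
  define M :: "nat \<Rightarrow> (nat \<times> nat) set" where "M = (\<lambda>n. {(h, i). h + i \<le> n})"
  define M' :: "(nat \<times> nat) set" where "M' = (\<lambda>(i, h). (h, i)) ` (SIGMA i:{..<m}. {..(k - n) - i})"
  define I :: "((nat \<times> nat) + (nat \<times> nat) + (complex \<times> complex)) set" where
    "I = M (k - m) <+> (M' <+> Z)"
  define mon :: "nat \<times> nat \<Rightarrow> poly_xy" where "mon = (\<lambda>(h, i). monom (monom 1 h) i)"
  define T where "T = case_sum (\<lambda>x. mon x * F) (case_sum (\<lambda>x. mon x * G) L)"
  have finM: "finite (M n)" for n
    unfolding M_def by (rule finite_subset[of _ "{..n} \<times> {..n}"]) auto
  have finM': "finite M'" by (auto simp: M'_def)
  have finI: "finite I" using finM finM' Z(1) by (simp add: I_def)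
  have cM: "real (card (M n)) = (real n + 1) * (real n + 2) / 2" for n
    unfolding M_def by (rule card_monomials)
  have cM': "real (card M') = real m * (real (k - n) + 1) - real m * (real m - 1) / 2"
  proof -
    have "card M' = card (SIGMA i:{..<m}. {..(k - n) - i})"
      unfolding M'_def by (intro card_image) (auto simp: inj_on_def)
    also have "\<dots> = (\<Sum>i<m. (k - n) - i + 1)" by simp
    finally show ?thesis using sum_equations[of m "k - n"] by (simp add: k_def)
  qed
  have "card I = card (M (k - m)) + (card M' + card Z)"
    using finM finM' Z(1) by (simp add: I_def card_Plus)
  then have "real (card I) - real (card (M k)) = real (card Z) - real m * real n"
    by (simp add: cM cM' k_def field_simps)
  then have "card (M k) < card I" using N by (metis diff_gt_0_iff_gt of_nat_less_iff of_nat_mult)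
  from nontrivial_solution[OF finI finM[of k] this, of "\<lambda>\<kappa> \<iota>. coeff_xy (T \<iota>) (fst \<kappa>) (snd \<kappa>)"]
  obtain f where f': "f \<noteq> (\<lambda>_. 0) \<and> (\<forall>\<iota>. \<iota> \<notin> I \<longrightarrow> f \<iota> = 0) \<and>
    (\<forall>\<kappa>\<in>M k. (\<Sum>\<iota>\<in>I. coeff_xy (T \<iota>) (fst \<kappa>) (snd \<kappa>) * f \<iota>) = 0)" ..
  then have f: "f \<noteq> (\<lambda>_. 0)" "\<And>\<iota>. \<iota> \<notin> I \<Longrightarrow> f \<iota> = 0" by blast+
  have f3: "(\<Sum>\<iota>\<in>I. coeff_xy (T \<iota>) h i * f \<iota>) = 0" if "(h, i) \<in> M k" for h i
    using f' that by fastforce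
  have monom_tdeg: "tdeg_le (mon (h, i)) n" if "(h, i) \<in> M n" for h i n
    using that by (auto simp: tdeg_le_def coeff_xy_def mon_def M_def)
  have M'_sub: "(h, i) \<in> M (k - n) \<and> i < m" if "(h, i) \<in> M'" for h i
    using that by (auto simp: M'_def M_def k_def)
  define \<alpha> where "\<alpha> = (\<Sum>x\<in>M (k - m). scale_xy (f (Inl x)) (mon x))"
  define \<beta> where "\<beta> = (\<Sum>x\<in>M'. scale_xy (f (Inr (Inl x))) (mon x))"
  define \<gamma> where "\<gamma> = (\<Sum>z\<in>Z. scale_xy (f (Inr (Inr z))) (L z))"
  note coeff_scale = scale_xy_simps(1)
  have coeff_sum: "coeff_xy (sum P X) h i = (\<Sum>x\<in>X. coeff_xy (P x) h i)" for P h i and X :: "'z set"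
    by (simp add: coeff_xy_def coeff_sum)
  have "(\<Sum>\<iota>\<in>I. scale_xy (f \<iota>) (T \<iota>)) = \<alpha> * F + (\<beta> * G + \<gamma>)"
    unfolding I_def \<alpha>_def \<beta>_def \<gamma>_def
    using finM finM' Z(1)
    by (simp add: sum.Plus T_def sum_distrib_right scale_xy_simps(3))
  moreover have "(\<Sum>\<iota>\<in>I. scale_xy (f \<iota>) (T \<iota>)) = 0"
  proof -
    have tdeg: "tdeg_le (\<Sum>\<iota>\<in>I. scale_xy (f \<iota>) (T \<iota>)) k"
    proof (rule tdeg_le_sum)
      fix \<iota> assume \<iota>: "\<iota> \<in> I"
      have "tdeg_le (T \<iota>) k"
      proof -
        consider x where "\<iota> = Inl x" "x \<in> M (k - m)" | x where "\<iota> = Inr (Inl x)" "x \<in> M'" | z where "\<iota> = Inr (Inr z)"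
          using \<iota> by (auto simp: I_def)
        then show ?thesis
        proof cases
          case 1
          have "tdeg_le (mon x * F) ((k - m) + m)"
            using 1(2) by (cases x) (auto intro!: tdeg_le_mult monom_tdeg F)
          then show ?thesis using 1 by (simp add: T_def k_def add_ac)
        next
          case 2
          have "tdeg_le (mon x * G) ((k - n) + n)"
            using 2(2) M'_sub by (cases x) (auto intro!: tdeg_le_mult monom_tdeg G)
          then show ?thesis using 2 by (simp add: T_def k_def add_ac)
        next
          case 3
          then show ?thesis using tdeg_le_mono[OF L(1)[of z], of k] by (simp add: T_def k_def)
        qed
      qed
      then show "tdeg_le (scale_xy (f \<iota>) (T \<iota>)) k" by (auto simp: tdeg_le_def coeff_scale)
    qed
    have "coeff_xy (\<Sum>\<iota>\<in>I. scale_xy (f \<iota>) (T \<iota>)) h i = 0" for h i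
    proof (cases "(h, i) \<in> M k")
      case True
      then show ?thesis using f3[OF True] by (simp add: coeff_sum coeff_scale mult.commute)
    next
      case False
      then show ?thesis using tdeg by (auto simp: tdeg_le_def M_def)
    qed
    then show ?thesis using coeff_xy_eq_0_iff by blast
  qed
  ultimately have eq: "\<alpha> * F + (\<beta> * G + \<gamma>) = 0" by simp
  have fZ: "f (Inr (Inr z)) = 0" if "z \<in> Z" for z
  proof -
    have "eval_xy (\<alpha> * F + (\<beta> * G + \<gamma>)) (fst z) (snd z) = 0" unfolding eq by simp
    then have "eval_xy \<gamma> (fst z) (snd z) = 0" using Z(2)[OF that] by simp
    moreover have "eval_xy \<gamma> (fst z) (snd z) = (\<Sum>w\<in>Z. if w = z then f (Inr (Inr w)) else 0)"
      unfolding \<gamma>_def eval_xy_sum by (intro sum.cong) (auto simp: L(2)[OF that] scale_xy_simps(2))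
    ultimately show ?thesis using that Z(1) by simp
  qed
  then have \<gamma>: "\<gamma> = 0" by (simp add: \<gamma>_def scale_xy_def)
  have "\<beta> * G = F * (- \<alpha>)" using eq \<gamma> by (simp add: algebra_simps eq_neg_iff_add_eq_0)
  then have "F dvd \<beta> * G" by simp
  then have "F dvd \<beta>" by (rule cop)
  have coeff_part: "coeff_xy (\<Sum>x\<in>Y. scale_xy (g x) (mon x)) h i = (if (h, i) \<in> Y then g (h, i) else 0)"
    if "finite Y" for Y g h i
  proof -
    have "coeff_xy (\<Sum>x\<in>Y. scale_xy (g x) (mon x)) h i = (\<Sum>x\<in>Y. if x = (h, i) then g x else 0)"
      unfolding coeff_sum coeff_scale by (intro sum.cong) (auto simp: mon_def coeff_xy_def prod_eq_iff split: if_splits)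
    then show ?thesis using that by simp
  qed
  have "\<beta> = 0"
  proof (rule ccontr)
    assume \<beta>: "\<beta> \<noteq> 0"
    define h where "h = degree (coeff \<beta> (degree \<beta>))"
    have "coeff_xy \<beta> h (degree \<beta>) \<noteq> 0" using \<beta> by (simp add: coeff_xy_def h_def)
    then have "(h, degree \<beta>) \<in> M'" unfolding \<beta>_def coeff_part[OF finM'] by (auto split: if_splits)
    then have "degree \<beta> < m" using M'_sub by blast
    then show False using dvd_imp_degree_le[OF \<open>F dvd \<beta>\<close> \<beta>] F(1) by simp
  qed
  then have "\<alpha> * F = 0" using eq \<gamma> by simp
  then have "\<alpha> = 0" using F(2) by simp
  have f1: "f (Inl x) = 0" if "x \<in> M (k - m)" for x
    using coeff_part[OF finM, of "\<lambda>x. f (Inl x)" "k - m" "fst x" "snd x"] \<open>\<alpha> = 0\<close> that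
    by (simp add: \<alpha>_def[symmetric] coeff_xy_def)
  have f2: "f (Inr (Inl x)) = 0" if "x \<in> M'" for x
    using coeff_part[OF finM', of "\<lambda>x. f (Inr (Inl x))" "fst x" "snd x"] \<open>\<beta> = 0\<close> that
    by (simp add: \<beta>_def[symmetric] coeff_xy_def)
  have "f \<iota> = 0" for \<iota>
    using f(2)[of \<iota>] f1 f2 fZ by (cases "\<iota> \<in> I") (auto simp: I_def)
  then show False using f(1) by auto
qed

text \<open>
  The leading monomial for the graded order in which \<open>y\<close> is larger than \<open>x\<close>.
\<close>

lemma total_degree_attained:
  assumes "F \<noteq> 0"
  obtains h i where "coeff_xy F h i \<noteq> 0" "h + i = total_degree F"
    "\<And>h' i'. coeff_xy F h' i' \<noteq> 0 \<Longrightarrow> h' + i' = total_degree F \<Longrightarrow> i' \<le> i"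
proof -
  let ?D = "{i. \<exists>h. coeff_xy F h i \<noteq> 0 \<and> h + i = total_degree F}"
  have "{h + i | h i. coeff_xy F h i \<noteq> 0} \<noteq> {}" using assms coeff_xy_eq_0_iff by blast
  moreover have "finite {h + i | h i. coeff_xy F h i \<noteq> 0}"
    unfolding total_degree_set by (intro finite_imageI finite_coeff_xy_support)
  ultimately have "total_degree F \<in> {h + i | h i. coeff_xy F h i \<noteq> 0}"
    unfolding total_degree_def using assms by (simp only: if_False) (rule Max_in)
  then have ne: "?D \<noteq> {}" by (auto, metis)
  have fin: "finite ?D" by (rule finite_subset[of _ "{..total_degree F}"]) auto
  from Max_in[OF fin ne] obtain h where h: "coeff_xy F h (Max ?D) \<noteq> 0" "h + Max ?D = total_degree F" by blast
  show ?thesis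
    by (rule that[OF h]) (use Max_ge[OF fin] in blast)
qed

text \<open>
  The product of the leading monomials of the factors cannot cancel.
\<close>

lemma total_degree_mult:
  assumes "F \<noteq> 0" "G \<noteq> 0"
  shows "total_degree (F * G) = total_degree F + total_degree G"
proof (rule antisym)
  show "total_degree (F * G) \<le> total_degree F + total_degree G"
    unfolding total_degree_le_iff by (intro tdeg_le_mult tdeg_le_total_degree)
  obtain h i where F: "coeff_xy F h i \<noteq> 0" "h + i = total_degree F"
    "\<And>h' i'. coeff_xy F h' i' \<noteq> 0 \<Longrightarrow> h' + i' = total_degree F \<Longrightarrow> i' \<le> i"
    using total_degree_attained[OF assms(1)] by metis
  obtain h1 i1 where G: "coeff_xy G h1 i1 \<noteq> 0" "h1 + i1 = total_degree G"
    "\<And>h' i'. coeff_xy G h' i' \<noteq> 0 \<Longrightarrow> h' + i' = total_degree G \<Longrightarrow> i' \<le> i1"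
    using total_degree_attained[OF assms(2)] by metis
  have zero: "coeff_xy F k j * coeff_xy G (h + h1 - k) (i + i1 - j) = 0"
    if "j \<le> i + i1" "k \<le> h + h1" "(j, k) \<noteq> (i, h)" for j k
  proof (rule ccontr)
    assume "\<not> ?thesis"
    then have nz: "coeff_xy F k j \<noteq> 0" "coeff_xy G (h + h1 - k) (i + i1 - j) \<noteq> 0" by auto
    then have "k + j \<le> total_degree F" "(h + h1 - k) + (i + i1 - j) \<le> total_degree G"
      using tdeg_le_total_degree unfolding tdeg_le_def by blast+
    then have eqs: "k + j = total_degree F" "(h + h1 - k) + (i + i1 - j) = total_degree G"
      using that F(2) G(2) by linarith+
    then have "j \<le> i" "i + i1 - j \<le> i1" using F(3) G(3) nz by blast+
    then have "j = i" "k = h" using that eqs F(2) by linarith+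
    then show False using that(3) by simp
  qed
  have "coeff_xy (F * G) (h + h1) (i + i1) =
     (\<Sum>(j, k)\<in>{..i + i1} \<times> {..h + h1}. coeff_xy F k j * coeff_xy G (h + h1 - k) (i + i1 - j))"
    by (simp add: coeff_xy_mult sum.cartesian_product)
  also have "\<dots> = (\<Sum>(j, k)\<in>{(i, h)}. coeff_xy F k j * coeff_xy G (h + h1 - k) (i + i1 - j))"
  proof (intro sum.mono_neutral_right ballI)
    fix x assume x: "x \<in> {..i + i1} \<times> {..h + h1} - {(i, h)}"
    obtain j k where "x = (j, k)" by (cases x)
    with x zero[of j k] show "(case x of (j, k) \<Rightarrow> coeff_xy F k j * coeff_xy G (h + h1 - k) (i + i1 - j)) = 0" by simp
  qed auto
  also have "\<dots> = coeff_xy F h i * coeff_xy G h1 i1" by simp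
  finally have "coeff_xy (F * G) (h + h1) (i + i1) \<noteq> 0" using F(1) G(1) by simp
  then have "(h + h1) + (i + i1) \<le> total_degree (F * G)"
    using tdeg_le_total_degree unfolding tdeg_le_def by blast
  then show "total_degree F + total_degree G \<le> total_degree (F * G)" using F(2) G(2) by simp
qed

lemma degree_le_total_degree: "degree F \<le> total_degree F"
proof (cases "F = 0")
  case False
  then have "coeff_xy F (degree (coeff F (degree F))) (degree F) \<noteq> 0"
    by (simp add: coeff_xy_def)
  then show ?thesis using tdeg_le_total_degree[of F] unfolding tdeg_le_def by force
qed simp

text \<open>
  The equality of the degree in \<open>y\<close> with the total degree means that the polynomial is monic in \<open>y\<close> up to
  a nonzero constant. This property passes to factors since both degrees are additive.
\<close>

lemma monic_factor:
  assumes "F * G \<noteq> (0 :: poly_xy)" "degree (F * G) = total_degree (F * G)"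
  shows "degree F = total_degree F"
proof -
  have nz: "F \<noteq> 0" "G \<noteq> 0" using assms(1) by auto
  then show ?thesis
    using assms(2) degree_le_total_degree[of F] degree_le_total_degree[of G]
    by (simp add: total_degree_mult degree_mult_eq)
qed

text \<open>
  Being monic in \<open>y\<close> up to a constant, the polynomial has a zero over every \<open>x\<close>.
\<close>

lemma monic_infinite_zeros:
  assumes "degree F = total_degree F" "degree F \<noteq> 0"
  shows "infinite {(x, y). eval_xy F x y = 0}"
proof -
  have "\<exists>y. eval_xy F x y = 0" for x
  proof -
    let ?p = "map_poly (\<lambda>p. poly p x) F"
    have "degree (coeff F (degree F)) = 0"
    proof (rule ccontr)
      assume d: "degree (coeff F (degree F)) \<noteq> 0"
      then have "coeff_xy F (degree (coeff F (degree F))) (degree F) \<noteq> 0" by (auto simp: coeff_xy_def)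
      then have "degree (coeff F (degree F)) + degree F \<le> total_degree F"
        using tdeg_le_total_degree unfolding tdeg_le_def by blast
      then show False using d assms(1) by simp
    qed
    then obtain c where c: "coeff F (degree F) = [:c:]" by (rule degree_eq_zeroE)
    have "F \<noteq> 0" using assms(2) by auto
    then have "coeff F (degree F) \<noteq> 0" by simp
    then have "c \<noteq> 0" using c by auto
    then have "coeff ?p (degree F) \<noteq> 0" using c by (simp add: coeff_map_poly)
    then have "degree ?p \<ge> degree F" by (rule le_degree)
    then have "\<not> constant (poly ?p)" using assms(2) by (simp add: constant_degree)
    from Fundamental_Theorem_Algebra.fundamental_theorem_of_algebra[OF this] obtain y where y: "poly ?p y = 0" ..
    have "poly (map_poly (\<lambda>p. poly p x) G) y = eval_xy G x y" for G
      by (induction G) (simp_all add: map_poly_pCons)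
    then show ?thesis using y by auto
  qed
  then have U: "(UNIV :: complex set) \<subseteq> fst ` {(x, y). eval_xy F x y = 0}"
    by (fastforce simp: image_iff)
  show ?thesis
  proof
    assume "finite {(x, y). eval_xy F x y = 0}"
    from finite_subset[OF U finite_imageI[OF this]] show False using infinite_UNIV_char_0 by blast
  qed
qed

text \<open>
  Bezout's inequality needs coprime polynomials, and \<open>A\<close> may have a common factor \<open>g\<close> with
  \<open>R\<close>, of degree \<open>\<gamma>\<close> say. At most \<open>\<gamma> e\<close> points of \<open>Z\<close> lie on \<open>g = 0\<close>, and at most
  \<open>(d - \<gamma>) (a - \<gamma>)\<close> on the residual curves of \<open>R\<close> and \<open>A\<close>; as \<open>a - \<gamma> < e\<close>, this is less than \<open>d e\<close> in
  total.
\<close>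

lemma vanishing_on_complete_intersection:
  fixes R S A :: poly_xy
  assumes R: "degree R = d" "total_degree R = d" and S: "tdeg_le S e"
    and Z: "Z \<subseteq> {(x, y). eval_xy R x y = 0 \<and> eval_xy S x y = 0}" "card Z = d * e"
    and fin: "finite {(x, y). eval_xy R x y = 0 \<and> eval_xy S x y = 0}"
    and A: "tdeg_le A a" "a < d" "d \<le> e" "\<And>z. z \<in> Z \<Longrightarrow> eval_xy A (fst z) (snd z) = 0"
  shows "A = 0"
proof (rule ccontr)
  assume A0: "A \<noteq> 0"
  have R0: "R \<noteq> 0" using R A(2) by auto
  have finZ: "finite Z" using Z(1) fin finite_subset by blast
  have unit: "is_unit G" if G: "degree G = total_degree G" "degree G = 0" "G \<noteq> 0" for G :: poly_xy
  proof -
    obtain p where p: "G = [:p:]" using G(2) by (rule degree_eq_zeroE)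
    have "coeff_xy G h 0 = 0" if "h \<noteq> 0" for h
      using tdeg_le_total_degree[of G] G(1,2) that unfolding tdeg_le_def by fastforce
    then have "degree p = 0" using p by (metis coeff_pCons_0 coeff_xy_def leading_coeff_0_iff degree_0)
    then obtain c where "G = [:[:c:]:]" "c \<noteq> 0" using p G(3) by (auto elim: degree_eq_zeroE)
    then show ?thesis by (intro dvdI[of _ _ "[:[:1 / c:]:]"]) (simp add: one_pCons)
  qed
  have copRS: "coprime R S"
  proof -
    define g where "g = gcd R S"
    obtain R1 where R1: "R = g * R1" unfolding g_def by (meson dvd_def gcd_dvd1)
    obtain S1 where S1: "S = g * S1" unfolding g_def by (meson dvd_def gcd_dvd2)
    have g0: "g \<noteq> 0" using R0 R1 by auto
    have dg: "degree g = total_degree g" using monic_factor[of g R1] R0 R1 R by simp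
    have "degree g = 0"
    proof (rule ccontr)
      assume "degree g \<noteq> 0"
      from monic_infinite_zeros[OF dg this] have "infinite {(x, y). eval_xy g x y = 0}" .
      moreover have "{(x, y). eval_xy g x y = 0} \<subseteq> {(x, y). eval_xy R x y = 0 \<and> eval_xy S x y = 0}"
        using R1 S1 by auto
      ultimately show False using fin finite_subset by blast
    qed
    then have "is_unit g" using unit[OF dg _ g0] by blast
    then show ?thesis unfolding g_def by (simp only: is_unit_gcd)
  qed
  define g where "g = gcd A R"
  have g0: "g \<noteq> 0" using R0 by (simp add: g_def)
  obtain A1 R1 where AR: "A = A1 * g" "R = R1 * g" "coprime A1 R1"
    using gcd_coprime_exists[of A R] g0 unfolding g_def by blast
  have nz: "A1 \<noteq> 0" "R1 \<noteq> 0" using AR A0 R0 by auto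
  have dg: "degree g = total_degree g" using monic_factor[of g R1] R0 AR(2) R by (simp add: mult.commute)
  have dR1: "degree R1 = total_degree R1" using monic_factor[of R1 g] R0 AR(2) R by simp
  define \<gamma> where "\<gamma> = total_degree g"
  have tR: "total_degree R1 + \<gamma> = d" using total_degree_mult[OF nz(2) g0] AR(2) R(2) by (simp add: \<gamma>_def)
  have tA: "total_degree A1 + \<gamma> \<le> a" using total_degree_mult[OF nz(1) g0] AR(1) A(1) by (simp add: \<gamma>_def total_degree_le_iff[symmetric])
  have "coprime g S" using copRS AR(2) by (metis coprime_mult_left_iff)
  then have "card {z \<in> Z. eval_xy g (fst z) (snd z) = 0} \<le> \<gamma> * e"
    using Z(1) finZ dg g0 S
    by (intro bezout_bound[of g _ S]) (auto simp: \<gamma>_def tdeg_le_total_degree coprime_dvd_mult_left_iff)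
  moreover have "card {z \<in> Z. eval_xy R1 (fst z) (snd z) = 0 \<and> eval_xy A1 (fst z) (snd z) = 0} \<le> total_degree R1 * total_degree A1"
    using finZ dR1 nz AR(3)
    by (intro bezout_bound[of R1 _ A1]) (auto simp: tdeg_le_total_degree coprime_dvd_mult_left_iff coprime_commute)
  moreover have "card Z \<le> card {z \<in> Z. eval_xy g (fst z) (snd z) = 0} +
      card {z \<in> Z. eval_xy R1 (fst z) (snd z) = 0 \<and> eval_xy A1 (fst z) (snd z) = 0}"
  proof -
    have "Z \<subseteq> {z \<in> Z. eval_xy g (fst z) (snd z) = 0} \<union> {z \<in> Z. eval_xy R1 (fst z) (snd z) = 0 \<and> eval_xy A1 (fst z) (snd z) = 0}"
      using Z(1) A(4) AR by auto
    from card_mono[OF _ this] show ?thesis using finZ by (intro order.trans[OF _ card_Un_le]) simp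
  qed
  ultimately have "d * e \<le> \<gamma> * e + total_degree R1 * total_degree A1" using Z(2) by linarith
  then have "total_degree R1 * e \<le> total_degree R1 * total_degree A1" unfolding tR[symmetric] by (simp add: algebra_simps)
  moreover have "total_degree R1 > 0" "total_degree A1 < e" using tR tA A(2,3) by linarith+
  ultimately show False by simp
qed

section \<open>Injectivity of the jet polynomial\<close>

lemma eval_xy_line_derivative:
  "((\<lambda>\<epsilon>. eval_xy F (x + \<epsilon> * \<xi>) (y + \<epsilon> * \<eta>)) has_field_derivative
     eval_xy (diff_x F) x y * \<xi> + eval_xy (diff_y F) x y * \<eta>) (at 0)"
proof -
  have 1: "((\<lambda>\<epsilon>. x + \<epsilon> * \<xi>) has_derivative (\<lambda>h. h * \<xi>)) (at 0)" for x \<xi> :: complex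
    by (auto intro!: derivative_eq_intros)
  from has_derivative_eval_xy[OF 1[of x \<xi>] 1[of y \<eta>], of F] show ?thesis
    unfolding has_field_derivative_def by (rule has_derivative_eq_rhs) (auto simp: algebra_simps)
qed

text \<open>
  The point \<open>(x, y)\<close> is approached along \<open>(x + \<epsilon> \<xi>, y + \<epsilon> \<eta>)\<close>. By Cramer's rule
  there is a tangent vector at the moving point with \<open>dR = \<rho> \<Delta> R\<close> and \<open>dS = \<sigma> \<Delta> S\<close>, where \<open>\<Delta>\<close> is the Jacobian.
  Since \<open>R\<close> and \<open>S\<close> are of order \<open>\<epsilon>\<close>, this vector is \<open>\<epsilon> (u, v)\<close> with \<open>u, v\<close> convergent. Every term of \<open>J\<close>
  then contains the factor \<open>R\<^sup>m S\<^sup>m \<epsilon>\<^bsup>j+k\<^esup>\<close>; after division by \<open>R\<^sup>m S\<^sup>m \<epsilon>\<^sup>n\<close> only the terms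
  with \<open>j + k = n\<close> survive in the limit.
\<close>

lemma homogeneous_part_vanishes:
  fixes R S :: poly_xy and B :: "nat \<times> nat \<times> nat \<times> nat \<Rightarrow> poly_xy" and \<xi> \<eta> \<rho> \<sigma> :: complex
  assumes J: "\<And>x y x' y'. (\<Sum>(j, k, p, q)\<in>jet_exponents m. eval_xy (B (j, k, p, q)) x y * x' ^ j * y' ^ k *
      (x' * eval_xy (diff_x R) x y + y' * eval_xy (diff_y R) x y) ^ p *
      (x' * eval_xy (diff_x S) x y + y' * eval_xy (diff_y S) x y) ^ q *
      eval_xy R x y ^ (m - p) * eval_xy S x y ^ (m - q)) = 0"
    and low: "\<And>j k p q. (j, k, p, q) \<in> jet_exponents m \<Longrightarrow> j + k < n \<Longrightarrow> B (j, k, p, q) = 0"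
    and z: "eval_xy R x y = 0" "eval_xy S x y = 0"
  defines "Rx \<equiv> eval_xy (diff_x R) x y" and "Ry \<equiv> eval_xy (diff_y R) x y"
    and "Sx \<equiv> eval_xy (diff_x S) x y" and "Sy \<equiv> eval_xy (diff_y S) x y"
  assumes r0: "Rx * \<xi> + Ry * \<eta> \<noteq> 0" and s0: "Sx * \<xi> + Sy * \<eta> \<noteq> 0"
  defines "u0 \<equiv> \<rho> * (Rx * \<xi> + Ry * \<eta>) * Sy - \<sigma> * (Sx * \<xi> + Sy * \<eta>) * Ry"
    and "v0 \<equiv> \<sigma> * (Sx * \<xi> + Sy * \<eta>) * Rx - \<rho> * (Rx * \<xi> + Ry * \<eta>) * Sx"
    and "\<Delta>0 \<equiv> Rx * Sy - Ry * Sx"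
  shows "(\<Sum>(j, k, p, q)\<in>{(j, k, p, q) \<in> jet_exponents m. j + k = n}.
     eval_xy (B (j, k, p, q)) x y * u0 ^ j * v0 ^ k * (\<rho> * \<Delta>0) ^ p * (\<sigma> * \<Delta>0) ^ q) = 0"
proof -
  let ?I = "{(j, k, p, q) \<in> jet_exponents m. n \<le> j + k}"
  have finI: "finite ?I" by (rule finite_subset[of _ "jet_exponents m"]) auto
  define ev where "ev = (\<lambda>F \<epsilon>. eval_xy F (x + \<epsilon> * \<xi>) (y + \<epsilon> * \<eta>))"
  have lim: "((ev F) \<longlongrightarrow> eval_xy F x y) (at 0)" for F
    using DERIV_isCont[OF eval_xy_line_derivative[of F x \<xi> y \<eta>]] by (simp add: ev_def isCont_def)
  define r where "r = (\<lambda>\<epsilon>. ev R \<epsilon> / \<epsilon>)"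
  define s where "s = (\<lambda>\<epsilon>. ev S \<epsilon> / \<epsilon>)"
  have r: "(r \<longlongrightarrow> Rx * \<xi> + Ry * \<eta>) (at 0)"
    using eval_xy_line_derivative[of R x \<xi> y \<eta>] z by (simp add: DERIV_def r_def ev_def Rx_def Ry_def)
  have s: "(s \<longlongrightarrow> Sx * \<xi> + Sy * \<eta>) (at 0)"
    using eval_xy_line_derivative[of S x \<xi> y \<eta>] z by (simp add: DERIV_def s_def ev_def Sx_def Sy_def)
  define u where "u = (\<lambda>\<epsilon>. \<rho> * r \<epsilon> * ev (diff_y S) \<epsilon> - \<sigma> * s \<epsilon> * ev (diff_y R) \<epsilon>)"
  define v where "v = (\<lambda>\<epsilon>. \<sigma> * s \<epsilon> * ev (diff_x R) \<epsilon> - \<rho> * r \<epsilon> * ev (diff_x S) \<epsilon>)"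
  define \<Delta> where "\<Delta> = (\<lambda>\<epsilon>. ev (diff_x R) \<epsilon> * ev (diff_y S) \<epsilon> - ev (diff_y R) \<epsilon> * ev (diff_x S) \<epsilon>)"
  define T where "T = (\<lambda>j k p q \<epsilon>. ev (B (j, k, p, q)) \<epsilon> * u \<epsilon> ^ j * v \<epsilon> ^ k * (\<rho> * \<Delta> \<epsilon>) ^ p * (\<sigma> * \<Delta> \<epsilon>) ^ q)"
  have uvlim: "(u \<longlongrightarrow> u0) (at 0)" "(v \<longlongrightarrow> v0) (at 0)" "(\<Delta> \<longlongrightarrow> \<Delta>0) (at 0)"
    unfolding u_def v_def \<Delta>_def u0_def v0_def \<Delta>0_def Rx_def Ry_def Sx_def Sy_def
    by (intro tendsto_intros lim r[unfolded Rx_def Ry_def] s[unfolded Sx_def Sy_def])+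
  have "((\<lambda>\<epsilon>. \<Sum>(j, k, p, q)\<in>?I. \<epsilon> ^ (j + k - n) * T j k p q \<epsilon>) \<longlongrightarrow>
     (\<Sum>(j, k, p, q)\<in>?I. 0 ^ (j + k - n) * (eval_xy (B (j, k, p, q)) x y * u0 ^ j * v0 ^ k * (\<rho> * \<Delta>0) ^ p * (\<sigma> * \<Delta>0) ^ q))) (at 0)"
    unfolding T_def case_prod_unfold by (intro tendsto_intros lim uvlim)
  moreover have "\<forall>\<^sub>F \<epsilon> in at 0. (\<Sum>(j, k, p, q)\<in>?I. \<epsilon> ^ (j + k - n) * T j k p q \<epsilon>) = 0"
  proof -
    have "\<forall>\<^sub>F \<epsilon> in at 0. r \<epsilon> \<noteq> 0" "\<forall>\<^sub>F \<epsilon> in at 0. s \<epsilon> \<noteq> 0"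
      using tendsto_imp_eventually_ne[OF r r0] tendsto_imp_eventually_ne[OF s s0] by auto
    then show ?thesis using eventually_neq_at_within[of 0 0 UNIV]
    proof eventually_elim
      case (elim \<epsilon>)
      have R: "ev R \<epsilon> = \<epsilon> * r \<epsilon>" and S: "ev S \<epsilon> = \<epsilon> * s \<epsilon>" using elim by (simp_all add: r_def s_def)
      have dR: "(\<epsilon> * u \<epsilon>) * ev (diff_x R) \<epsilon> + (\<epsilon> * v \<epsilon>) * ev (diff_y R) \<epsilon> = (\<rho> * \<Delta> \<epsilon>) * ev R \<epsilon>"
        unfolding R u_def v_def \<Delta>_def by (simp add: algebra_simps)
      have dS: "(\<epsilon> * u \<epsilon>) * ev (diff_x S) \<epsilon> + (\<epsilon> * v \<epsilon>) * ev (diff_y S) \<epsilon> = (\<sigma> * \<Delta> \<epsilon>) * ev S \<epsilon>"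
        unfolding S u_def v_def \<Delta>_def by (simp add: algebra_simps)
      have summand: "ev (B (j, k, p, q)) \<epsilon> * (\<epsilon> * u \<epsilon>) ^ j * (\<epsilon> * v \<epsilon>) ^ k *
         ((\<epsilon> * u \<epsilon>) * ev (diff_x R) \<epsilon> + (\<epsilon> * v \<epsilon>) * ev (diff_y R) \<epsilon>) ^ p *
         ((\<epsilon> * u \<epsilon>) * ev (diff_x S) \<epsilon> + (\<epsilon> * v \<epsilon>) * ev (diff_y S) \<epsilon>) ^ q * ev R \<epsilon> ^ (m - p) * ev S \<epsilon> ^ (m - q) =
         (ev R \<epsilon> ^ m * ev S \<epsilon> ^ m) * (\<epsilon> ^ (j + k) * T j k p q \<epsilon>)"
        if "(j, k, p, q) \<in> jet_exponents m" for j k p q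
      proof -
        have "p \<le> m" "q \<le> m" using that by (auto simp: jet_exponents_def)
        then have "ev R \<epsilon> ^ m = ev R \<epsilon> ^ p * ev R \<epsilon> ^ (m - p)" "ev S \<epsilon> ^ m = ev S \<epsilon> ^ q * ev S \<epsilon> ^ (m - q)"
          by (simp_all flip: power_add)
        then show ?thesis
          unfolding dR dS T_def by (simp only: prod.case power_mult_distrib power_add mult_ac)
      qed
      have "(ev R \<epsilon> ^ m * ev S \<epsilon> ^ m) * (\<Sum>(j, k, p, q)\<in>jet_exponents m. \<epsilon> ^ (j + k) * T j k p q \<epsilon>) = 
         (\<Sum>(j, k, p, q)\<in>jet_exponents m. ev (B (j, k, p, q)) \<epsilon> * (\<epsilon> * u \<epsilon>) ^ j * (\<epsilon> * v \<epsilon>) ^ k *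
         ((\<epsilon> * u \<epsilon>) * ev (diff_x R) \<epsilon> + (\<epsilon> * v \<epsilon>) * ev (diff_y R) \<epsilon>) ^ p *
         ((\<epsilon> * u \<epsilon>) * ev (diff_x S) \<epsilon> + (\<epsilon> * v \<epsilon>) * ev (diff_y S) \<epsilon>) ^ q * ev R \<epsilon> ^ (m - p) * ev S \<epsilon> ^ (m - q))"
        unfolding sum_distrib_left by (intro sum.cong refl, clarify, rule summand[symmetric])
      also have "\<dots> = 0" unfolding ev_def by (rule J)
      finally have "(\<Sum>(j, k, p, q)\<in>jet_exponents m. \<epsilon> ^ (j + k) * T j k p q \<epsilon>) = 0"
        using elim R S by simp
      also have "(\<Sum>(j, k, p, q)\<in>jet_exponents m. \<epsilon> ^ (j + k) * T j k p q \<epsilon>) =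
         (\<Sum>(j, k, p, q)\<in>?I. \<epsilon> ^ (j + k) * T j k p q \<epsilon>)"
      proof (intro sum.mono_neutral_right ballI)
        fix t assume t: "t \<in> jet_exponents m - ?I"
        obtain j k p q where "t = (j, k, p, q)" by (cases t)
        moreover from this t have "B (j, k, p, q) = 0" by (intro low) auto
        ultimately show "(case t of (j, k, p, q) \<Rightarrow> \<epsilon> ^ (j + k) * T j k p q \<epsilon>) = 0"
          by (simp add: T_def ev_def)
      qed auto
      also have "\<dots> = \<epsilon> ^ n * (\<Sum>(j, k, p, q)\<in>?I. \<epsilon> ^ (j + k - n) * T j k p q \<epsilon>)"
        unfolding sum_distrib_left
      proof (intro sum.cong refl, clarify)
        fix j k p q assume "n \<le> j + k"
        then have "\<epsilon> ^ (j + k) = \<epsilon> ^ n * \<epsilon> ^ (j + k - n)" by (simp flip: power_add)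
        then show "\<epsilon> ^ (j + k) * T j k p q \<epsilon> = \<epsilon> ^ n * (\<epsilon> ^ (j + k - n) * T j k p q \<epsilon>)" by simp
      qed
      finally show ?case using elim by simp
    qed
  qed
  then have "((\<lambda>\<epsilon>. \<Sum>(j, k, p, q)\<in>?I. \<epsilon> ^ (j + k - n) * T j k p q \<epsilon>) \<longlongrightarrow> 0) (at 0)"
    by (rule tendsto_eventually)
  ultimately have "(\<Sum>(j, k, p, q)\<in>?I. 0 ^ (j + k - n) * (eval_xy (B (j, k, p, q)) x y * u0 ^ j * v0 ^ k * (\<rho> * \<Delta>0) ^ p * (\<sigma> * \<Delta>0) ^ q)) = 0"
    using tendsto_unique[OF at_neq_bot] by blast
  moreover have "(\<Sum>(j, k, p, q)\<in>?I. 0 ^ (j + k - n) * (eval_xy (B (j, k, p, q)) x y * u0 ^ j * v0 ^ k * (\<rho> * \<Delta>0) ^ p * (\<sigma> * \<Delta>0) ^ q)) =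
     (\<Sum>(j, k, p, q)\<in>{(j, k, p, q) \<in> jet_exponents m. j + k = n}. eval_xy (B (j, k, p, q)) x y * u0 ^ j * v0 ^ k * (\<rho> * \<Delta>0) ^ p * (\<sigma> * \<Delta>0) ^ q)"
    by (rule sum.mono_neutral_cong_right[OF finI]) auto
  ultimately show ?thesis by simp
qed

lemma infinite_linear_nonroots:
  fixes a b c d :: complex
  assumes "a * d - b * c \<noteq> 0"
  shows "infinite {u. u * a + b \<noteq> 0 \<and> u * c + d \<noteq> 0}"
proof
  assume fin: "finite {u. u * a + b \<noteq> 0 \<and> u * c + d \<noteq> 0}"
  have "[:b, a:] \<noteq> 0" "[:d, c:] \<noteq> 0" using assms by auto
  then have "finite ({u. u * a + b \<noteq> 0 \<and> u * c + d \<noteq> 0} \<union> {u. poly [:b, a:] u = 0} \<union> {u. poly [:d, c:] u = 0})"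
    using fin by (intro finite_UnI poly_roots_finite)
  moreover have "{u. u * a + b \<noteq> 0 \<and> u * c + d \<noteq> 0} \<union> {u. poly [:b, a:] u = 0} \<union> {u. poly [:d, c:] u = 0} = UNIV"
    by (auto simp: algebra_simps)
  ultimately have "finite (UNIV :: complex set)" by (simp only:)
  then show False using infinite_UNIV_char_0 by blast
qed

text \<open>
  By transversality the first-order values of \<open>R\<close> and \<open>S\<close> along the approach, and the ratios \<open>dR/R\<close> and \<open>dS/S\<close>,
  can be prescribed. They are chosen so that the limit has tangent direction \<open>(u, 1)\<close> and ratios \<open>\<tau>\<close> and \<open>1\<close>. Since
  \<open>k\<close> and \<open>q\<close> are determined by \<open>j\<close> and \<open>p\<close>, the homogeneous part becomes a polynomial in \<open>u\<close> and \<open>\<tau>\<close>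
  whose coefficients are the values of the \<open>B\<close>, and it vanishes for generic \<open>u\<close> and \<open>\<tau>\<close>.
\<close>

lemma coefficients_vanish_at_point:
  fixes R S :: poly_xy and B :: "nat \<times> nat \<times> nat \<times> nat \<Rightarrow> poly_xy"
  assumes J: "\<And>x y x' y'. (\<Sum>(j, k, p, q)\<in>jet_exponents m. eval_xy (B (j, k, p, q)) x y * x' ^ j * y' ^ k *
      (x' * eval_xy (diff_x R) x y + y' * eval_xy (diff_y R) x y) ^ p *
      (x' * eval_xy (diff_x S) x y + y' * eval_xy (diff_y S) x y) ^ q *
      eval_xy R x y ^ (m - p) * eval_xy S x y ^ (m - q)) = 0"
    and low: "\<And>j k p q. (j, k, p, q) \<in> jet_exponents m \<Longrightarrow> j + k < n \<Longrightarrow> B (j, k, p, q) = 0"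
    and z: "eval_xy R x y = 0" "eval_xy S x y = 0"
    and trans: "eval_xy (diff_x R) x y * eval_xy (diff_y S) x y - eval_xy (diff_y R) x y * eval_xy (diff_x S) x y \<noteq> 0"
    and e: "(j, k, p, q) \<in> jet_exponents m" "j + k = n"
  shows "eval_xy (B (j, k, p, q)) x y = 0"
proof -
  define Rx Ry Sx Sy where "Rx = eval_xy (diff_x R) x y" and "Ry = eval_xy (diff_y R) x y"
    and "Sx = eval_xy (diff_x S) x y" and "Sy = eval_xy (diff_y S) x y"
  note defs = Rx_def Ry_def Sx_def Sy_def
  define \<Delta> where "\<Delta> = Rx * Sy - Ry * Sx"
  have \<Delta>: "\<Delta> \<noteq> 0" using trans by (simp add: \<Delta>_def defs)
  let ?I = "{(j, k, p, q) \<in> jet_exponents m. j + k = n}"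
  have finI: "finite ?I" by (rule finite_subset[of _ "jet_exponents m"]) auto
  define P where "P = (\<Sum>(j, k, p, q)\<in>?I. monom (monom (eval_xy (B (j, k, p, q)) x y) j) p)"
  have ev: "eval_xy P u \<tau> = 0" if "\<tau> \<noteq> 0" "u * Rx + Ry \<noteq> 0" "u * Sx + Sy \<noteq> 0" for u \<tau>
  proof -
    define r0 where "r0 = (u * Rx + Ry) / \<tau>"
    define s0 where "s0 = u * Sx + Sy"
    \<comment> \<open>The direction along which \<open>R\<close> and \<open>S\<close> have derivatives \<open>r0\<close> and \<open>s0\<close>.\<close>
    define \<xi> where "\<xi> = (r0 * Sy - s0 * Ry) / \<Delta>"
    define \<eta> where "\<eta> = (s0 * Rx - r0 * Sx) / \<Delta>"
    have "Rx * \<xi> + Ry * \<eta> = r0 * (Rx * Sy - Ry * Sx) / \<Delta>"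
      unfolding \<xi>_def \<eta>_def by (simp add: algebra_simps add_divide_distrib diff_divide_distrib)
    then have r0: "Rx * \<xi> + Ry * \<eta> = r0" using \<Delta> by (simp add: \<Delta>_def)
    have "Sx * \<xi> + Sy * \<eta> = s0 * (Rx * Sy - Ry * Sx) / \<Delta>"
      unfolding \<xi>_def \<eta>_def by (simp add: algebra_simps add_divide_distrib diff_divide_distrib)
    then have s0: "Sx * \<xi> + Sy * \<eta> = s0" using \<Delta> by (simp add: \<Delta>_def)
    have nz: "r0 \<noteq> 0" "s0 \<noteq> 0" using that by (simp_all add: r0_def s0_def)
    have u: "\<tau> / \<Delta> * r0 * Sy - 1 / \<Delta> * s0 * Ry = u"
    proof -
      have "\<tau> / \<Delta> * r0 * Sy - 1 / \<Delta> * s0 * Ry = u * (Rx * Sy - Ry * Sx) / \<Delta>"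
        using that(1) unfolding r0_def s0_def by (simp add: algebra_simps add_divide_distrib diff_divide_distrib)
      then show ?thesis using \<Delta> by (simp add: \<Delta>_def)
    qed
    have v: "1 / \<Delta> * s0 * Rx - \<tau> / \<Delta> * r0 * Sx = 1"
    proof -
      have "1 / \<Delta> * s0 * Rx - \<tau> / \<Delta> * r0 * Sx = (Rx * Sy - Ry * Sx) / \<Delta>"
        using that(1) unfolding r0_def s0_def by (simp add: algebra_simps add_divide_distrib diff_divide_distrib)
      then show ?thesis using \<Delta> by (simp add: \<Delta>_def)
    qed
    have "(\<Sum>(j, k, p, q)\<in>?I. eval_xy (B (j, k, p, q)) x y * u ^ j * 1 ^ k * (\<tau> / \<Delta> * \<Delta>) ^ p * (1 / \<Delta> * \<Delta>) ^ q) = 0"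
      using homogeneous_part_vanishes[OF J low z, folded defs, where \<xi> = \<xi> and \<eta> = \<eta> and \<rho> = "\<tau> / \<Delta>" and \<sigma> = "1 / \<Delta>"] nz
      unfolding r0 s0 u v \<Delta>_def[symmetric] by blast
    then show ?thesis using \<Delta> by (simp add: P_def case_prod_unfold)
  qed
  have "P = 0"
  proof (rule eval_xy_eq_0_imp[of "UNIV - {0}"])
    show "infinite (UNIV - {0 :: complex})" using infinite_UNIV_char_0 by simp
    fix \<tau> :: complex assume "\<tau> \<in> UNIV - {0}"
    then have "{u. u * Rx + Ry \<noteq> 0 \<and> u * Sx + Sy \<noteq> 0} \<subseteq> {u. eval_xy P u \<tau> = 0}" using ev by auto
    then show "infinite {u. eval_xy P u \<tau> = 0}"
      using infinite_linear_nonroots[of Rx Sy Ry Sx] \<Delta> finite_subset unfolding \<Delta>_def by blast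
  qed
  have "coeff_xy P j p = (\<Sum>t\<in>?I. if t = (j, k, p, q) then eval_xy (B t) x y else 0)"
    unfolding P_def coeff_xy_def coeff_sum
    by (intro sum.cong refl) (use e in \<open>auto simp: jet_exponents_def split: if_splits\<close>)
  also have "\<dots> = eval_xy (B (j, k, p, q)) x y" using finI e by simp
  finally show ?thesis using \<open>P = 0\<close> by (simp add: coeff_xy_def)
qed

text \<open>
  The vanishing of the coefficients of lower order \<open>j + k\<close> is what allows the next ones to be
  evaluated at the points of \<open>Z\<close>.
\<close>

lemma jet_J_injective:
  fixes R S :: poly_xy
  assumes J: "\<And>x y x' y'. eval_jet (jet_J R S m a A) x y x' y' = 0"
    and Z: "\<And>x y. (x, y) \<in> Z \<Longrightarrow> eval_xy R x y = 0 \<and> eval_xy S x y = 0 \<and>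
      eval_xy (diff_x R) x y * eval_xy (diff_y S) x y - eval_xy (diff_y R) x y * eval_xy (diff_x S) x y \<noteq> 0"
    and vanish: "\<And>F. tdeg_le F (nat a) \<Longrightarrow> (\<And>x y. (x, y) \<in> Z \<Longrightarrow> eval_xy F x y = 0) \<Longrightarrow> F = 0"
    and A: "A \<in> coeff_families m a"
  shows "A = (\<lambda>_. 0)"
proof -
  have "A_poly a A (j, k, p, q) = 0" if "(j, k, p, q) \<in> jet_exponents m" for j k p q
    using that
  proof (induction "j + k" arbitrary: j k p q rule: less_induct)
    case less
    show ?case
    proof (rule vanish[OF tdeg_le_A_poly])
      fix x y assume xy: "(x, y) \<in> Z"
      show "eval_xy (A_poly a A (j, k, p, q)) x y = 0"
        by (rule coefficients_vanish_at_point[OF J[unfolded eval_jet_J] _ _ _ _ less.prems refl])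
           (use less Z[OF xy] in auto)
    qed
  qed
  then have "A (\<epsilon>, (h, i)) = 0" if "\<epsilon> \<in> jet_exponents m" "(h, i) \<in> monomials a" for \<epsilon> h i
    using coeff_A_poly[of a A \<epsilon> h i] that by (cases \<epsilon>) (simp add: coeff_xy_def)
  then have A0: "A \<iota> = 0" if "\<iota> \<in> coeff_indices m a" for \<iota>
    using that by (cases \<iota>; cases "snd \<iota>") (simp add: coeff_indices_def)
  show ?thesis
  proof (rule ext)
    fix \<iota>
    show "A \<iota> = 0" using A A0[of \<iota>] unfolding coeff_families_def by blast
  qed
qed

section \<open>The transversal intersection points\<close>

lemma three_eq_zero: "(3 :: 3) = 0" by simp

lemma forall_3': "(\<forall>i :: 3. P i) \<longleftrightarrow> P 0 \<and> P 1 \<and> P 2"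
  by (metis forall_3 three_eq_zero)

definition point3 :: "complex \<Rightarrow> complex \<Rightarrow> complex \<Rightarrow> complex ^ 3" where
  "point3 w x y = (\<chi> k. if k = 0 then w else if k = 1 then x else y)"

lemma point3_nth [simp]: "point3 w x y $ 0 = w" "point3 w x y $ 1 = x" "point3 w x y $ 2 = y"
  by (simp_all add: point3_def)

lemma point3_update:
  "(\<chi> k. if k = 0 then v else point3 w x y $ k) = point3 v x y"
  "(\<chi> k. if k = 1 then v else point3 w x y $ k) = point3 w v y"
  "(\<chi> k. if k = 2 then v else point3 w x y $ k) = point3 w x v"
  by (simp_all add: vec_eq_iff forall_3')

lemma abs_proj_in_curve_iff: "u \<noteq> 0 \<Longrightarrow> abs_proj u \<in> curve F \<longleftrightarrow> homogenize F u = 0"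
  unfolding curve_def by (subst proj_locus_iff) (auto simp: homogenize_scale)

lemma homogenize_nonzero:
  "u $ 0 \<noteq> 0 \<Longrightarrow> homogenize F u = (u $ 0) ^ total_degree F * eval_xy F (u $ 1 / u $ 0) (u $ 2 / u $ 0)"
  using homogenize_scale[of F "u $ 0" "(1 / u $ 0) *s u"] homogenize_affine[of "(1 / u $ 0) *s u" F] by simp

text \<open>
  Transversality includes that no intersection point lies at infinity.
\<close>

lemma affine_intersection:
  assumes "meet_transversally R S"
  defines "Z \<equiv> {(x, y). eval_xy R x y = 0 \<and> eval_xy S x y = 0}"
  shows "finite Z" "card Z = total_degree R * total_degree S"
proof -
  define g where "g = (\<lambda>(x, y). abs_proj (point3 1 x y))"
  have nz: "point3 1 x y \<noteq> 0" for x y using nth_nonzero_imp_nonzero[of "point3 1 x y" 0] by simp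
  have mem: "g (x, y) \<in> curve R \<inter> curve S \<longleftrightarrow> (x, y) \<in> Z" for x y
    by (simp add: g_def abs_proj_in_curve_iff nz homogenize_affine Z_def)
  have coords: "affine_coords 0 (g (x, y)) = point3 1 x y" for x y
    unfolding g_def prod.case affine_coords_abs_proj[OF nz] by (simp add: vec_eq_iff)
  have inj: "inj_on g Z"
  proof (rule inj_onI, clarify)
    fix x y x' y' assume "g (x, y) = g (x', y')"
    from arg_cong[OF this, of "affine_coords 0"] have "point3 1 x y = point3 1 x' y'" by (simp only: coords)
    from arg_cong[OF this, of "\<lambda>v. v $ 1"] arg_cong[OF this, of "\<lambda>v. v $ 2"]
    show "x = x' \<and> y = y'" by simp
  qed
  have "g ` Z = curve R \<inter> curve S"
  proof (intro equalityI subsetI)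
    fix p assume p: "p \<in> curve R \<inter> curve S"
    then have p0: "p \<in> affine_part 0" using assms(1) by (auto simp: meet_transversally_def)
    define u where "u = affine_coords 0 p"
    have "u = point3 1 (u $ 1) (u $ 2)" using p0 by (simp add: vec_eq_iff forall_3' u_def)
    then have "g (u $ 1, u $ 2) = p" using abs_proj_affine_coords[OF p0] by (simp add: g_def u_def)
    moreover have "(u $ 1, u $ 2) \<in> Z" using mem[of "u $ 1" "u $ 2"] p calculation by simp
    ultimately show "p \<in> g ` Z" by blast
  qed (use mem in auto)
  then have "bij_betw g Z (curve R \<inter> curve S)" using inj by (simp add: bij_betw_def)
  then show "finite Z" "card Z = total_degree R * total_degree S"
    using assms(1) bij_betw_finite bij_betw_same_card unfolding meet_transversally_def by metis+
qed

text \<open>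
  The first component follows from Euler's relation \<open>\<Sum> u\<^sub>i F\<^sub>i = n F = 0\<close>.
\<close>

lemma gradient_homogenize:
  assumes "eval_xy F x y = 0"
  shows "gradient (homogenize F) (point3 1 x y) =
    point3 (- (x * eval_xy (diff_x F) x y + y * eval_xy (diff_y F) x y)) (eval_xy (diff_x F) x y) (eval_xy (diff_y F) x y)"
proof -
  have const: "((\<lambda>w. c) has_derivative (\<lambda>h. 0)) (at (x :: complex))" for c x :: complex by simp
  have ident: "((\<lambda>w. w) has_derivative (\<lambda>h. h)) (at (x :: complex))" for x :: complex by simp
  have "((\<lambda>w. eval_xy F w y) has_field_derivative eval_xy (diff_x F) x y) (at x)"
    using has_derivative_eval_xy[OF ident[of x] const[of y x], of F] by (simp add: has_field_derivative_def)
  then have 1: "gradient (homogenize F) (point3 1 x y) $ 1 = eval_xy (diff_x F) x y"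
    by (simp add: gradient_def point3_update homogenize_affine DERIV_imp_deriv)
  have "((\<lambda>w. eval_xy F x w) has_field_derivative eval_xy (diff_y F) x y) (at y)"
    using has_derivative_eval_xy[OF const[of x y] ident[of y], of F] by (simp add: has_field_derivative_def)
  then have 2: "gradient (homogenize F) (point3 1 x y) $ 2 = eval_xy (diff_y F) x y"
    by (simp add: gradient_def point3_update homogenize_affine DERIV_imp_deriv)
  have quot: "((\<lambda>w. c / w) has_derivative (\<lambda>h. - c * h)) (at (1 :: complex))" for c :: complex
    by (auto intro!: derivative_eq_intros)
  have "((\<lambda>w. eval_xy F (x / w) (y / w)) has_field_derivative - (x * eval_xy (diff_x F) x y + y * eval_xy (diff_y F) x y)) (at 1)"
    using has_derivative_eval_xy[OF quot[of x] quot[of y], of F] unfolding has_field_derivative_def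
    by (rule has_derivative_eq_rhs) (auto simp: algebra_simps)
  then have "((\<lambda>w. w ^ total_degree F * eval_xy F (x / w) (y / w)) has_field_derivative
      - (x * eval_xy (diff_x F) x y + y * eval_xy (diff_y F) x y)) (at 1)"
    using assms by (auto intro!: derivative_eq_intros)
  moreover have ev: "\<forall>\<^sub>F w in nhds 1. w ^ total_degree F * eval_xy F (x / w) (y / w) = homogenize F (point3 w x y)"
  proof -
    have "\<forall>\<^sub>F w in nhds 1. w \<in> - {0 :: complex}" by (rule eventually_nhds_in_open) auto
    then show ?thesis by (rule eventually_mono) (simp add: homogenize_nonzero)
  qed
  ultimately have "((\<lambda>w. homogenize F (point3 w x y)) has_field_derivative
      - (x * eval_xy (diff_x F) x y + y * eval_xy (diff_y F) x y)) (at 1)"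
    using DERIV_cong_ev[OF refl ev refl] by blast
  then have 0: "gradient (homogenize F) (point3 1 x y) $ 0 = - (x * eval_xy (diff_x F) x y + y * eval_xy (diff_y F) x y)"
    by (simp add: gradient_def point3_update DERIV_imp_deriv)
  show ?thesis unfolding vec_eq_iff forall_3' using 0 1 2 by simp
qed

text \<open>
  Transversality is stated for projective gradients. Their components of index \<open>0\<close> are combinations of the other two by
  Euler's relation, so linear independence is already visible on the affine partial derivatives.
\<close>

lemma transversal_jacobian:
  assumes "meet_transversally R S" "eval_xy R x y = 0" "eval_xy S x y = 0"
  shows "eval_xy (diff_x R) x y * eval_xy (diff_y S) x y - eval_xy (diff_y R) x y * eval_xy (diff_x S) x y \<noteq> 0"
proof
  define Rx Ry Sx Sy where defs: "Rx = eval_xy (diff_x R) x y" "Ry = eval_xy (diff_y R) x y"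
    "Sx = eval_xy (diff_x S) x y" "Sy = eval_xy (diff_y S) x y"
  assume "eval_xy (diff_x R) x y * eval_xy (diff_y S) x y - eval_xy (diff_y R) x y * eval_xy (diff_x S) x y = 0"
  then have \<Delta>: "Rx * Sy = Ry * Sx" by (simp add: defs)
  have nz: "point3 1 x y \<noteq> 0" using nth_nonzero_imp_nonzero[of "point3 1 x y" 0] by simp
  have indep: "a = 0 \<and> b = 0" if "a * Rx + b * Sx = 0" "a * Ry + b * Sy = 0" for a b
  proof -
    let ?c = "\<lambda>k :: nat. if k = 0 then a else b"
    have "a * (x * Rx + y * Ry) + b * (x * Sx + y * Sy) = x * (a * Rx + b * Sx) + y * (a * Ry + b * Sy)"
      by (simp add: algebra_simps)
    then have e0: "a * (x * Rx + y * Ry) + b * (x * Sx + y * Sy) = 0" using that by simp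
    have "a * - (x * Rx + y * Ry) + b * - (x * Sx + y * Sy) = - (a * (x * Rx + y * Ry) + b * (x * Sx + y * Sy))"
      by (simp add: algebra_simps)
    then have e1: "a * - (x * Rx + y * Ry) + b * - (x * Sx + y * Sy) = 0" unfolding e0 by simp
    have "a *s point3 (- (x * Rx + y * Ry)) Rx Ry + b *s point3 (- (x * Sx + y * Sy)) Sx Sy = 0"
      unfolding vec_eq_iff forall_3'
      by (simp only: vector_add_component vector_smult_component point3_nth that e1 zero_index simp_thms)
    then have sum: "(\<Sum>k<length [homogenize R, homogenize S]. ?c k *s gradient ([homogenize R, homogenize S] ! k) (point3 1 x y)) = 0"
      by (simp add: lessThan_Suc gradient_homogenize[OF assms(2)] gradient_homogenize[OF assms(3)] defs[symmetric] add.commute)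
    have zero: "point3 1 x y \<noteq> 0 \<and> (\<forall>f\<in>set [homogenize R, homogenize S]. f (point3 1 x y) = 0)"
      using assms(2,3) nz by (simp add: homogenize_affine)
    have sm: "smooth_intersection [homogenize R, homogenize S :: complex ^ 3 \<Rightarrow> complex]"
      using assms(1) by (simp add: meet_transversally_def)
    note sm' = sm[unfolded smooth_intersection_def, rule_format, OF zero sum]
    from sm'[of 0] sm'[of 1] show ?thesis by simp
  qed
  have "Sx = 0 \<and> - Rx = 0" using indep[of Sx "- Rx"] \<Delta> by (simp add: mult.commute)
  moreover have "Sy = 0 \<and> - Ry = 0" using indep[of Sy "- Ry"] \<Delta> by (simp add: mult.commute)
  ultimately show False using indep[of 1 0] by simp
qed

section \<open>An explicit chart of the surface\<close>

lemma holo_compose: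
  assumes f: "f holomorphic_on U" "open U" and g: "holomorphic_fun_on V g" "\<And>s. s \<in> V \<Longrightarrow> g s \<in> U"
  shows "holomorphic_fun_on V (\<lambda>s. f (g s))"
  unfolding holomorphic_fun_on_def
proof
  fix s assume s: "s \<in> V"
  have "(f has_field_derivative deriv f (g s)) (at (g s))"
    using holomorphic_derivI[OF f(1,2) g(2)[OF s]] .
  from diff_chain_at[OF holo_pointD(1)[OF g(1) s] this[unfolded has_field_derivative_def]]
  have "((\<lambda>s. f (g s)) has_derivative (\<lambda>v. deriv f (g s) * frechet_derivative g (at s) v)) (at s)"
    by (simp add: o_def)
  then show "\<exists>D. ((\<lambda>s. f (g s)) has_derivative D) (at s) \<and> (\<forall>c v. D (c *s v) = c * D v)"
    using holo_pointD(2)[OF g(1) s] by (intro exI[of _ "\<lambda>v. deriv f (g s) * frechet_derivative g (at s) v"]) simp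
qed

lemma has_derivative_vec_componentwise:
  fixes f :: "'a::real_normed_vector \<Rightarrow> complex ^ 'n::finite"
  assumes "\<And>k. ((\<lambda>s. f s $ k) has_derivative (\<lambda>v. D v $ k)) (at s)"
  shows "(f has_derivative D) (at s)"
proof (rule has_derivative_componentwise_within[THEN iffD2], rule ballI)
  fix b :: "complex ^ 'n" assume "b \<in> Basis"
  then obtain k c where b: "b = axis k c" by (auto simp: Basis_vec_def)
  have "((\<lambda>s. f s $ k \<bullet> c) has_derivative (\<lambda>v. D v $ k \<bullet> c)) (at s)"
    by (rule bounded_linear.has_derivative[OF bounded_linear_inner_left assms])
  then show "((\<lambda>x. f x \<bullet> b) has_derivative (\<lambda>x. D x \<bullet> b)) (at s)"
    by (simp add: b inner_axis)
qed

text \<open>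
  The open angular sector of half-angle \<open>\<pi>/n\<close>; the condition on the real part is only
  restrictive for \<open>n = 1\<close>.
\<close>

definition sector :: "nat \<Rightarrow> complex set" where
  "sector n = {\<zeta>. 0 < Re \<zeta> \<and> \<bar>Im (Ln \<zeta>)\<bar> < pi / n}"

lemma open_sector: "open (sector n)"
proof -
  have 1: "open {\<zeta>. 0 < Re \<zeta>}" by (rule open_halfspace_Re_gt)
  have "continuous_on {\<zeta>. 0 < Re \<zeta>} (\<lambda>\<zeta>. \<bar>Im (Ln \<zeta>)\<bar>)"
    by (intro continuous_intros) (auto simp: complex_nonpos_Reals_iff)
  then have "open ((\<lambda>\<zeta>. \<bar>Im (Ln \<zeta>)\<bar>) -` {..<pi / n} \<inter> {\<zeta>. 0 < Re \<zeta>})"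
    by (rule continuous_on_open_vimage[OF 1, THEN iffD1, rule_format, OF _ open_lessThan])
  moreover have "sector n = (\<lambda>\<zeta>. \<bar>Im (Ln \<zeta>)\<bar>) -` {..<pi / n} \<inter> {\<zeta>. 0 < Re \<zeta>}"
    by (auto simp: sector_def)
  ultimately show ?thesis by simp
qed

definition root_branch :: "nat \<Rightarrow> complex \<Rightarrow> complex" where
  "root_branch n w = exp (Ln w / n)"

text \<open>
  The sector singles out the principal branch by an open condition on the root. This is what makes
  the image of the chart built from such branches open in the surface.
\<close>

lemma root_branch:
  assumes "n \<ge> 1" "Re w > 0"
  shows "root_branch n w ^ n = w" "root_branch n w \<in> sector n"
    "\<And>\<zeta>. \<zeta> \<in> sector n \<Longrightarrow> \<zeta> ^ n = w \<Longrightarrow> \<zeta> = root_branch n w"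
proof -
  have w0: "w \<noteq> 0" using assms(2) by auto
  have "root_branch n w ^ n = exp (of_nat n * (Ln w / n))" by (simp only: root_branch_def exp_of_nat_mult)
  also have "\<dots> = w" using assms(1) w0 by simp
  finally show "root_branch n w ^ n = w" .
  have im: "\<bar>Im (Ln w)\<bar> < pi / 2" using assms(2) w0 Re_Ln_pos_lt by blast
  have im': "\<bar>Im (Ln w / n)\<bar> \<le> \<bar>Im (Ln w)\<bar>"
  proof -
    have "\<bar>Im (Ln w)\<bar> / real n \<le> \<bar>Im (Ln w)\<bar> / 1" using assms(1) by (intro divide_left_mono) auto
    then show ?thesis by (simp add: abs_divide)
  qed
  have "Ln (exp (Ln w / n)) = Ln w / n"
    using im im' pi_gt_zero by (intro Ln_exp) linarith+
  moreover have "Re (exp (Ln w / n)) > 0"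
  proof -
    have "- (pi / 2) < Im (Ln w / n)" "Im (Ln w / n) < pi / 2" using im im' by linarith+
    then show ?thesis unfolding Re_exp by (intro mult_pos_pos exp_gt_zero cos_gt_zero_pi)
  qed
  moreover have "\<bar>Im (Ln w / n)\<bar> < pi / n"
  proof -
    have "\<bar>Im (Ln w)\<bar> / real n < pi / real n"
      using im pi_gt_zero assms(1) by (intro divide_strict_right_mono) linarith+
    then show ?thesis by (simp add: abs_divide)
  qed
  ultimately show "root_branch n w \<in> sector n" by (simp add: sector_def root_branch_def)
  fix \<zeta> assume \<zeta>: "\<zeta> \<in> sector n" "\<zeta> ^ n = w"
  have \<zeta>0: "\<zeta> \<noteq> 0" using \<zeta>(1) by (auto simp: sector_def)
  have "\<bar>Im (of_nat n * Ln \<zeta>)\<bar> < pi"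
    using \<zeta>(1) assms(1) by (simp add: sector_def abs_mult field_simps)
  then have "Ln (exp (of_nat n * Ln \<zeta>)) = of_nat n * Ln \<zeta>" by (intro Ln_exp) linarith+
  moreover have "exp (of_nat n * Ln \<zeta>) = w" using \<zeta>0 \<zeta>(2) by (simp add: exp_of_nat_mult)
  ultimately have "Ln w / n = Ln \<zeta>" using assms(1) by simp
  then show "\<zeta> = root_branch n w" using \<zeta>0 by (simp add: root_branch_def)
qed

lemma holo_root_branch:
  assumes "holomorphic_fun_on V g" "\<And>s. s \<in> V \<Longrightarrow> Re (g s) > 0"
  shows "holomorphic_fun_on V (\<lambda>s. root_branch n (g s))"
  unfolding root_branch_def
proof (rule holo_compose[OF _ _ assms(1)])
  show "(\<lambda>w. exp (Ln w / of_nat n)) holomorphic_on {w. Re w > 0}"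
    by (intro holomorphic_intros) (auto simp: complex_nonpos_Reals_iff)
  show "open {w. Re w > 0}" by (rule open_halfspace_Re_gt)
qed (use assms(2) in auto)

lemma holo_vector_derivative:
  fixes f :: "complex ^ 'k::finite \<Rightarrow> complex ^ 'n::finite"
  assumes "\<And>k. holomorphic_fun_on V (\<lambda>s. f s $ k)" "s \<in> V"
  shows "(f has_derivative (\<lambda>v. \<chi> k. frechet_derivative (\<lambda>s. f s $ k) (at s) v)) (at s)"
  using holo_pointD(1)[OF assms] by (intro has_derivative_vec_componentwise) simp

text \<open>
  A graph over the \<open>(x, y)\<close>-plane: the inverse is the projection, and injectivity of the derivative in
  the coordinates of index \<open>0\<close> carries over to the other affine coordinates by the quotient rule.
\<close>

lemma graph_chart:
  fixes P :: "complex ^ 2 \<Rightarrow> complex ^ 5" and X :: "5 proj set"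
  assumes V: "open V" and P: "\<And>k. holomorphic_fun_on V (\<lambda>s. P s $ k)"
    and P012: "\<And>s. s \<in> V \<Longrightarrow> P s $ 0 = 1 \<and> P s $ 1 = s $ 1 \<and> P s $ 2 = s $ 2"
    and img: "openin (top_of_set X) ((\<lambda>s. abs_proj (P s)) ` V)"
  shows "(V, \<lambda>s. abs_proj (P s)) \<in> charts X"
proof -
  let ?\<phi> = "\<lambda>s. abs_proj (P s)"
  have nz: "P s \<noteq> 0" if "s \<in> V" for s using P012[OF that] nth_nonzero_imp_nonzero[of "P s" 0] by simp
  have coords: "affine_coords 0 (?\<phi> s) = P s" if "s \<in> V" for s
    unfolding affine_coords_abs_proj[OF nz[OF that]] using P012[OF that] by (simp add: vec_eq_iff)
  have aff0: "?\<phi> s \<in> affine_part 0" if "s \<in> V" for s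
    using abs_proj_in_affine_part[OF nz[OF that], of 0] P012[OF that] by simp
  have contP: "continuous_on V P"
    using holo_vector_derivative[OF P] by (meson continuous_at_imp_continuous_on has_derivative_continuous)
  have cont: "continuous_on V ?\<phi>"
    by (rule continuous_on_compose2[OF continuous_on_abs_proj contP]) (use nz in auto)
  define \<kappa> :: "5 proj \<Rightarrow> complex ^ 2" where
    "\<kappa> = (\<lambda>p. \<chi> k. if k = 1 then affine_coords 0 p $ 1 else affine_coords 0 p $ 2)"
  have "continuous_on (affine_part 0) \<kappa>"
    unfolding \<kappa>_def
  proof (rule continuous_on_vec_lambda)
    have "continuous_on (affine_part 0) (\<lambda>p :: 5 proj. affine_coords 0 p $ i)" for i
      by (intro continuous_intros continuous_on_affine_coords)
    then show "continuous_on (affine_part 0) (\<lambda>p :: 5 proj. if k = 1 then affine_coords 0 p $ 1 else affine_coords 0 p $ 2)" for k :: 2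
      by (cases "k = 1") auto
  qed
  then have cont\<kappa>: "continuous_on (?\<phi> ` V) \<kappa>" by (rule continuous_on_subset) (use aff0 in auto)
  have \<kappa>: "\<kappa> (?\<phi> s) = s" if "s \<in> V" for s
    using P012[OF that] unfolding \<kappa>_def coords[OF that] by (simp add: vec_eq_iff forall_2)
  have homeo: "homeomorphism V (?\<phi> ` V) ?\<phi> \<kappa>"
    by (rule homeomorphismI[OF cont cont\<kappa>]) (use \<kappa> in auto)
  have der: "\<exists>D. ((affine_coords i \<circ> ?\<phi>) has_derivative D) (at s) \<and> (\<forall>c v. D (c *s v) = c *s D v) \<and> inj D"
    if s: "s \<in> V" and i: "?\<phi> s \<in> affine_part i" for s i
  proof -
    define W where "W = {s \<in> V. P s $ i \<noteq> 0}"
    have sW: "s \<in> W" using s i abs_proj_in_affine_part[OF nz[OF s]] by (simp add: W_def)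
    have "continuous_on V (\<lambda>s. P s $ i)" by (rule holo_imp_continuous_on[OF P])
    then have "open ((\<lambda>s. P s $ i) -` (- {0}) \<inter> V)"
      using continuous_on_open_vimage[OF V] by (metis open_Compl closed_singleton)
    then have W: "open W" by (simp add: W_def vimage_def Int_def conj_commute)
    have PW: "holomorphic_fun_on W (\<lambda>s. P s $ k)" for k
      by (rule holo_subset[OF P]) (auto simp: W_def)
    let ?g = "\<lambda>s. \<chi> k. P s $ k / P s $ i"
    have g: "holomorphic_fun_on W (\<lambda>s. ?g s $ k)" for k
      using holo_divide[OF PW PW, of i k] by (simp add: W_def)
    define D where "D = (\<lambda>v. \<chi> k. frechet_derivative (\<lambda>s. ?g s $ k) (at s) v)"
    have D: "(?g has_derivative D) (at s)" unfolding D_def by (rule holo_vector_derivative[OF g sW])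
    have "((affine_coords i \<circ> ?\<phi>) has_derivative D) (at s)"
      by (rule has_derivative_transform_within_open[OF D W sW])
         (use nz in \<open>auto simp: W_def affine_coords_abs_proj\<close>)
    moreover have "D (c *s v) = c *s D v" for c v
      unfolding D_def vec_eq_iff using holo_pointD(2)[OF g sW] by simp
    moreover have "inj D"
    proof -
      have lin: "linear D" using D has_derivative_linear by blast
      have "v = 0" if "D v = 0" for v
      proof -
        let ?P' = "\<lambda>k. frechet_derivative (\<lambda>s. P s $ k) (at s) v"
        have nzi: "P s $ i \<noteq> 0" using sW by (simp add: W_def)
        have cross: "?P' k * P s $ i = P s $ k * ?P' i" for k
        proof -
          have "((\<lambda>s. P s $ k / P s $ i) has_derivative
              (\<lambda>v. (frechet_derivative (\<lambda>s. P s $ k) (at s) v * P s $ i - P s $ k * frechet_derivative (\<lambda>s. P s $ i) (at s) v) / (P s $ i * P s $ i))) (at s)"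
            by (rule has_derivative_divide'[OF holo_pointD(1)[OF P s] holo_pointD(1)[OF P s] nzi])
          from fun_cong[OF frechet_derivative_at[OF this], of v]
          have "(?P' k * P s $ i - P s $ k * ?P' i) / (P s $ i * P s $ i) = D v $ k"
            by (simp add: D_def)
          then show ?thesis using that nzi by simp
        qed
        have P'0: "?P' 0 = 0"
        proof -
          have "((\<lambda>s. P s $ 0) has_derivative (\<lambda>v. 0)) (at s)"
            by (rule has_derivative_transform_within_open[OF has_derivative_const[of 1] V s]) (use P012 in simp)
          from fun_cong[OF frechet_derivative_at[OF this], of v] show ?thesis by simp
        qed
        have P'k: "?P' k = v $ l" if "\<And>s. s \<in> V \<Longrightarrow> P s $ k = s $ l" for k l
        proof -
          have "((\<lambda>s. s $ l) has_derivative (\<lambda>v. v $ l)) (at s)"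
            by (rule bounded_linear_imp_has_derivative[OF bounded_linear_vec_nth])
          then have "((\<lambda>s. P s $ k) has_derivative (\<lambda>v. v $ l)) (at s)"
            by (rule has_derivative_transform_within_open[OF _ V s]) (use that in simp)
          from fun_cong[OF frechet_derivative_at[OF this], of v] show ?thesis by simp
        qed
        have "?P' i = 0" using cross[of 0] P'0 P012[OF s] by simp
        then have "?P' k = 0" for k using cross[of k] nzi by simp
        then have "v $ 1 = 0" "v $ 2 = 0" using P'k[of 1 1] P'k[of 2 2] P012 by auto
        then show "v = 0" by (simp add: vec_eq_iff forall_2)
      qed
      then show ?thesis using linear_injective_0[OF lin] by blast
    qed
    ultimately show ?thesis by blast
  qed
  show ?thesis unfolding charts_def using V img homeo der by blast
qed

lemma holo_eval_coords: "holomorphic_fun_on V (\<lambda>s. eval_xy F (s $ 1) (s $ 2))"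
  by (intro holo_eval_xy holo_nth)

lemma open_Re_quotient_pos:
  "open {s :: complex ^ 'n::finite. Re (eval_xy F (s $ i) (s $ j) / c) > 0}"
proof -
  have "continuous_on UNIV (\<lambda>s :: complex ^ 'n. eval_xy F (s $ i) (s $ j))"
    unfolding eval_xy_altdef by (intro continuous_intros)
  then have "continuous_on UNIV (\<lambda>s :: complex ^ 'n. Re (eval_xy F (s $ i) (s $ j) * (1 / c)))"
    by (intro continuous_intros)
  then show ?thesis using open_Collect_less[of "\<lambda>s. 0" "\<lambda>s. Re (eval_xy F (s $ i) (s $ j) * (1 / c))"] by simp
qed

text \<open>
  Over the region where \<open>R\<close> and \<open>S\<close> divided by their values at the base point have positive
  real part, \<open>z\<close> and \<open>t\<close> are given by branches of roots.
\<close>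

lemma surface_chart_exists:
  assumes d: "total_degree R \<ge> 1" and e: "total_degree S \<ge> 1"
    and nz: "eval_xy R x0 y0 \<noteq> 0" "eval_xy S x0 y0 \<noteq> 0" "y0 \<noteq> 0"
  shows "\<exists>(V :: (complex ^ 2) set) P. open V \<and> vector [x0, y0] \<in> V \<and> (V, \<lambda>s. abs_proj (P s)) \<in> charts (surface R S) \<and>
    (\<forall>s\<in>V. P s $ 0 = 1 \<and> P s $ 1 = s $ 1 \<and> P s $ 2 = s $ 2 \<and> P s $ 2 \<noteq> 0 \<and> P s $ 3 \<noteq> 0 \<and> P s $ 4 \<noteq> 0)"
proof -
  define R0 S0 where "R0 = eval_xy R x0 y0" and "S0 = eval_xy S x0 y0"
  obtain z0 where z0: "R0 = z0 ^ total_degree R" using exists_complex_root[of "total_degree R" R0] d by auto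
  obtain t0 where t0: "S0 = t0 ^ total_degree S" using exists_complex_root[of "total_degree S" S0] e by auto
  have nz0: "R0 \<noteq> 0" "S0 \<noteq> 0" "z0 \<noteq> 0" "t0 \<noteq> 0"
    using nz z0 t0 d e by (auto simp: R0_def S0_def power_0_left)
  define r where "r = (\<lambda>s :: complex ^ 2. eval_xy R (s $ 1) (s $ 2) / R0)"
  define s' where "s' = (\<lambda>s :: complex ^ 2. eval_xy S (s $ 1) (s $ 2) / S0)"
  define V :: "(complex ^ 2) set" where "V = {s. Re (r s) > 0} \<inter> {s. Re (s' s) > 0} \<inter> {s. s $ 2 \<noteq> 0}"
  have V: "open V"
    unfolding V_def r_def s'_def
    by (intro open_Int open_Re_quotient_pos open_Collect_neq continuous_intros)
  have mem: "vector [x0, y0] \<in> V" using nz nz0 by (simp add: V_def r_def s'_def flip: R0_def S0_def)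
  define z where "z = (\<lambda>s. z0 * root_branch (total_degree R) (r s))"
  define t where "t = (\<lambda>s. t0 * root_branch (total_degree S) (s' s))"
  define P where "P = (\<lambda>s :: complex ^ 2. point5 1 (s $ 1) (s $ 2) (z s) (t s))"
  have zV: "z s ^ total_degree R = eval_xy R (s $ 1) (s $ 2)" "t s ^ total_degree S = eval_xy S (s $ 1) (s $ 2)"
    "z s / z0 \<in> sector (total_degree R)" "t s / t0 \<in> sector (total_degree S)" if "s \<in> V" for s
    using that root_branch(1,2)[OF d, of "r s"] root_branch(1,2)[OF e, of "s' s"] nz0
    by (auto simp: V_def z_def t_def power_mult_distrib z0[symmetric] t0[symmetric] r_def s'_def)
  have hol: "holomorphic_fun_on V (\<lambda>s. P s $ k)" for k
  proof -
    have r: "holomorphic_fun_on V r" "holomorphic_fun_on V s'"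
      unfolding r_def s'_def using nz0 by (intro holo_divide holo_eval_coords holo_const; simp)+
    have zt: "holomorphic_fun_on V z" "holomorphic_fun_on V t"
      unfolding z_def t_def by (intro holo_mult holo_const holo_root_branch r; simp add: V_def)+
    have "\<forall>k. holomorphic_fun_on V (\<lambda>s. P s $ k)"
      unfolding forall_5 by (simp add: P_def holo_const holo_nth zt)
    then show ?thesis by blast
  qed
  have nzP: "P s \<noteq> 0" for s using nth_nonzero_imp_nonzero[of "P s" 0] by (simp add: P_def)
  define \<Omega> :: "(complex ^ 5) set" where "\<Omega> = {q. Re (eval_xy R (q $ 1) (q $ 2) / R0) > 0} \<inter>
     {q. Re (eval_xy S (q $ 1) (q $ 2) / S0) > 0} \<inter> {q. q $ 2 \<noteq> 0} \<inter>
     (\<lambda>q. q $ 3 / z0) -` sector (total_degree R) \<inter> (\<lambda>q. q $ 4 / t0) -` sector (total_degree S)"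
  have "open \<Omega>"
    unfolding \<Omega>_def
    using nz0
    by (intro open_Int open_Re_quotient_pos open_Collect_neq open_vimage open_sector continuous_intros) auto
  then have U: "open (affine_coords 0 -` \<Omega> \<inter> affine_part 0)"
    using continuous_on_affine_coords continuous_on_open_vimage[OF open_affine_part] by blast
  have "(\<lambda>s. abs_proj (P s)) ` V = surface R S \<inter> (affine_coords 0 -` \<Omega> \<inter> affine_part 0)"
  proof (intro equalityI subsetI)
    fix p assume "p \<in> (\<lambda>s. abs_proj (P s)) ` V"
    then obtain s where s: "s \<in> V" "p = abs_proj (P s)" by blast
    have "p \<in> surface R S"
      unfolding s(2) abs_proj_in_surface_iff[OF nzP] eqn_z_def eqn_t_def
      using zV(1,2)[OF s(1)] by (simp add: homogenize_affine P_def)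
    moreover have "affine_coords 0 p = P s"
      unfolding s(2) affine_coords_abs_proj[OF nzP] by (simp add: vec_eq_iff P_def)
    moreover have "p \<in> affine_part 0"
      unfolding s(2) abs_proj_in_affine_part[OF nzP] by (simp add: P_def)
    moreover have "P s \<in> \<Omega>"
      using s(1) zV(3,4)[OF s(1)] by (simp add: \<Omega>_def P_def V_def r_def s'_def)
    ultimately show "p \<in> surface R S \<inter> (affine_coords 0 -` \<Omega> \<inter> affine_part 0)" by simp
  next
    fix p assume p: "p \<in> surface R S \<inter> (affine_coords 0 -` \<Omega> \<inter> affine_part 0)"
    define q where "q = affine_coords 0 p"
    have p0: "p \<in> affine_part 0" and q\<Omega>: "q \<in> \<Omega>" using p by (auto simp: q_def)
    have eqs: "q $ 3 ^ total_degree R = eval_xy R (q $ 1) (q $ 2)" "q $ 4 ^ total_degree S = eval_xy S (q $ 1) (q $ 2)"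
      using surface_affine_coords[of p R S] p by (auto simp: q_def)
    define s :: "complex ^ 2" where "s = vector [q $ 1, q $ 2]"
    have s12: "s $ 1 = q $ 1" "s $ 2 = q $ 2" by (simp_all add: s_def)
    have sV: "s \<in> V" using q\<Omega> by (simp add: V_def \<Omega>_def r_def s'_def s12)
    have "q $ 3 / z0 = root_branch (total_degree R) (r s)"
      using root_branch(3)[OF d, of "r s" "q $ 3 / z0"] q\<Omega> sV nz0
      by (simp add: V_def \<Omega>_def r_def s12 power_divide eqs z0[symmetric])
    then have "q $ 3 = z s" using nz0 by (simp add: z_def field_simps)
    moreover have "q $ 4 / t0 = root_branch (total_degree S) (s' s)"
      using root_branch(3)[OF e, of "s' s" "q $ 4 / t0"] q\<Omega> sV nz0
      by (simp add: V_def \<Omega>_def s'_def s12 power_divide eqs t0[symmetric])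
    then have "q $ 4 = t s" using nz0 by (simp add: t_def field_simps)
    moreover have "q $ 0 = 1" using p0 by (simp add: q_def)
    ultimately have "q = P s" by (simp add: vec_eq_iff forall_5 P_def s12)
    then have "p = abs_proj (P s)" using abs_proj_affine_coords[OF p0] by (simp add: q_def)
    then show "p \<in> (\<lambda>s. abs_proj (P s)) ` V" using sV by blast
  qed
  then have img: "openin (top_of_set (surface R S)) ((\<lambda>s. abs_proj (P s)) ` V)"
    using U by (auto simp: openin_open)
  have "(V, \<lambda>s. abs_proj (P s)) \<in> charts (surface R S)"
    by (rule graph_chart[OF V hol _ img]) (simp add: P_def)
  moreover have "P s $ 3 \<noteq> 0 \<and> P s $ 4 \<noteq> 0" if "s \<in> V" for s
    using zV(3,4)[OF that] by (auto simp: P_def sector_def)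
  moreover have "P s $ 0 = 1 \<and> P s $ 1 = s $ 1 \<and> P s $ 2 = s $ 2" for s by (simp add: P_def)
  moreover have "P s $ 2 \<noteq> 0" if "s \<in> V" for s using that by (simp add: P_def V_def)
  ultimately show ?thesis using V mem by (intro exI[of _ V] exI[of _ P] conjI) auto
qed

section \<open>Independent sections\<close>

lemma eval_jet_J_linear:
  "eval_jet (jet_J R S m a A) x y x' y' =
    (\<Sum>\<iota>\<in>coeff_indices m a. A \<iota> * eval_jet (jet_term R S m \<iota>) x y x' y')"
  unfolding jet_J_eq_sum by simp

lemma jet_vanishing_on_open:
  fixes V :: "(complex ^ 2) set"
  assumes V: "open V" "s0 \<in> V" and J: "\<And>s. s \<in> V \<Longrightarrow> eval_jet P (s $ 1) (s $ 2) x' y' = 0"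
  shows "eval_jet P x y x' y' = 0"
proof -
  define Q where "Q = poly (poly P [:[:[:y':]:]:]) [:[:x':]:]"
  have Q: "eval_jet P x y x' y' = eval_xy Q x y" for x y by (simp add: eval_jet_def Q_def)
  obtain e where e: "e > 0" "ball s0 e \<subseteq> V" using V open_contains_ball by blast
  have inf: "infinite (ball c (e / 2))" for c :: complex
    using uncountable_ball[of "e / 2" c] e(1) countable_finite by auto
  have zero: "eval_xy Q x y = 0" if "x \<in> ball (s0 $ 1) (e / 2)" "y \<in> ball (s0 $ 2) (e / 2)" for x y
  proof -
    define s :: "complex ^ 2" where "s = vector [x, y]"
    have "norm (s - s0) \<le> (\<Sum>k\<in>UNIV. norm ((s - s0) $ k))" unfolding norm_vec_def by (rule L2_set_le_sum) simp
    also have "\<dots> = norm (x - s0 $ 1) + norm (y - s0 $ 2)" by (simp add: sum_2 s_def)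
    also have "\<dots> < e" using that by (simp add: dist_norm norm_minus_commute)
    finally have "s \<in> V" using e(2) by (auto simp: dist_norm norm_minus_commute)
    then show ?thesis using J[of s] by (simp add: Q s_def)
  qed
  have "Q = 0"
  proof (rule eval_xy_eq_0_imp[OF inf[of "s0 $ 2"]])
    fix y assume y: "y \<in> ball (s0 $ 2) (e / 2)"
    have "ball (s0 $ 1) (e / 2) \<subseteq> {x. eval_xy Q x y = 0}" using zero[OF _ y] by blast
    then show "infinite {x. eval_xy Q x y = 0}" using inf finite_subset by blast
  qed
  then show ?thesis by (simp add: Q)
qed

text \<open>
  The sections induced by independent solutions are independent: a vanishing combination, read in the
  explicit chart, makes the jet polynomial of the combined family vanish on an open set, hence identically.
\<close>

lemma sections_dimension_ge:
  assumes G: "generic_conditions R S" and d: "total_degree R \<ge> 1" "total_degree R \<le> total_degree S"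
    and m: "m \<ge> 1" and a: "a \<le> int (total_degree R) - 4 * int m"
    and B: "finite B" "cfun.independent B" "B \<subseteq> solutions R S m a"
  shows "enat (card B) \<le> cfun_edim (holomorphic_sections (surface R S) m)"
proof -
  let ?X = "surface R S"
  have e: "total_degree S \<ge> 1" using d by simp
  have G': "G1 R S" "G2 R S" "G6 R S" using G by (auto simp: generic_conditions_def)
  define Q where "Q = (\<lambda>b \<omega>. \<omega> \<in> holomorphic_sections ?X m \<and>
    (\<forall>V \<phi> s v. (V, \<phi>) \<in> charts ?X \<longrightarrow> s \<in> V \<longrightarrow> \<phi> s \<in> affine_part 0 \<longrightarrow> affine_coords 0 (\<phi> s) $ 2 \<noteq> 0 \<longrightarrow>
      affine_coords 0 (\<phi> s) $ 3 \<noteq> 0 \<longrightarrow> affine_coords 0 (\<phi> s) $ 4 \<noteq> 0 \<longrightarrow>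
      \<omega> ((V, \<phi>), s, v) = jet_differential R S m a b (affine_coords 0 (\<phi> s)) (frechet_derivative (affine_coords 0 \<circ> \<phi>) (at s) v)))"
  have "\<exists>\<omega>. Q b \<omega>" if "b \<in> B" for b
  proof -
    have "var_y ^ total_degree R dvd jet_J R S m a b" using that B(3) by (auto simp: solutions_def)
    from jet_differential_extends[OF G'(1,3) d(1) e a this] obtain \<omega> where
      \<omega>: "\<omega> \<in> holomorphic_sections ?X m" and eq: "\<forall>(V, \<phi>)\<in>charts ?X. \<forall>s\<in>V. \<phi> s \<in> affine_part 0 \<inter>
       {p. affine_coords 0 p \<in> {q. q $ 2 \<noteq> 0 \<and> q $ 3 \<noteq> 0 \<and> q $ 4 \<noteq> 0}} \<longrightarrow>
     (\<forall>v. \<omega> ((V, \<phi>), s, v) = jet_differential R S m a b (affine_coords 0 (\<phi> s)) (frechet_derivative (affine_coords 0 \<circ> \<phi>) (at s) v))"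
      unfolding restriction_holomorphic_def Let_def by (elim conjE bexE)
    have "Q b \<omega>"
      unfolding Q_def
    proof (intro conjI \<omega> allI impI)
      fix V and \<phi> :: "complex ^ 2 \<Rightarrow> 5 proj" and s v
      assume *: "(V, \<phi>) \<in> charts ?X" "s \<in> V" "\<phi> s \<in> affine_part 0" "affine_coords 0 (\<phi> s) $ 2 \<noteq> 0"
        "affine_coords 0 (\<phi> s) $ 3 \<noteq> 0" "affine_coords 0 (\<phi> s) $ 4 \<noteq> 0"
      show "\<omega> ((V, \<phi>), s, v) = jet_differential R S m a b (affine_coords 0 (\<phi> s)) (frechet_derivative (affine_coords 0 \<circ> \<phi>) (at s) v)"
        using bspec[OF eq *(1)] *(2-) by simp
    qed
    then show ?thesis by (rule exI[of _ \<omega>])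
  qed
  then have "\<forall>b\<in>B. \<exists>\<omega>. Q b \<omega>" by (rule ballI)
  from bchoice[OF this] obtain \<omega> where Q: "\<forall>b\<in>B. Q b (\<omega> b)" ..
  have \<omega>: "\<omega> b \<in> holomorphic_sections ?X m" if "b \<in> B" for b
    using Q that by (simp add: Q_def)
  have \<omega>_eq: "\<omega> b ((V, \<phi>), s, v) = jet_differential R S m a b (affine_coords 0 (\<phi> s)) (frechet_derivative (affine_coords 0 \<circ> \<phi>) (at s) v)"
    if "b \<in> B" "(V, \<phi>) \<in> charts ?X" "s \<in> V" "\<phi> s \<in> affine_part 0"
      "affine_coords 0 (\<phi> s) $ 2 \<noteq> 0" "affine_coords 0 (\<phi> s) $ 3 \<noteq> 0" "affine_coords 0 (\<phi> s) $ 4 \<noteq> 0" for b V \<phi> s v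
    using bspec[OF Q that(1)] that(2-) unfolding Q_def by blast
  have "[:0, 1:] * R * S \<noteq> 0" using d e by (auto simp: total_degree_def split: if_splits)
  then obtain x0 y0 where "eval_xy ([:0, 1:] * R * S) x0 y0 \<noteq> 0" using exists_nonroot by blast
  then have xy0: "eval_xy R x0 y0 \<noteq> 0" "eval_xy S x0 y0 \<noteq> 0" "y0 \<noteq> 0" by auto
  from surface_chart_exists[OF d(1) e xy0] obtain V :: "(complex ^ 2) set" and P where
    VP: "open V \<and> vector [x0, y0] \<in> V \<and> (V, \<lambda>s. abs_proj (P s)) \<in> charts (surface R S) \<and>
      (\<forall>s\<in>V. P s $ 0 = 1 \<and> P s $ 1 = s $ 1 \<and> P s $ 2 = s $ 2 \<and> P s $ 2 \<noteq> 0 \<and> P s $ 3 \<noteq> 0 \<and> P s $ 4 \<noteq> 0)"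
    by (elim exE)
  then have V: "open V" "vector [x0, y0] \<in> V" and chart: "(V, \<lambda>s. abs_proj (P s)) \<in> charts ?X" by simp_all
  have P: "P s $ 0 = 1 \<and> P s $ 1 = s $ 1 \<and> P s $ 2 = s $ 2 \<and> P s $ 2 \<noteq> 0 \<and> P s $ 3 \<noteq> 0 \<and> P s $ 4 \<noteq> 0" if "s \<in> V" for s
    using VP that by blast
  define \<alpha> where "\<alpha> = (V, \<lambda>s. abs_proj (P s))"
  have nzP: "P s \<noteq> 0" if "s \<in> V" for s using P[OF that] nth_nonzero_imp_nonzero[of "P s" 0] by simp
  have coords: "affine_coords 0 (abs_proj (P s)) = P s" if "s \<in> V" for s
    unfolding affine_coords_abs_proj[OF nzP[OF that]] using P[OF that] by (simp add: vec_eq_iff)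
  have aff0: "abs_proj (P s) \<in> affine_part 0" if "s \<in> V" for s
    using abs_proj_in_affine_part[OF nzP[OF that], of 0] P[OF that] by simp
  have dom: "s \<in> chart_dom \<alpha> 0" if "s \<in> V" for s using aff0[OF that] that by (simp add: chart_dom_def \<alpha>_def)
  have daff: "daff \<alpha> 0 s v $ k = v $ l" if s: "s \<in> V" and k: "\<And>s. s \<in> V \<Longrightarrow> P s $ k = s $ l" for s v k l
  proof -
    have "((\<lambda>s. s $ l) has_derivative (\<lambda>v. v $ l)) (at s)"
      by (rule bounded_linear_imp_has_derivative[OF bounded_linear_vec_nth])
    then have "((\<lambda>s. aff \<alpha> 0 s $ k) has_derivative (\<lambda>v. v $ l)) (at s)"
      by (rule has_derivative_transform_within_open[OF _ V(1) s]) (simp add: aff_def \<alpha>_def coords k)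
    from fun_cong[OF has_derivative_unique[OF aff_nth_derivative[OF chart[folded \<alpha>_def] dom[OF s], of k] this], of v]
    show ?thesis .
  qed
  have jet: "eval_jet (jet_J R S m a b) (s $ 1) (s $ 2) (v $ 1) (v $ 2) =
     \<omega> b (\<alpha>, s, v) * (P s $ 2 ^ total_degree R * P s $ 3 ^ (m * (total_degree R - 1)) * P s $ 4 ^ (m * (total_degree S - 1)))"
    if "b \<in> B" "s \<in> V" for b s and v :: "complex ^ 2"
  proof -
    have nz: "affine_coords 0 (abs_proj (P s)) $ 2 \<noteq> 0" "affine_coords 0 (abs_proj (P s)) $ 3 \<noteq> 0"
      "affine_coords 0 (abs_proj (P s)) $ 4 \<noteq> 0"
      using P[OF that(2)] unfolding coords[OF that(2)] by blast+
    have "\<omega> b (\<alpha>, s, v) = jet_differential R S m a b (P s) (daff \<alpha> 0 s v)"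
      using \<omega>_eq[OF that(1) chart that(2) aff0[OF that(2)] nz, of v]
      by (simp only: coords[OF that(2)] \<alpha>_def aff_def snd_conv)
    moreover have "daff \<alpha> 0 s v $ 1 = v $ 1" "daff \<alpha> 0 s v $ 2 = v $ 2"
      by (rule daff[OF that(2)]; simp add: P)+
    moreover have Ps: "P s $ 1 = s $ 1" "P s $ 2 = s $ 2" using P[OF that(2)] by blast+
    ultimately have "\<omega> b (\<alpha>, s, v) = eval_jet (jet_J R S m a b) (s $ 1) (s $ 2) (v $ 1) (v $ 2) /
       (P s $ 2 ^ total_degree R * P s $ 3 ^ (m * (total_degree R - 1)) * P s $ 4 ^ (m * (total_degree S - 1)))"
      by (simp only: jet_differential_def)
    moreover have "P s $ 2 ^ total_degree R * P s $ 3 ^ (m * (total_degree R - 1)) * P s $ 4 ^ (m * (total_degree S - 1)) \<noteq> 0"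
      using P[OF that(2)] by (metis mult_eq_0_iff power_not_zero)
    ultimately show ?thesis by (metis nonzero_eq_divide_eq)
  qed
  have T: "meet_transversally R S" using G'(2) by (simp add: G2_def)
  define Z where "Z = {(x, y). eval_xy R x y = 0 \<and> eval_xy S x y = 0}"
  note Z = affine_intersection[OF T, folded Z_def]
  have degR: "degree R = total_degree R"
  proof (rule antisym[OF degree_le_total_degree])
    have "coeff R (total_degree R) \<noteq> 0" using G'(1) by (auto simp: G1_def coeff_xy_def)
    then show "total_degree R \<le> degree R" by (rule le_degree)
  qed
  have indep: "u b = 0" if sum0: "(\<Sum>b\<in>B. (\<lambda>x. u b * \<omega> b x)) = 0" and b: "b \<in> B" for u b
  proof -
    define A where "A = (\<Sum>b\<in>B. (\<lambda>x. u b * b x))"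
    have fam: "A \<in> coeff_families m a"
      using B(3) unfolding A_def coeff_families_def solutions_def by (auto simp: sum_fun_apply intro!: sum.neutral)
    have lin: "eval_jet (jet_J R S m a A) x y x' y' = (\<Sum>b\<in>B. u b * eval_jet (jet_J R S m a b) x y x' y')" for x y x' y'
      unfolding eval_jet_J_linear A_def sum_fun_apply sum_distrib_left sum_distrib_right
      by (subst sum.swap) (simp add: mult.assoc)
    have van: "eval_jet (jet_J R S m a A) (s $ 1) (s $ 2) (v $ 1) (v $ 2) = 0" if s: "s \<in> V" for s and v :: "complex ^ 2"
    proof -
      let ?c = "P s $ 2 ^ total_degree R * P s $ 3 ^ (m * (total_degree R - 1)) * P s $ 4 ^ (m * (total_degree S - 1))"
      have "eval_jet (jet_J R S m a A) (s $ 1) (s $ 2) (v $ 1) (v $ 2) = (\<Sum>b\<in>B. u b * (\<omega> b (\<alpha>, s, v) * ?c))"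
        unfolding lin by (intro sum.cong refl) (simp only: jet s)
      also have "\<dots> = (\<Sum>b\<in>B. (\<lambda>x. u b * \<omega> b x)) (\<alpha>, s, v) * ?c"
        by (simp only: sum_fun_apply sum_distrib_right mult.assoc)
      also have "\<dots> = 0" unfolding sum0 by simp
      finally show ?thesis .
    qed
    have "eval_jet (jet_J R S m a A) x y x' y' = 0" for x y x' y'
      using jet_vanishing_on_open[OF V, of "jet_J R S m a A" x' y' x y] van[of _ "vector [x', y']"] by simp
    then have "A = (\<lambda>_. 0)"
    proof (rule jet_J_injective[where Z = Z, OF _ _ _ fam])
      show "eval_xy R x y = 0 \<and> eval_xy S x y = 0 \<and>
        eval_xy (diff_x R) x y * eval_xy (diff_y S) x y - eval_xy (diff_y R) x y * eval_xy (diff_x S) x y \<noteq> 0"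
        if "(x, y) \<in> Z" for x y
        using that transversal_jacobian[OF T, of x y] by (auto simp: Z_def)
      show "F = 0" if F: "tdeg_le F (nat a)" "\<And>x y. (x, y) \<in> Z \<Longrightarrow> eval_xy F x y = 0" for F
      proof (rule vanishing_on_complete_intersection[OF degR refl tdeg_le_total_degree _ Z(2) _ F(1) _ d(2)])
        show "nat a < total_degree R" using a m d(1) by linarith
        show "eval_xy F (fst z) (snd z) = 0" if "z \<in> Z" for z using F(2)[of "fst z" "snd z"] that by simp
      qed (use Z(1) in \<open>auto simp: Z_def\<close>)
    qed
    then have "(\<Sum>b\<in>B. (\<lambda>x. u b * b x)) = 0" by (simp add: A_def zero_fun_def)
    then show ?thesis using B(2) b cfun.dependent_finite[OF B(1)] by blast
  qed
  have inj: "inj_on \<omega> B" "cfun.independent (\<omega> ` B)"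
    using independent_image[OF B(1), of \<omega>] indep by blast+
  have "enat (card (\<omega> ` B)) \<le> cfun_edim (holomorphic_sections ?X m)"
    unfolding cfun_edim_def by (rule Sup_upper) (use inj(2) \<omega> B(1) in blast)
  then show ?thesis by (simp add: card_image[OF inj(1)])
qed

theorem mainTheorem1:
  fixes d e :: nat and R S :: "complex poly poly"
  assumes "752 \<le> d" and "d \<le> e" and "real e \<le> 1 / 648 * real d ^ 2"
    and "total_degree R = d" and "total_degree S = e"
    and "generic_conditions R S"
  shows
    "(\<forall>m a. 1 \<le> m \<and> a \<le> int d - 4 * int m \<longrightarrow>
        (\<forall>A\<in>coeff_families m a. var_y ^ d dvd jet_J R S m a A \<longrightarrow>
           restriction_holomorphic (surface R S) m
             {q. q $ 2 \<noteq> 0 \<and> q $ 3 \<noteq> 0 \<and> q $ 4 \<noteq> 0} (jet_differential R S m a A)))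
     \<and>
     (\<forall>m a. 1 \<le> m \<and> a \<le> int d - 4 * int m \<longrightarrow>
        (\<exists>E :: coeff_family set. finite E \<and>
           (\<forall>A\<in>coeff_families m a. var_y ^ d dvd jet_J R S m a A \<longleftrightarrow>
              (\<forall>l\<in>E. (\<Sum>\<iota>\<in>coeff_indices m a. l \<iota> * A \<iota>) = 0))) \<and>
        (0 \<le> a \<longrightarrow> real (card (coeff_indices m a)) =
           (real_of_int a + 1) * (real_of_int a + 2) / 2 *
           ((real m + 1) * (real m + 2) * (real m + 3) / (1 * 2 * 3))))
     \<and>
     (let m = nat \<lfloor>real d / 12\<rfloor>; a = int d - 4 * int m;
          bound = 1 / 93312 * real d ^ 3 - 61 / 7776 * real d ^ 2 - 17 / 108 * real d - 28 / 27
      in bound \<le> real (cfun.dim (solutions R S m a)) \<and>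
         ereal bound \<le> ereal_of_enat (cfun_edim (holomorphic_sections (surface R S) m)))"
proof (intro conjI)
  have R: "total_degree R \<ge> 1" and S: "total_degree S \<ge> 1" using assms by auto
  have G: "G1 R S" "G6 R S" using assms(6) by (auto simp: generic_conditions_def)
  show "\<forall>m a. 1 \<le> m \<and> a \<le> int d - 4 * int m \<longrightarrow>
        (\<forall>A\<in>coeff_families m a. var_y ^ d dvd jet_J R S m a A \<longrightarrow>
           restriction_holomorphic (surface R S) m
             {q. q $ 2 \<noteq> 0 \<and> q $ 3 \<noteq> 0 \<and> q $ 4 \<noteq> 0} (jet_differential R S m a A))"
    using jet_differential_extends[OF G R S] unfolding assms(4) by blast
  show "\<forall>m a. 1 \<le> m \<and> a \<le> int d - 4 * int m \<longrightarrow>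
        (\<exists>E :: coeff_family set. finite E \<and>
           (\<forall>A\<in>coeff_families m a. var_y ^ d dvd jet_J R S m a A \<longleftrightarrow>
              (\<forall>l\<in>E. (\<Sum>\<iota>\<in>coeff_indices m a. l \<iota> * A \<iota>) = 0))) \<and>
        (0 \<le> a \<longrightarrow> real (card (coeff_indices m a)) =
           (real_of_int a + 1) * (real_of_int a + 2) / 2 *
           ((real m + 1) * (real m + 2) * (real m + 3) / (1 * 2 * 3)))"
  proof (intro allI impI conjI)
    fix m :: nat and a :: int
    from divisibility_linear_system[where m = m and d = d and a = a and R = R and S = S]
    obtain E :: "coeff_family set" where E: "finite E \<and>
        card E \<le> (m + 1) * (\<Sum>i<d. nat a + m * (total_degree R + total_degree S) - i + 1) \<and>
        (\<forall>A. var_y ^ d dvd jet_J R S m a A \<longleftrightarrow> (\<forall>l\<in>E. (\<Sum>\<iota>\<in>coeff_indices m a. l \<iota> * A \<iota>) = 0))" ..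
    then show "\<exists>E :: coeff_family set. finite E \<and>
           (\<forall>A\<in>coeff_families m a. var_y ^ d dvd jet_J R S m a A \<longleftrightarrow>
              (\<forall>l\<in>E. (\<Sum>\<iota>\<in>coeff_indices m a. l \<iota> * A \<iota>) = 0))"
      by (intro exI[of _ E]) simp
  qed (rule card_coeff_indices)
  define m where "m = d div 12"
  define a where "a = int d - 4 * int m"
  define bound where "bound = 1 / 93312 * real d ^ 3 - 61 / 7776 * real d ^ 2 - 17 / 108 * real d - 28 / 27"
  have m: "nat \<lfloor>real d / 12\<rfloor> = m"
    using floor_divide_of_nat_eq[of d 12, where ?'a = real] by (simp add: m_def)
  have m1: "m \<ge> 1" using assms(1) by (simp add: m_def)
  have md: "4 * m \<le> d" by (simp add: m_def)
  have na: "nat a = d - 4 * m" and ra: "real_of_int a = real (d - 4 * m)" and a0: "0 \<le> a" using md by (auto simp: a_def)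
  from dim_solutions_ge[where a = a and m = m and R = R and S = S, unfolded assms(4,5)] obtain B where
    B': "finite B \<and> B \<subseteq> solutions R S m a \<and> cfun.independent B \<and> card B \<le> cfun.dim (solutions R S m a) \<and>
      card (coeff_indices m a) \<le> card B + (m + 1) * (\<Sum>i<d. nat a + m * (d + e) - i + 1)" ..
  then have B: "finite B" "B \<subseteq> solutions R S m a" "cfun.independent B" "card B \<le> cfun.dim (solutions R S m a)"
    "card (coeff_indices m a) \<le> card B + (m + 1) * (\<Sum>i<d. nat a + m * (d + e) - i + 1)"
    by simp_all
  have "real (card (coeff_indices m a)) \<le> real (card B) + (real m + 1) * real (\<Sum>i<d. (d - 4 * m) + m * (d + e) - i + 1)"
    using of_nat_mono[OF B(5), where ?'a = real] unfolding na by (simp only: of_nat_add of_nat_mult of_nat_1)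
  moreover have "real (card (coeff_indices m a)) =
      (real (d - 4 * m) + 1) * (real (d - 4 * m) + 2) / 2 * ((real m + 1) * (real m + 2) * (real m + 3) / 6)"
    unfolding card_coeff_indices[OF a0] ra by simp
  moreover note counting_inequality[OF assms(1,3), folded m_def bound_def]
  ultimately have "bound \<le> real (card B)" by linarith
  moreover have "enat (card B) \<le> cfun_edim (holomorphic_sections (surface R S) m)"
    by (rule sections_dimension_ge[OF assms(6) R _ m1 _ B(1,3,2)]) (use assms in \<open>simp_all add: a_def\<close>)
  then have "ereal_of_enat (enat (card B)) \<le> ereal_of_enat (cfun_edim (holomorphic_sections (surface R S) m))"
    by (simp only: ereal_of_enat_le_iff)
  then have "ereal (real (card B)) \<le> ereal_of_enat (cfun_edim (holomorphic_sections (surface R S) m))"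
    by simp
  moreover have "ereal bound \<le> ereal (real (card B))" using calculation(1) by simp
  ultimately have "bound \<le> real (cfun.dim (solutions R S m a)) \<and>
    ereal bound \<le> ereal_of_enat (cfun_edim (holomorphic_sections (surface R S) m))"
    using B(4) by (intro conjI) (linarith, rule order.trans)
  then show "let m = nat \<lfloor>real d / 12\<rfloor>; a = int d - 4 * int m;
          bound = 1 / 93312 * real d ^ 3 - 61 / 7776 * real d ^ 2 - 17 / 108 * real d - 28 / 27
      in bound \<le> real (cfun.dim (solutions R S m a)) \<and>
         ereal bound \<le> ereal_of_enat (cfun_edim (holomorphic_sections (surface R S) m))"
    unfolding Let_def m a_def bound_def .
qed

end
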